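(* Let $d\ge 1$ and let $S$ be an $n$-vertex combinatorial $(d-1)$-sphere. Then $S$ is a subcomplex of an $n$-vertex combinatorial $d$-sphere (so the two complexes have the same vertex set) in each of the following cases. (a) $S$ is a join of two or more combinatorial spheres, i.e. $S=S_1\ast\cdots\ast S_m$ with $m\ge 2$ and each $S_i$ a combinatorial sphere. (b) $S$ has a vertex of degree $d$, and $n\ge d+2$. (c) $S$ is a flag sphere.
   Context: Simplicial complexes are finite and identified with abstract simplicial complexes, so a face is a finite subset of the vertex set $V(X)$; isomorphic complexes are identified. An $n$-vertex complex is one with exactly $n$ vertices. For a simplicial complex $X$, $|X|$ denotes its geometric carrier with the induced PL structure. A simplicial complex $X$ is a combinatorial $k$-sphere if $|X|$ is PL homeomorphic to the boundary of a $(k+1)$-simplex; spheres have dimension $k\ge 0$, and a $0$-sphere consists of two points. The standard $k$-sphere $S^k_{k+2}$ is the boundary complex of a $(k+1)$-simplex (it has $k+2$ vertices). The degree of a vertex $v$ in $X$ is the number of edges of $X$ containing $v$. For complexes $X,Y$ with disjoint vertex sets, the join is $X\ast Y = X\cup Y\cup\{\alpha\cup\beta : \alpha\in X,\ \beta\in Y\}$. A clique in $X$ is a subset $U\subseteq V(X)$ such that every pair of distinct vertices of $U$ forms an edge of $X$. A combinatorial $k$-sphere $S$ is called flag if $S\ne S^k_{k+2}$ and every clique in $S$ is a simplex of $S$. *)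

theory Defs
  imports "HOL-Analysis.Analysis" "HOL-Analysis.Finite_Function_Topology"
begin

text \<open>The empty face belongs to every complex.\<close>

definition abstract_complex :: "'a set set \<Rightarrow> bool" where
  "abstract_complex X \<longleftrightarrow>
     finite X \<and> {} \<in> X \<and> (\<forall>\<sigma>\<in>X. finite \<sigma>) \<and> (\<forall>\<sigma>\<in>X. \<forall>\<tau>. \<tau> \<subseteq> \<sigma> \<longrightarrow> \<tau> \<in> X)"

definition vertex_set :: "'a set set \<Rightarrow> 'a set" where
  "vertex_set X = \<Union>X"

definition complex_iso :: "'a set set \<Rightarrow> 'b set set \<Rightarrow> bool" where
  "complex_iso X Y \<longleftrightarrow> (\<exists>f. inj_on f (vertex_set X) \<and> Y = (\<lambda>\<sigma>. f ` \<sigma>) ` X)"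

definition vertex_degree :: "'a set set \<Rightarrow> 'a \<Rightarrow> nat" where
  "vertex_degree X v = card {e \<in> X. card e = 2 \<and> v \<in> e}"

definition complex_join :: "'a set set \<Rightarrow> 'a set set \<Rightarrow> 'a set set" where
  "complex_join X Y = X \<union> Y \<union> {\<alpha> \<union> \<beta> |\<alpha> \<beta>. \<alpha> \<in> X \<and> \<beta> \<in> Y}"

text \<open>The complex \<open>{{}}\<close> is the unit of the join, so \<open>iterated_join [X\<^sub>1, \<dots>, X\<^sub>m]\<close> is
  \<open>X\<^sub>1 * \<dots> * X\<^sub>m\<close>. Disjointness of the vertex sets has to be required separately.\<close>

fun iterated_join :: "'a set set list \<Rightarrow> 'a set set" where
  "iterated_join [] = {{}}"
| "iterated_join (X # Xs) = complex_join X (iterated_join Xs)"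

definition clique :: "'a set set \<Rightarrow> 'a set \<Rightarrow> bool" where
  "clique X U \<longleftrightarrow> U \<subseteq> vertex_set X \<and> (\<forall>u\<in>U. \<forall>v\<in>U. u \<noteq> v \<longrightarrow> {u, v} \<in> X)"

text \<open>A geometric simplicial complex is given by the vertex sets of its simplices; the simplex
  with vertex set \<open>\<sigma>\<close> is \<open>convex hull \<sigma>\<close>. The library's \<^const>\<open>simplicial_complex\<close> is
  confined to \<^class>\<open>euclidean_space\<close>, whose dimension is fixed by the type.\<close>

definition geometric_complex :: "'v::real_normed_vector set set \<Rightarrow> bool" where
  "geometric_complex K \<longleftrightarrow> abstract_complex K \<and> (\<forall>\<sigma>\<in>K. \<not> affine_dependent \<sigma>) \<and>
     (\<forall>\<sigma>\<in>K. \<forall>\<tau>\<in>K. convex hull \<sigma> \<inter> convex hull \<tau> = convex hull (\<sigma> \<inter> \<tau>))"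

definition carrier_of :: "'v::real_normed_vector set set \<Rightarrow> 'v set" where
  "carrier_of K = (\<Union>\<sigma>\<in>K. convex hull \<sigma>)"

definition subdivision_of :: "'v::real_normed_vector set set \<Rightarrow> 'v set set \<Rightarrow> bool" where
  "subdivision_of K' K \<longleftrightarrow> geometric_complex K' \<and> carrier_of K' = carrier_of K \<and>
     (\<forall>\<sigma>'\<in>K'. \<exists>\<sigma>\<in>K. convex hull \<sigma>' \<subseteq> convex hull \<sigma>)"

definition affine_map_on ::
  "'v::real_normed_vector set \<Rightarrow> ('v \<Rightarrow> 'w::real_normed_vector) \<Rightarrow> bool" where
  "affine_map_on C f \<longleftrightarrow> (\<forall>x\<in>C. \<forall>y\<in>C. \<forall>t\<in>{0..1}.
     f ((1 - t) *\<^sub>R x + t *\<^sub>R y) = (1 - t) *\<^sub>R f x + t *\<^sub>R f y)"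

definition pl_map :: "'v::real_normed_vector set set \<Rightarrow> 'w::real_normed_vector set set
    \<Rightarrow> ('v \<Rightarrow> 'w) \<Rightarrow> bool" where
  "pl_map K L f \<longleftrightarrow> f ` carrier_of K \<subseteq> carrier_of L \<and>
     (\<exists>K'. subdivision_of K' K \<and> (\<forall>\<sigma>\<in>K'. affine_map_on (convex hull \<sigma>) f))"

definition pl_homeomorphic ::
  "'v::real_normed_vector set set \<Rightarrow> 'w::real_normed_vector set set \<Rightarrow> bool" where
  "pl_homeomorphic K L \<longleftrightarrow> (\<exists>f g. homeomorphism (carrier_of K) (carrier_of L) f g \<and>
     pl_map K L f \<and> pl_map L K g)"

text \<open>The standard realization of an abstract complex sends the vertex \<open>v\<close> to the basis vector
  \<open>e\<^sub>v\<close> of the free real vector space on the vertex type. That space carries the 1-norm; any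
  norm induces the same topology on the finite-dimensional subspace containing the carrier.\<close>

definition realization :: "'a set set \<Rightarrow> ('a \<Rightarrow>\<^sub>0 real) set set" where
  "realization X = (\<lambda>\<sigma>. (\<lambda>v. Poly_Mapping.single v 1) ` \<sigma>) ` X"

definition standard_sphere :: "nat \<Rightarrow> nat set set" where
  "standard_sphere k = {\<sigma>. \<sigma> \<subset> {0..k + 1}}"

definition combinatorial_sphere :: "nat \<Rightarrow> 'a set set \<Rightarrow> bool" where
  "combinatorial_sphere k X \<longleftrightarrow>
     abstract_complex X \<and> pl_homeomorphic (realization X) (realization (standard_sphere k))"

text \<open>Isomorphic complexes are identified, so being the standard sphere means being isomorphic to
  it.\<close>

definition flag_sphere :: "nat \<Rightarrow> 'a set set \<Rightarrow> bool" where
  "flag_sphere k S \<longleftrightarrow> combinatorial_sphere k S \<and> \<not> complex_iso S (standard_sphere k) \<and>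
     (\<forall>U. clique S U \<longrightarrow> U \<in> S)"

end

theory Submission
  imports Defs
begin

text \<open>Call vertices \<open>u\<close> and \<open>v\<close> of \<open>S\<close> admissible if every \<open>\<sigma>\<close> with \<open>\<sigma> - {u}\<close> and \<open>\<sigma> - {v}\<close> in \<open>S\<close> is in \<open>S\<close>;
  for \<open>u \<noteq> v\<close> this is the link condition for the edge \<open>uv\<close>. Each of the hypotheses (a), (b), (c) provides
  such a pair. The cones \<open>B\<^sub>u\<close> and \<open>B\<^sub>v\<close> over the antistars of \<open>u\<close> and \<open>v\<close> then meet exactly in \<open>S\<close>, and
  \<open>B\<^sub>u \<union> B\<^sub>v\<close> is the required sphere: by Newman's theorem the antistar of \<open>u\<close> is a cone over the link
  of \<open>u\<close>, hence \<open>B\<^sub>u\<close> is PL homeomorphic relative to \<open>S\<close> to a cone \<open>x * S\<close>, and \<open>B\<^sub>u \<union> B\<^sub>v\<close> is the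
  suspension of \<open>S\<close>.

  Newman's theorem is proved by induction on the dimension. Stellar subdivision of edges does not
  change the pair (antistar of \<open>u\<close>, link of \<open>u\<close>) up to PL homeomorphism, because the theorem holds in the links
  of the neighbours of \<open>u\<close>. Two triangulations with a common vertex become equal near that vertex
  after such subdivisions, so it suffices to look at one triangulation of the sphere, the boundary of a simplex
  starred at a point.

  PL homeomorphisms are handled as bijective relations whose graph is a finite union of polytopes.
  Composition, inversion, gluing and coning are then immediate, and subdivisions are needed only
  to extract simplexwise affine representatives.\<close>

section \<open>Polyhedral relations\<close>

text \<open>Coning from \<open>u\<close> over the faces that avoid \<open>u\<close> creates no
  vertex, but the apex already lies on \<open>S\<close>, so the ball is not visibly a cone over its
  boundary. Newman's theorem repairs this: if the antistar is \<open>y * link\<close>, then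
  \<open>u * antistar\<close> is a join with the edge \<open>uy\<close>, and an interior point of
  that edge is an apex that sees all of \<open>S\<close>. The homeomorphisms have to be the identity
  on prescribed subcomplexes, since otherwise they could not be glued.

  In Newman's theorem the obstacle is that two triangulations of one polyhedron are not evidently
  related by edge subdivisions. It suffices to make their stars at one vertex agree, because this
  star and the carrier determine the carriers of antistar and link. Pairs are compared up to a
  homeomorphism that may move the link; the identity on the link is restored at the end by coning
  the inverse.

  Complexes are placed in the free vector space on the natural numbers, which leaves room for apexes
  in general position. Spheres are indexed by the dimension plus two, so that the index counts the
  vertices of the standard sphere.\<close>

definition polyhedral :: "'v::real_vector set \<Rightarrow> bool" where
  "polyhedral X \<longleftrightarrow> (\<exists>\<F>. finite \<F> \<and> (\<forall>F\<in>\<F>. finite F) \<and> X = (\<Union>F\<in>\<F>. convex hull F))"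

text \<open>The section is spanned by the points of \<open>S\<close> on the hyperplane and by the
  points \<open>q (s, t)\<close> where a segment from the positive to the negative side crosses it.
  In a point of the section the positive and the negative values of \<open>h\<close> balance, and a
  transport plan between the two sides writes the point as a combination of crossing points.\<close>

lemma hyperplane_section:
  fixes h :: "'v::real_vector \<Rightarrow> real"
  assumes "finite S" "linear h"
  shows "\<exists>F. finite F \<and> convex hull S \<inter> {x. h x = 0} = convex hull F"
proof -
  define Z where "Z = {s\<in>S. h s = 0}"
  define P where "P = {s\<in>S. h s > 0}"
  define N where "N = {s\<in>S. h s < 0}"
  define q where "q = (\<lambda>(s,t). (h s / (h s - h t)) *\<^sub>R t + (- h t / (h s - h t)) *\<^sub>R s)"
  define F where "F = Z \<union> q ` (P \<times> N)"
  interpret linear h by fact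
  have fin: "finite Z" "finite P" "finite N" using assms(1) by (auto simp: Z_def P_def N_def)
  have S: "S = Z \<union> (P \<union> N)" "Z \<inter> (P \<union> N) = {}" "P \<inter> N = {}"
    by (auto simp: Z_def P_def N_def)
  have sumS: "sum f S = sum f Z + sum f P + sum f N" for f :: "'v \<Rightarrow> 'c::real_vector"
    using fin S by (simp add: sum.union_disjoint)
  have "convex hull F \<subseteq> convex hull S \<inter> {x. h x = 0}"
  proof (rule hull_minimal)
    have "q x \<in> convex hull S \<inter> {x. h x = 0}" if x: "x \<in> P \<times> N" for x
    proof -
      obtain s t where [simp]: "x = (s,t)" and st: "s \<in> S" "t \<in> S" "h s > 0" "h t < 0"
        using x by (auto simp: P_def N_def)
      have "(h s / (h s - h t)) *\<^sub>R t + (- h t / (h s - h t)) *\<^sub>R s \<in> convex hull S"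
        using st by (intro convexD[OF convex_convex_hull]) (auto intro: hull_inc simp: divide_simps)
      then have "q x \<in> convex hull S" by (simp add: q_def)
      moreover have "h (q x) = 0" using st by (simp add: q_def diff scale)
      ultimately show ?thesis by auto
    qed
    then show "F \<subseteq> convex hull S \<inter> {x. h x = 0}"
      unfolding F_def by (auto simp: Z_def intro: hull_inc)
    have "convex {x. h x = 0}" by (auto simp: convex_def add scale)
    then show "convex (convex hull S \<inter> {x. h x = 0})" by (intro convex_Int) auto
  qed
  moreover have "convex hull S \<inter> {x. h x = 0} \<subseteq> convex hull F"
  proof
    fix x assume x: "x \<in> convex hull S \<inter> {x. h x = 0}"
    then obtain c where c: "\<And>s. s \<in> S \<Longrightarrow> 0 \<le> c s" "sum c S = 1" "x = (\<Sum>s\<in>S. c s *\<^sub>R s)"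
      using assms(1) by (auto simp: convex_hull_finite)
    define W where "W = (\<Sum>s\<in>P. c s * h s)"
    have "h x = (\<Sum>s\<in>S. c s * h s)" by (simp add: c(3) sum scale)
    then have "(\<Sum>s\<in>S. c s * h s) = 0" using x by auto
    moreover have "(\<Sum>s\<in>Z. c s * h s) = 0" by (simp add: Z_def)
    ultimately have W2: "(\<Sum>s\<in>N. c s * h s) = - W" unfolding sumS W_def by simp
    have cP: "c s \<ge> 0" if "s \<in> P" for s using that c by (auto simp: P_def)
    have cN: "c s \<ge> 0" if "s \<in> N" for s using that c by (auto simp: N_def)
    have W0: "W \<ge> 0" unfolding W_def by (intro sum_nonneg) (auto simp: P_def c)
    show "x \<in> convex hull F"
    \<comment> \<open>\<open>W\<close> is the mass to be transported. If it vanishes, no weight lies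
      off the hyperplane and only points of \<open>Z\<close> occur.\<close>
    proof (cases "W = 0")
      case True
      then have "\<forall>s\<in>P. c s * h s = 0" unfolding W_def
        using sum_nonneg_eq_0_iff[OF fin(2), of "\<lambda>s. c s * h s"] cP by (auto simp: P_def)
      then have p: "\<forall>s\<in>P. c s = 0" by (auto simp: P_def)
      have "(\<Sum>s\<in>N. - (c s * h s)) = 0" using W2 True by (simp add: sum_negf)
      then have "\<forall>s\<in>N. - (c s * h s) = 0"
        using sum_nonneg_eq_0_iff[OF fin(3), of "\<lambda>s. - (c s * h s)"] cN
        by (auto simp: N_def mult_le_0_iff)
      then have n: "\<forall>s\<in>N. c s = 0" by (auto simp: N_def)
      have "x = (\<Sum>s\<in>Z. c s *\<^sub>R s)" unfolding c(3) sumS using n p by simp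
      moreover have "sum c Z = 1" using c(2) n p unfolding sumS by simp
      ultimately have "x \<in> convex hull Z" using fin(1) c(1)
        by (auto simp: convex_hull_finite Z_def)
      then show ?thesis by (rule set_mp[OF hull_mono, rotated]) (auto simp: F_def)
    next
      case False
      then have W: "W > 0" using W0 by simp
      \<comment> \<open>The product plan: the mass \<open>c s * h s\<close> of a positive point is
        spread over the negative points in proportion to \<open>- (c t * h t)\<close>. The factor
        \<open>h s - h t\<close> cancels the denominators in \<open>q\<close>.\<close>
      define w where "w = (\<lambda>(s,t). c s * c t * (h s - h t) / W)"
      define a where "a = case_sum c w"
      define y where "y = case_sum (\<lambda>z::'v. z) q"
      let ?I = "Z <+> (P \<times> N)"
      have wq: "w (s,t) *\<^sub>R q (s,t) = (c s * h s / W) *\<^sub>R (c t *\<^sub>R t) + (c t * (- h t) / W) *\<^sub>R (c s *\<^sub>R s)"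
        if "s \<in> P" "t \<in> N" for s t
      proof -
        have "h s - h t \<noteq> 0" using that by (auto simp: P_def N_def)
        then have "w (s,t) * (h s / (h s - h t)) = (c s * h s / W) * c t"
          "w (s,t) * (- h t / (h s - h t)) = (c t * (- h t) / W) * c s"
          using W by (auto simp: w_def)
        then show ?thesis by (simp only: q_def prod.case scaleR_add_right scaleR_scaleR)
      qed
      have e1: "(\<Sum>s\<in>P. c s * h s / W) = 1" using W by (simp add: W_def flip: sum_divide_distrib)
      have "(\<Sum>t\<in>N. c t * (- h t)) = W" using W2 by (simp add: sum_negf)
      then have e2: "(\<Sum>t\<in>N. c t * (- h t) / W) = 1" using W by (metis sum_divide_distrib divide_self_if less_irrefl)
      have "(\<Sum>x\<in>P\<times>N. w x *\<^sub>R q x) = (\<Sum>s\<in>P. \<Sum>t\<in>N. w (s,t) *\<^sub>R q (s,t))"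
        by (simp add: sum.cartesian_product)
      also have "\<dots> = (\<Sum>s\<in>P. \<Sum>t\<in>N. (c s * h s / W) *\<^sub>R (c t *\<^sub>R t) + (c t * (- h t) / W) *\<^sub>R (c s *\<^sub>R s))"
        using wq by (intro sum.cong) auto
      also have "\<dots> = (\<Sum>s\<in>P. (c s * h s / W)) *\<^sub>R (\<Sum>t\<in>N. c t *\<^sub>R t)
           + (\<Sum>t\<in>N. (c t * (- h t) / W)) *\<^sub>R (\<Sum>s\<in>P. c s *\<^sub>R s)"
        by (simp only: sum.distrib flip: scaleR_sum_right scaleR_sum_left)
      also have "\<dots> = (\<Sum>t\<in>N. c t *\<^sub>R t) + (\<Sum>s\<in>P. c s *\<^sub>R s)" using e1 e2 by simp
      finally have s1: "(\<Sum>x\<in>P\<times>N. w x *\<^sub>R q x) = (\<Sum>t\<in>N. c t *\<^sub>R t) + (\<Sum>s\<in>P. c s *\<^sub>R s)" .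
      have "(\<Sum>x\<in>P\<times>N. w x) = (\<Sum>s\<in>P. \<Sum>t\<in>N. w (s,t))"
        by (simp add: sum.cartesian_product)
      also have "\<dots> = (\<Sum>s\<in>P. \<Sum>t\<in>N. (c s * h s / W) * c t + (c t * (- h t) / W) * c s)"
        using W by (intro sum.cong) (auto simp: w_def field_simps)
      also have "\<dots> = (\<Sum>s\<in>P. (c s * h s / W)) * (\<Sum>t\<in>N. c t)
           + (\<Sum>t\<in>N. (c t * (- h t) / W)) * (\<Sum>s\<in>P. c s)"
        by (simp only: sum.distrib flip: sum_distrib_left sum_distrib_right)
      also have "\<dots> = sum c N + sum c P" using e1 e2 by simp
      finally have s2: "(\<Sum>x\<in>P\<times>N. w x) = sum c N + sum c P" .
      have "(\<Sum>i\<in>?I. a i *\<^sub>R y i) \<in> convex hull F"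
      proof (rule convex_sum)
        show "finite ?I" using fin by auto
        show "sum a ?I = 1" using fin c(2) s2 by (simp add: sum.Plus a_def o_def sumS)
        fix i assume i: "i \<in> ?I"
        show "0 \<le> a i" using i W c(1) by (auto simp: a_def w_def Z_def P_def N_def split: sum.splits intro!: divide_nonneg_pos mult_nonneg_nonneg)
        show "y i \<in> convex hull F" using i by (auto simp: y_def F_def intro!: hull_inc)
      qed simp
      also have "(\<Sum>i\<in>?I. a i *\<^sub>R y i) = x" unfolding c(3) sumS
        using fin s1 by (simp add: sum.Plus a_def y_def o_def)
      finally show ?thesis .
    qed
  qed
  moreover have "finite F" using fin by (auto simp: F_def)
  ultimately show ?thesis by blast
qed

text \<open>The codomain may have infinite dimension, but \<open>f\<close> maps the polytope into
  the span of a finite set. The functionals dual to a basis of that span turn the kernel into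
  finitely many hyperplane sections.\<close>

lemma polytope_kernel:
  fixes f :: "'v::real_vector \<Rightarrow> 'w::real_vector"
  assumes S: "finite S" and f: "linear f"
  shows "\<exists>F. finite F \<and> convex hull S \<inter> {x. f x = 0} = convex hull F"
proof -
  obtain B where B: "B \<subseteq> f ` S" "independent B" "span B = span (f ` S)"
    by (metis basis_exists real_vector.span_eq subset_antisym dual_order.trans real_vector.span_superset)
  have fB: "finite B" using B(1) S finite_surj by blast
  have "\<exists>g. linear g \<and> (\<forall>x\<in>B. g x = (if x = b then 1 else (0::real)))" for b
    using linear_independent_extend[OF B(2), of "\<lambda>x. if x = b then 1 else (0::real)"] by blast
  then obtain g where g: "\<And>b. linear (g b)" "\<And>b x. x \<in> B \<Longrightarrow> g b x = (if x = b then 1 else (0::real))"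
    by metis
  have *: "\<exists>F. finite F \<and> convex hull S \<inter> {x. \<forall>b\<in>C. g b (f x) = 0} = convex hull F" if "finite C" for C
    using that
  proof induction
    case empty then show ?case using S by auto
  next
    case (insert b C)
    then obtain F where F: "finite F" "convex hull S \<inter> {x. \<forall>b\<in>C. g b (f x) = 0} = convex hull F" by blast
    have "linear (\<lambda>x. g b (f x))" using linear_compose[OF f g(1)] by (simp add: o_def)
    from hyperplane_section[OF F(1) this] obtain F' where
      "finite F'" "convex hull F \<inter> {x. g b (f x) = 0} = convex hull F'" by blast
    then show ?case unfolding F(2)[symmetric] by (intro exI[of _ F']) auto
  qed
  have "f x = 0 \<longleftrightarrow> (\<forall>b\<in>B. g b (f x) = 0)" if "x \<in> convex hull S" for x
  proof
    assume z: "\<forall>b\<in>B. g b (f x) = 0"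
    have "f x \<in> convex hull (f ` S)" using that f convex_hull_linear_image[OF f] by blast
    then have "f x \<in> span B" using convex_hull_subset_span B(3) by blast
    then obtain r where r: "f x = (\<Sum>b\<in>B. r b *\<^sub>R b)" using real_vector.span_finite[OF fB] by auto
    have "r b = 0" if b: "b \<in> B" for b
    proof -
      have "0 = g b (f x)" using z b by simp
      also have "\<dots> = (\<Sum>b'\<in>B. r b' * g b b')"
        unfolding r by (simp add: linear_sum[OF g(1)] linear_scale[OF g(1)])
      also have "\<dots> = (\<Sum>b'\<in>B. if b' = b then r b' else 0)" using g(2) by (intro sum.cong) auto
      also have "\<dots> = r b" using fB b by simp
      finally show ?thesis by simp
    qed
    then show "f x = 0" using r by simp
  qed (simp add: linear_0[OF g(1)])
  then have "convex hull S \<inter> {x. f x = 0} = convex hull S \<inter> {x. \<forall>b\<in>B. g b (f x) = 0}" by blast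
  then show ?thesis using *[OF fB] by simp
qed

lemma polyhedral_hull: "finite F \<Longrightarrow> polyhedral (convex hull F)"
  unfolding polyhedral_def by (intro exI[of _ "{F}"]) auto

lemma polyhedral_empty: "polyhedral {}" unfolding polyhedral_def by (intro exI[of _ "{}"]) auto

lemma polyhedral_Un: "polyhedral X \<Longrightarrow> polyhedral Y \<Longrightarrow> polyhedral (X \<union> Y)"
  unfolding polyhedral_def by (metis UN_Un Un_iff finite_Un)

lemma polyhedral_UN: "finite I \<Longrightarrow> (\<And>i. i \<in> I \<Longrightarrow> polyhedral (f i)) \<Longrightarrow> polyhedral (\<Union>i\<in>I. f i)"
  by (induction I rule: finite_induct) (auto intro: polyhedral_Un polyhedral_empty)

lemma polyhedral_linear_image: assumes "linear f" "polyhedral X" shows "polyhedral (f ` X)"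
proof -
  obtain \<F> where F: "finite \<F>" "\<forall>F\<in>\<F>. finite F" "X = (\<Union>F\<in>\<F>. convex hull F)"
    using assms(2) unfolding polyhedral_def by blast
  have "f ` X = (\<Union>F\<in>\<F>. convex hull (f ` F))"
    unfolding F(3) image_UN by (simp add: convex_hull_linear_image[OF assms(1)])
  then show ?thesis using F by (auto intro!: polyhedral_UN polyhedral_hull)
qed

lemma polyhedral_Times: assumes "polyhedral X" "polyhedral Y" shows "polyhedral (X \<times> Y)"
proof -
  obtain \<F> \<G> where F: "finite \<F>" "\<forall>F\<in>\<F>. finite F" "X = (\<Union>F\<in>\<F>. convex hull F)"
   and G: "finite \<G>" "\<forall>F\<in>\<G>. finite F" "Y = (\<Union>F\<in>\<G>. convex hull F)"
    using assms unfolding polyhedral_def by blast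
  have "X \<times> Y = (\<Union>F\<in>\<F>. \<Union>G\<in>\<G>. convex hull (F \<times> G))"
    unfolding F(3) G(3) by (auto simp: convex_hull_Times)
  then show ?thesis using F G by (auto intro!: polyhedral_UN polyhedral_hull)
qed

lemma polyhedral_kernel: assumes "linear f" "polyhedral X" shows "polyhedral (X \<inter> {x. f x = 0})"
proof -
  obtain \<F> where F: "finite \<F>" "\<forall>F\<in>\<F>. finite F" "X = (\<Union>F\<in>\<F>. convex hull F)"
    using assms(2) unfolding polyhedral_def by blast
  have "X \<inter> {x. f x = 0} = (\<Union>F\<in>\<F>. convex hull F \<inter> {x. f x = 0})" unfolding F(3) by auto
  moreover have "polyhedral (convex hull F \<inter> {x. f x = 0})" if "F \<in> \<F>" for F
    using polytope_kernel[OF _ assms(1), of F] F that by (metis polyhedral_hull)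
  ultimately show ?thesis using F(1) polyhedral_UN[of \<F> "\<lambda>F. convex hull F \<inter> {x. f x = 0}"] by metis
qed

text \<open>A composition is a projection of the fibre product of \<open>R\<close> and
  \<open>S\<close>, which is the part of \<open>R \<times> S\<close> where the two middle
  coordinates agree, hence a kernel section. Sections of polytopes were developed for this
  purpose.\<close>

lemma polyhedral_relcomp: assumes "polyhedral R" "polyhedral S" shows "polyhedral (R O S)"
proof -
  let ?f = "\<lambda>p. snd (fst p) - fst (snd p)" and ?g = "\<lambda>p. (fst (fst p), snd (snd p))"
  have "linear ?f" "linear ?g" by (auto intro!: linearI simp: algebra_simps)
  then have "polyhedral (?g ` ((R \<times> S) \<inter> {p. ?f p = 0}))"
    using assms by (intro polyhedral_linear_image polyhedral_kernel polyhedral_Times)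
  also have "?g ` ((R \<times> S) \<inter> {p. ?f p = 0}) = R O S" by (force simp: image_iff)
  finally show ?thesis .
qed

lemma polyhedral_converse: assumes "polyhedral R" shows "polyhedral (R\<inverse>)"
proof -
  have "R\<inverse> = (\<lambda>p. (snd p, fst p)) ` R" by force
  moreover have "linear (\<lambda>p::'a\<times>'b. (snd p, fst p))" by (auto intro!: linearI)
  ultimately show ?thesis using assms by (simp add: polyhedral_linear_image)
qed

lemma polyhedral_Id_on: assumes "polyhedral X" shows "polyhedral (Id_on X)"
proof -
  have "Id_on X = (\<lambda>x. (x, x)) ` X" by auto
  moreover have "linear (\<lambda>x::'a. (x, x))" by (auto intro!: linearI)
  ultimately show ?thesis using assms by (simp add: polyhedral_linear_image)
qed

lemma polyhedral_compact: fixes X :: "'v::real_normed_vector set"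
  assumes "polyhedral X" shows "compact X"
  using assms unfolding polyhedral_def by (auto intro!: compact_UN finite_imp_compact_convex_hull)

section \<open>PL homeomorphisms as bijective polyhedral relations\<close>

definition pl_iso :: "('v::real_vector \<times> 'w::real_vector) set \<Rightarrow> 'v set \<Rightarrow> 'w set \<Rightarrow> bool" where
  "pl_iso R X Y \<longleftrightarrow> polyhedral R \<and> Domain R = X \<and> Range R = Y \<and> single_valued R \<and> single_valued (R\<inverse>)"

lemma pl_iso_Id_on: "polyhedral X \<Longrightarrow> pl_iso (Id_on X) X X"
  by (auto simp: pl_iso_def polyhedral_Id_on single_valued_def)

lemma pl_iso_converse: "pl_iso R X Y \<Longrightarrow> pl_iso (R\<inverse>) Y X"
  by (simp add: pl_iso_def polyhedral_converse)

lemma pl_iso_relcomp: assumes "pl_iso R X Y" "pl_iso S Y Z" shows "pl_iso (R O S) X Z"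
proof -
  have D: "Domain R = X" "Range R = Domain S" "Range S = Z" using assms by (auto simp: pl_iso_def)
  have "Domain (R O S) = X" "Range (R O S) = Z" using D by (fastforce)+
  moreover have "single_valued (R O S)" "single_valued ((R O S)\<inverse>)"
    unfolding converse_relcomp using assms by (auto simp: pl_iso_def intro: single_valued_relcomp)
  ultimately show ?thesis using assms by (simp add: pl_iso_def polyhedral_relcomp)
qed

lemma pl_iso_sub: assumes "pl_iso R X Y" "G \<subseteq> R" "polyhedral G" shows "pl_iso G (Domain G) (Range G)"
  using assms single_valued_subset[of G R] single_valued_subset[of "G\<inverse>" "R\<inverse>"]
  by (simp add: pl_iso_def)

text \<open>\<open>G\<close> is a common part of both relations that covers the overlap of the
  domains as well as that of the ranges. Thus no point acquires two images and no image two
  preimages.\<close>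

lemma pl_iso_Un:
  assumes "pl_iso R X Y" "pl_iso R' X' Y'" "G \<subseteq> R" "G \<subseteq> R'" "X \<inter> X' \<subseteq> Domain G" "Y \<inter> Y' \<subseteq> Range G"
  shows "pl_iso (R \<union> R') (X \<union> X') (Y \<union> Y')"
  unfolding pl_iso_def
proof (intro conjI)
  show "polyhedral (R \<union> R')" using assms by (simp add: pl_iso_def polyhedral_Un)
  show "Domain (R \<union> R') = X \<union> X'" "Range (R \<union> R') = Y \<union> Y'" using assms by (auto simp: pl_iso_def)
  have sv: "single_valued R" "single_valued R'" "single_valued (R\<inverse>)" "single_valued (R'\<inverse>)"
    and D: "Domain R = X" "Domain R' = X'" "Range R = Y" "Range R' = Y'"
    using assms by (auto simp: pl_iso_def)
  have *: "y = y'" if "(x,y) \<in> R" "(x,y') \<in> R'" for x y y'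
  proof -
    have "x \<in> X \<inter> X'" using that D by blast
    then obtain z where "(x,z) \<in> G" using assms(5) by blast
    then have "(x,z) \<in> R" "(x,z) \<in> R'" using assms(3,4) by auto
    then show ?thesis using that single_valuedD[OF sv(1)] single_valuedD[OF sv(2)] by metis
  qed
  have **: "x = x'" if "(x,y) \<in> R" "(x',y) \<in> R'" for x x' y
  proof -
    have "y \<in> Y \<inter> Y'" using that D by blast
    then obtain z where "(z,y) \<in> G" using assms(6) by blast
    then have "(y,z) \<in> R\<inverse>" "(y,z) \<in> R'\<inverse>" using assms(3,4) by auto
    then show ?thesis using that single_valuedD[OF sv(3)] single_valuedD[OF sv(4)] by (metis converse_iff)
  qed
  show "single_valued (R \<union> R')"
    by (rule single_valuedI) (metis * Un_iff single_valuedD[OF sv(1)] single_valuedD[OF sv(2)])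
  show "single_valued ((R \<union> R')\<inverse>)"
    by (rule single_valuedI) (metis ** Un_iff converse_iff single_valuedD[OF sv(3)] single_valuedD[OF sv(4)])
qed

text \<open>Continuity is a matter of compactness: the projections of the compact graph to domain
  and range are continuous bijections and therefore have continuous inverses.\<close>

lemma pl_iso_homeomorphism:
  fixes X :: "'v::real_normed_vector set" and Y :: "'w::real_normed_vector set"
  assumes "pl_iso R X Y" shows "\<exists>f g. homeomorphism X Y f g \<and> (\<forall>x\<in>X. (x, f x) \<in> R)"
proof -
  define f where "f x = (THE y. (x,y) \<in> R)" for x
  define g where "g y = (THE x. (x,y) \<in> R)" for y
  have sv: "single_valued R" "single_valued (R\<inverse>)" and D: "Domain R = X" "Range R = Y"
    using assms by (auto simp: pl_iso_def)
  have f: "f x = y" if "(x,y) \<in> R" for x y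
    unfolding f_def using that sv by (auto simp: single_valued_def)
  have g: "g y = x" if "(x,y) \<in> R" for x y
    unfolding g_def using that sv by (auto simp: single_valued_def)
  have cR: "compact R" using assms by (auto simp: pl_iso_def polyhedral_compact)
  have "continuous_on (fst ` R) (\<lambda>x. (x, f x))"
    by (rule continuous_on_inv[OF _ cR]) (auto intro!: continuous_intros simp: f)
  from continuous_on_snd[OF this] have cf: "continuous_on X f"
    using D(1) by (simp add: fst_eq_Domain)
  have "continuous_on (snd ` R) (\<lambda>y. (g y, y))"
    by (rule continuous_on_inv[OF _ cR]) (auto intro!: continuous_intros simp: g)
  from continuous_on_fst[OF this] have cg: "continuous_on Y g"
    using D(2) by (simp add: snd_eq_Range)
  have fR: "(x, f x) \<in> R" if "x \<in> X" for x using that D(1) f by (metis DomainE)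
  have gR: "(g y, y) \<in> R" if "y \<in> Y" for y using that D(2) g by (metis RangeE)
  have "f ` X \<subseteq> Y" "g ` Y \<subseteq> X" using fR gR unfolding D[symmetric] by auto
  moreover have "g (f x) = x" if "x \<in> X" for x by (rule g[OF fR[OF that]])
  moreover have "f (g y) = y" if "y \<in> Y" for y by (rule f[OF gR[OF that]])
  ultimately have "homeomorphism X Y f g" using cf cg
    by (intro homeomorphismI) auto
  moreover have "\<forall>x\<in>X. (x, f x) \<in> R" using fR by blast
  ultimately show ?thesis by blast
qed

section \<open>Barycentric coordinates and stellar subdivision\<close>

text \<open>Summing over the support makes the value independent of an ambient complex. On an
  infinite support the convention for infinite sums gives 0; for coordinates in a complex the
  support is a face and so finite.\<close>

definition bary_sum :: "('v \<Rightarrow> 'w::real_vector) \<Rightarrow> ('v \<Rightarrow> real) \<Rightarrow> 'w" where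
  "bary_sum f c = (\<Sum>v | c v \<noteq> 0. c v *\<^sub>R f v)"

abbreviation bary_point :: "('v::real_normed_vector \<Rightarrow> real) \<Rightarrow> 'v" where
  "bary_point \<equiv> bary_sum (\<lambda>v. v)"

definition bary_coords :: "'v set set \<Rightarrow> ('v \<Rightarrow> real) set" where
  "bary_coords K = {c. (\<forall>v. 0 \<le> c v) \<and> {v. c v \<noteq> 0} \<in> K \<and> (\<Sum>v | c v \<noteq> 0. c v) = 1}"

text \<open>Vertices are points of the vector space, and uniqueness of barycentric coordinates takes
  the place of independence and proper intersection of simplices;
  \<open>realized_imp_geometric\<close> recovers these. In this form equations between points become
  equations between functions.\<close>

definition realized :: "'v::real_normed_vector set set \<Rightarrow> bool" where
  "realized K \<longleftrightarrow> abstract_complex K \<and> inj_on bary_point (bary_coords K)"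

definition vertex_coord :: "'v \<Rightarrow> 'v \<Rightarrow> real" where
  "vertex_coord v = (\<lambda>w. if w = v then 1 else 0)"

lemma bary_sum_sum: "finite W \<Longrightarrow> {v. c v \<noteq> 0} \<subseteq> W \<Longrightarrow> bary_sum f c = (\<Sum>v\<in>W. c v *\<^sub>R f v)"
  unfolding bary_sum_def by (rule sum.mono_neutral_left) auto

lemma bary_sum_one: "bary_sum (\<lambda>_. 1::real) c = (\<Sum>v | c v \<noteq> 0. c v)"
  by (simp add: bary_sum_def)

lemma bary_sum_vertex_coord: "bary_sum f (vertex_coord v) = f v"
  by (subst bary_sum_sum[of "{v}"]) (auto simp: vertex_coord_def)

lemma bary_sum_cong: "(\<And>v. c v \<noteq> 0 \<Longrightarrow> f v = g v) \<Longrightarrow> bary_sum f c = bary_sum g c"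
  unfolding bary_sum_def by (intro sum.cong) auto

lemma abstract_complexI:
  assumes "finite K" "{} \<in> K" "\<And>\<sigma>. \<sigma> \<in> K \<Longrightarrow> finite \<sigma>" "\<And>\<sigma> \<tau>. \<sigma> \<in> K \<Longrightarrow> \<tau> \<subseteq> \<sigma> \<Longrightarrow> \<tau> \<in> K"
  shows "abstract_complex K"
  using assms by (simp add: abstract_complex_def)

lemma abstract_complexD:
  assumes "abstract_complex K"
  shows "finite K" "{} \<in> K" "\<sigma> \<in> K \<Longrightarrow> finite \<sigma>" "\<sigma> \<in> K \<Longrightarrow> \<tau> \<subseteq> \<sigma> \<Longrightarrow> \<tau> \<in> K"
  using assms by (simp_all add: abstract_complex_def)

lemma abstract_complex_Int: "abstract_complex A \<Longrightarrow> abstract_complex B \<Longrightarrow> abstract_complex (A \<inter> B)"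
  by (rule abstract_complexI) (auto dest: abstract_complexD)

lemma abstract_complex_Un: "abstract_complex A \<Longrightarrow> abstract_complex B \<Longrightarrow> abstract_complex (A \<union> B)"
  by (rule abstract_complexI) (auto dest: abstract_complexD)

lemma abstract_complex_subset: "abstract_complex K \<Longrightarrow> \<sigma> \<in> K \<Longrightarrow> \<tau> \<subseteq> \<sigma> \<Longrightarrow> \<tau> \<in> K"
  unfolding abstract_complex_def by blast

lemma abstract_complex_finite: "abstract_complex K \<Longrightarrow> \<sigma> \<in> K \<Longrightarrow> finite \<sigma>"
  unfolding abstract_complex_def by blast

lemma abstract_complex_vertex: "abstract_complex K \<Longrightarrow> v \<in> \<Union>K \<longleftrightarrow> {v} \<in> K"
  by (rule iffI, erule UnionE, rule abstract_complex_subset) auto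

lemma abstract_complex_finite_vertices: "abstract_complex K \<Longrightarrow> finite (\<Union>K)"
  unfolding abstract_complex_def by blast

lemma bary_coords_finite: "abstract_complex K \<Longrightarrow> c \<in> bary_coords K \<Longrightarrow> finite {v. c v \<noteq> 0}"
  unfolding bary_coords_def by (auto intro: abstract_complex_finite)

lemma bary_coords_mass: "c \<in> bary_coords K \<Longrightarrow> bary_sum (\<lambda>_. 1::real) c = 1"
  by (simp add: bary_sum_one bary_coords_def)

lemma bary_coordsI:
  assumes "abstract_complex K" "\<sigma> \<in> K" "\<And>v. 0 \<le> c v" "\<And>v. v \<notin> \<sigma> \<Longrightarrow> c v = 0" "sum c \<sigma> = 1"
  shows "c \<in> bary_coords K"
proof -
  have "{v. c v \<noteq> 0} \<subseteq> \<sigma>" using assms(4) by auto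
  moreover have "finite \<sigma>" using assms by (auto intro: abstract_complex_finite)
  ultimately have "bary_sum (\<lambda>_. 1::real) c = 1" using assms(5) bary_sum_sum[of \<sigma> c "\<lambda>_. 1::real"] by simp
  then show ?thesis using assms \<open>_ \<subseteq> \<sigma>\<close> abstract_complex_subset[of K \<sigma>]
    by (auto simp: bary_coords_def bary_sum_one)
qed

lemma vertex_coord_bary_coords: "abstract_complex K \<Longrightarrow> v \<in> \<Union>K \<Longrightarrow> vertex_coord v \<in> bary_coords K"
  by (rule bary_coordsI[of K "{v}"]) (simp_all add: vertex_coord_def abstract_complex_vertex del: Union_iff)

lemma convex_hull_coords:
  fixes \<sigma> :: "'v::real_normed_vector set"
  assumes "finite \<sigma>"
  shows "convex hull \<sigma> = {bary_point c |c. (\<forall>v. 0 \<le> c v) \<and> (\<forall>v. v \<notin> \<sigma> \<longrightarrow> c v = 0) \<and> sum c \<sigma> = 1}"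
  (is "_ = ?R")
proof (intro equalityI subsetI)
  fix x assume "x \<in> convex hull \<sigma>"
  then obtain u where u: "\<And>v. v \<in> \<sigma> \<Longrightarrow> 0 \<le> u v" "sum u \<sigma> = 1" "(\<Sum>v\<in>\<sigma>. u v *\<^sub>R v) = x"
    using assms by (auto simp: convex_hull_finite)
  let ?c = "\<lambda>v. if v \<in> \<sigma> then u v else 0"
  have "bary_point ?c = (\<Sum>v\<in>\<sigma>. ?c v *\<^sub>R v)" using assms by (intro bary_sum_sum) auto
  also have "\<dots> = x" using u(3) by (auto intro: sum.cong)
  finally show "x \<in> ?R" using u by (auto intro!: exI[of _ ?c])
next
  fix x assume "x \<in> ?R"
  then obtain c where c: "x = bary_point c" "\<forall>v. 0 \<le> c v" "\<forall>v. v \<notin> \<sigma> \<longrightarrow> c v = 0" "sum c \<sigma> = 1" by blast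
  have "bary_point c = (\<Sum>v\<in>\<sigma>. c v *\<^sub>R v)" using assms c by (intro bary_sum_sum) auto
  then show "x \<in> convex hull \<sigma>" using c assms by (auto simp: convex_hull_finite)
qed

lemma bary_point_in_hull:
  assumes "c \<in> bary_coords K" "finite \<sigma>" "{v. c v \<noteq> 0} \<subseteq> \<sigma>"
  shows "bary_point c \<in> convex hull \<sigma>"
proof -
  have "sum c \<sigma> = 1" using bary_sum_sum[OF assms(2,3), of "\<lambda>_. 1::real"] bary_coords_mass[OF assms(1)] by simp
  then show ?thesis using assms by (subst convex_hull_coords) (auto simp: bary_coords_def)
qed

lemma carrier_coords:
  assumes "abstract_complex K" shows "carrier_of K = bary_point ` bary_coords K"
proof (intro equalityI subsetI)
  fix x assume "x \<in> carrier_of K"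
  then obtain \<sigma> where "\<sigma> \<in> K" "x \<in> convex hull \<sigma>" by (auto simp: carrier_of_def)
  then show "x \<in> bary_point ` bary_coords K"
    using assms by (subst (asm) convex_hull_coords) (auto intro: abstract_complex_finite bary_coordsI)
next
  fix x assume "x \<in> bary_point ` bary_coords K"
  then obtain c where c: "c \<in> bary_coords K" "x = bary_point c" by blast
  then have "x \<in> convex hull {v. c v \<noteq> 0}"
    using assms by (auto intro: bary_point_in_hull bary_coords_finite)
  then show "x \<in> carrier_of K" using c by (auto simp: carrier_of_def bary_coords_def)
qed

lemma realized_abstract: "realized K \<Longrightarrow> abstract_complex K" by (simp add: realized_def)

lemma realized_inj: "realized K \<Longrightarrow> c \<in> bary_coords K \<Longrightarrow> d \<in> bary_coords K \<Longrightarrow> bary_point c = bary_point d \<Longrightarrow> c = d"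
  by (auto simp: realized_def inj_on_def)

lemma bary_coords_mono: "A \<subseteq> K \<Longrightarrow> bary_coords A \<subseteq> bary_coords K"
  by (auto simp: bary_coords_def)

lemma realized_subcomplex: "realized K \<Longrightarrow> A \<subseteq> K \<Longrightarrow> abstract_complex A \<Longrightarrow> realized A"
  unfolding realized_def by (meson bary_coords_mono inj_on_subset)

lemma carrier_mono: "A \<subseteq> K \<Longrightarrow> carrier_of A \<subseteq> carrier_of K"
  by (auto simp: carrier_of_def)

lemma carrier_Un: "carrier_of (A \<union> B) = carrier_of A \<union> carrier_of B"
  by (auto simp: carrier_of_def)

text \<open>A common point has coordinates in both subcomplexes, and these coincide as coordinates
  in the ambient complex \<open>K\<close>. The overlaps that matter for gluing are computed in this
  combinatorial way.\<close>

lemma carrier_Int: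
  assumes "realized K" "A \<subseteq> K" "B \<subseteq> K" "abstract_complex A" "abstract_complex B"
  shows "carrier_of A \<inter> carrier_of B = carrier_of (A \<inter> B)"
proof
  show "carrier_of A \<inter> carrier_of B \<subseteq> carrier_of (A \<inter> B)"
  proof
    fix x assume "x \<in> carrier_of A \<inter> carrier_of B"
    then obtain c d where c: "c \<in> bary_coords A" "d \<in> bary_coords B" "x = bary_point c" "x = bary_point d"
      using assms by (auto simp: carrier_coords)
    then have "c = d" using realized_inj[OF assms(1)] bary_coords_mono assms(2,3) by (metis subsetD)
    then have "c \<in> bary_coords (A \<inter> B)" using c by (auto simp: bary_coords_def)
    moreover have "abstract_complex (A \<inter> B)" using assms(4,5) by (rule abstract_complex_Int)
    ultimately show "x \<in> carrier_of (A \<inter> B)" using c by (auto simp: carrier_coords)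
  qed
qed (auto simp: carrier_of_def)

lemma polyhedral_carrier: "abstract_complex K \<Longrightarrow> polyhedral (carrier_of K)"
  unfolding carrier_of_def by (auto intro!: polyhedral_UN polyhedral_hull simp: abstract_complex_def)

text \<open>The positive and the negative part of an affine dependence have equal mass
  \<open>m\<close>. Divided by \<open>m\<close>, they would be two different coordinate functions of
  one point.\<close>

lemma realized_independent: assumes "realized K" "\<sigma> \<in> K" shows "\<not> affine_dependent \<sigma>"
proof
  assume "affine_dependent \<sigma>"
  have ac: "abstract_complex K" and f: "finite \<sigma>"
    using assms realized_abstract abstract_complex_finite by blast+
  obtain U where U: "sum U \<sigma> = 0" "\<exists>v\<in>\<sigma>. U v \<noteq> 0" "(\<Sum>v\<in>\<sigma>. U v *\<^sub>R v) = 0"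
    using \<open>affine_dependent \<sigma>\<close> affine_dependent_explicit_finite[OF f] by blast
  define p where "p v = (if v \<in> \<sigma> then max (U v) 0 else 0)" for v
  define q where "q v = (if v \<in> \<sigma> then max (- U v) 0 else 0)" for v
  have pq: "U v = p v - q v" if "v \<in> \<sigma>" for v using that by (auto simp: p_def q_def max_def)
  have s: "sum p \<sigma> = sum q \<sigma>" using U(1) pq by (simp add: sum_subtractf)
  have e: "(\<Sum>v\<in>\<sigma>. p v *\<^sub>R v) = (\<Sum>v\<in>\<sigma>. q v *\<^sub>R v)" using U(3) pq
    by (simp add: algebra_simps sum_subtractf)
  define m where "m = sum p \<sigma>"
  have nn: "p v \<ge> 0" "q v \<ge> 0" for v by (auto simp: p_def q_def)
  have "m \<noteq> 0"
  proof
    assume "m = 0"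
    then have "\<forall>v\<in>\<sigma>. p v = 0" "\<forall>v\<in>\<sigma>. q v = 0"
      using sum_nonneg_eq_0_iff[OF f] nn s by (auto simp: m_def)
    then show False using U(2) pq by auto
  qed
  then have m: "m > 0" using sum_nonneg[of \<sigma> p] nn by (auto simp: m_def)
  have z: "p v = 0" "q v = 0" if "v \<notin> \<sigma>" for v using that by (auto simp: p_def q_def)
  have "(\<lambda>v. p v / m) \<in> bary_coords K" "(\<lambda>v. q v / m) \<in> bary_coords K"
    using m nn z s by (auto intro!: bary_coordsI[OF ac assms(2)] simp: m_def simp flip: sum_divide_distrib)
  moreover have "bary_point (\<lambda>v. p v / m) = bary_point (\<lambda>v. q v / m)"
  proof -
    have "bary_point (\<lambda>v. p v / m) = (\<Sum>v\<in>\<sigma>. (1/m) *\<^sub>R (p v *\<^sub>R v))"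
      using z by (subst bary_sum_sum[OF f]) (auto intro!: sum.cong)
    also have "\<dots> = (\<Sum>v\<in>\<sigma>. (1/m) *\<^sub>R (q v *\<^sub>R v))" by (simp add: e flip: scaleR_sum_right del: scaleR_scaleR)
    also have "\<dots> = bary_point (\<lambda>v. q v / m)"
      using z by (subst bary_sum_sum[OF f]) (auto intro!: sum.cong)
    finally show ?thesis .
  qed
  ultimately have "(\<lambda>v. p v / m) = (\<lambda>v. q v / m)" by (rule realized_inj[OF assms(1)])
  then have "p v = q v" for v using m by (metis divide_cancel_right less_irrefl)
  moreover obtain v where "v \<in> \<sigma>" "U v \<noteq> 0" using U(2) by blast
  ultimately show False using pq by auto
qed

lemma realized_imp_geometric: assumes "realized K" shows "geometric_complex K"
proof -
  have ac: "abstract_complex K" using assms by (rule realized_abstract)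
  have "convex hull \<sigma> \<inter> convex hull \<tau> \<subseteq> convex hull (\<sigma> \<inter> \<tau>)" if st: "\<sigma> \<in> K" "\<tau> \<in> K" for \<sigma> \<tau>
  proof
    fix x assume x: "x \<in> convex hull \<sigma> \<inter> convex hull \<tau>"
    have f: "finite \<sigma>" "finite \<tau>" using st ac abstract_complex_finite by blast+
    obtain c where c: "x = bary_point c" "\<forall>v. 0 \<le> c v" "\<forall>v. v \<notin> \<sigma> \<longrightarrow> c v = 0" "sum c \<sigma> = 1"
      using x unfolding convex_hull_coords[OF f(1)] by blast
    obtain d where d: "x = bary_point d" "\<forall>v. 0 \<le> d v" "\<forall>v. v \<notin> \<tau> \<longrightarrow> d v = 0" "sum d \<tau> = 1"
      using x unfolding convex_hull_coords[OF f(2)] by blast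
    have m: "c \<in> bary_coords K" "d \<in> bary_coords K" using c d st ac by (auto intro: bary_coordsI)
    then have "c = d" using realized_inj[OF assms] c d by metis
    then have "{v. c v \<noteq> 0} \<subseteq> \<sigma> \<inter> \<tau>" using c d by auto
    then show "x \<in> convex hull (\<sigma> \<inter> \<tau>)" using bary_point_in_hull[OF m(1)] f c by simp
  qed
  moreover have "convex hull (\<sigma> \<inter> \<tau>) \<subseteq> convex hull \<sigma> \<inter> convex hull \<tau>" for \<sigma> \<tau> :: "'a set"
    by (simp add: hull_mono)
  ultimately have "\<forall>\<sigma>\<in>K. \<forall>\<tau>\<in>K. convex hull \<sigma> \<inter> convex hull \<tau> = convex hull (\<sigma> \<inter> \<tau>)"
    by (intro ballI equalityI)
  then show ?thesis using ac realized_independent[OF assms] by (simp add: geometric_complex_def)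
qed

lemma bary_sum_combine:
  assumes "finite I" "\<And>i. i \<in> I \<Longrightarrow> finite {v. d i v \<noteq> 0}"
  shows "bary_sum f (\<lambda>w. \<Sum>i\<in>I. c i * d i w) = (\<Sum>i\<in>I. c i *\<^sub>R bary_sum f (d i))"
proof -
  define W where "W = (\<Union>i\<in>I. {v. d i v \<noteq> 0})"
  have W: "finite W" using assms by (auto simp: W_def)
  have "(\<Sum>i\<in>I. c i * d i w) = 0" if "w \<notin> W" for w
    using that by (intro sum.neutral) (auto simp: W_def)
  then have "bary_sum f (\<lambda>w. \<Sum>i\<in>I. c i * d i w) = (\<Sum>w\<in>W. (\<Sum>i\<in>I. c i * d i w) *\<^sub>R f w)"
    using W by (intro bary_sum_sum) auto
  also have "\<dots> = (\<Sum>w\<in>W. \<Sum>i\<in>I. c i *\<^sub>R (d i w *\<^sub>R f w))" by (simp add: scaleR_sum_left)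
  also have "\<dots> = (\<Sum>i\<in>I. \<Sum>w\<in>W. c i *\<^sub>R (d i w *\<^sub>R f w))" by (rule sum.swap)
  also have "\<dots> = (\<Sum>i\<in>I. c i *\<^sub>R (\<Sum>w\<in>W. d i w *\<^sub>R f w))" by (simp add: scaleR_sum_right)
  also have "\<dots> = (\<Sum>i\<in>I. c i *\<^sub>R bary_sum f (d i))"
    using W by (intro sum.cong refl) (subst bary_sum_sum[of W], auto simp: W_def)
  finally show ?thesis .
qed

section \<open>Refinements and functions affine on simplices\<close>

definition simplexwise_affine :: "'v::real_normed_vector set set \<Rightarrow> ('v \<Rightarrow> 'w::real_vector) \<Rightarrow> bool" where
  "simplexwise_affine K h \<longleftrightarrow> (\<forall>c\<in>bary_coords K. h (bary_point c) = bary_sum h c)"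

text \<open>Testing the vertices is enough, since hulls are convex. Equality of carriers is not
  included and is tracked separately.\<close>

definition refines :: "'v::real_normed_vector set set \<Rightarrow> 'v set set \<Rightarrow> bool" where
  "refines K' K \<longleftrightarrow> (\<forall>\<sigma>'\<in>K'. \<exists>\<sigma>\<in>K. \<sigma>' \<subseteq> convex hull \<sigma>)"

lemma refines_refl: "refines K K" unfolding refines_def by (meson hull_subset)

lemma refines_trans: "refines K'' K' \<Longrightarrow> refines K' K \<Longrightarrow> refines K'' K"
  unfolding refines_def by (meson convex_convex_hull hull_minimal order_trans)

text \<open>The support of \<open>c\<close> lies in the hull of one simplex \<tau> of
  \<open>K\<close>. The coordinates of all its vertices can therefore be chosen with support in
  \<tau>, and then the combination has support in \<tau> as well.\<close>

lemma refined_coords: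
  assumes K: "abstract_complex K" and K': "abstract_complex K'" "refines K' K" and c: "c \<in> bary_coords K'"
  shows "\<exists>d. (\<forall>v. c v \<noteq> 0 \<longrightarrow> d v \<in> bary_coords K \<and> bary_point (d v) = v) \<and>
    (\<lambda>w. \<Sum>v | c v \<noteq> 0. c v * d v w) \<in> bary_coords K"
proof -
  let ?\<sigma> = "{v. c v \<noteq> 0}"
  have f: "finite ?\<sigma>" using c K' bary_coords_finite by blast
  obtain \<tau> where \<tau>: "\<tau> \<in> K" "?\<sigma> \<subseteq> convex hull \<tau>" using c K' unfolding refines_def bary_coords_def by blast
  have ft: "finite \<tau>" using \<tau> K abstract_complex_finite by blast
  have "\<forall>v. \<exists>e. c v \<noteq> 0 \<longrightarrow> v = bary_point e \<and> (\<forall>w. 0 \<le> e w) \<and> (\<forall>w. w \<notin> \<tau> \<longrightarrow> e w = 0) \<and> sum e \<tau> = 1"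
    using \<tau>(2) unfolding convex_hull_coords[OF ft] by blast
  then obtain d where d: "\<And>v. c v \<noteq> 0 \<Longrightarrow> v = bary_point (d v) \<and> (\<forall>w. 0 \<le> d v w) \<and> (\<forall>w. w \<notin> \<tau> \<longrightarrow> d v w = 0) \<and> sum (d v) \<tau> = 1"
    by metis
  have "d v \<in> bary_coords K" if "c v \<noteq> 0" for v using d[OF that] \<tau> K by (intro bary_coordsI) auto
  moreover have "(\<lambda>w. \<Sum>v\<in>?\<sigma>. c v * d v w) \<in> bary_coords K"
  proof (rule bary_coordsI[OF K \<tau>(1)])
    show "0 \<le> (\<Sum>v\<in>?\<sigma>. c v * d v w)" for w
      using c d by (intro sum_nonneg mult_nonneg_nonneg) (auto simp: bary_coords_def)
    show "(\<Sum>v\<in>?\<sigma>. c v * d v w) = 0" if "w \<notin> \<tau>" for w using that d by (intro sum.neutral) auto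
    have "(\<Sum>w\<in>\<tau>. \<Sum>v\<in>?\<sigma>. c v * d v w) = (\<Sum>v\<in>?\<sigma>. \<Sum>w\<in>\<tau>. c v * d v w)" by (rule sum.swap)
    also have "\<dots> = (\<Sum>v\<in>?\<sigma>. c v)" using d by (intro sum.cong) (auto simp flip: sum_distrib_left)
    finally show "(\<Sum>w\<in>\<tau>. \<Sum>v\<in>?\<sigma>. c v * d v w) = 1" using c by (simp add: bary_coords_def)
  qed
  moreover have "\<forall>v. c v \<noteq> 0 \<longrightarrow> bary_point (d v) = v" using d by auto
  ultimately show ?thesis by (intro exI[of _ d]) auto
qed

text \<open>Both sides are expanded through coordinates in \<open>K\<close>, where a vertex of
  \<open>K'\<close> has the value prescribed by its own coordinates.\<close>

lemma simplexwise_affine_refines: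
  assumes K: "abstract_complex K" and K': "abstract_complex K'" "refines K' K" and h: "simplexwise_affine K h"
  shows "simplexwise_affine K' h"
  unfolding simplexwise_affine_def
proof
  fix c assume c: "c \<in> bary_coords K'"
  obtain d where d: "\<And>v. c v \<noteq> 0 \<Longrightarrow> d v \<in> bary_coords K \<and> bary_point (d v) = v"
    and e: "(\<lambda>w. \<Sum>v | c v \<noteq> 0. c v * d v w) \<in> bary_coords K" (is "?e \<in> _")
    using refined_coords[OF K K' c] by blast
  have f: "finite {v. c v \<noteq> 0}" using c K' bary_coords_finite by blast
  have fd: "finite {w. d v w \<noteq> 0}" if "c v \<noteq> 0" for v using d[OF that] K bary_coords_finite by blast
  have "bary_point ?e = (\<Sum>v | c v \<noteq> 0. c v *\<^sub>R bary_point (d v))" using f fd by (intro bary_sum_combine) auto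
  also have "\<dots> = bary_point c" unfolding bary_sum_def[of _ c] using d by (intro sum.cong) auto
  finally have 1: "bary_point ?e = bary_point c" .
  have "h (bary_point c) = bary_sum h ?e" using bspec[OF h[unfolded simplexwise_affine_def] e] unfolding 1 .
  also have "\<dots> = (\<Sum>v | c v \<noteq> 0. c v *\<^sub>R bary_sum h (d v))" using f fd by (intro bary_sum_combine) auto
  also have "\<dots> = bary_sum h c" unfolding bary_sum_def[of _ c]
  proof (intro sum.cong refl)
    fix v assume "v \<in> {v. c v \<noteq> 0}"
    then have "d v \<in> bary_coords K" "bary_point (d v) = v" using d[of v] by simp_all
    then have "h v = bary_sum h (d v)" using bspec[OF h[unfolded simplexwise_affine_def], of "d v"] by simp
    then show "c v *\<^sub>R bary_sum h (d v) = c v *\<^sub>R h v" by simp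
  qed
  finally show "h (bary_point c) = bary_sum h c" .
qed

text \<open>\<open>p\<close> is meant to be an interior point of the face \<phi>. Since
  \<open>p\<close> is removed before each test, the formula also covers the starring of a vertex,
  \<open>\<phi> = {p}\<close>, which leaves the complex as it is.\<close>

definition stellar :: "'v set set \<Rightarrow> 'v set \<Rightarrow> 'v \<Rightarrow> 'v set set" where
  "stellar K \<phi> p = {\<tau>. \<tau> - {p} \<in> K \<and> \<not> \<phi> \<subseteq> \<tau> - {p} \<and> (p \<in> \<tau> \<longrightarrow> (\<tau> - {p}) \<union> \<phi> \<in> K)}"

lemma abstract_stellar:
  assumes "abstract_complex K" "\<phi> \<in> K" "\<phi> \<noteq> {}" shows "abstract_complex (stellar K \<phi> p)"
proof -
  have "stellar K \<phi> p \<subseteq> K \<union> insert p ` K"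
  proof
    fix \<tau> assume "\<tau> \<in> stellar K \<phi> p"
    then show "\<tau> \<in> K \<union> insert p ` K"
      by (cases "p \<in> \<tau>") (auto simp: stellar_def image_iff intro!: bexI[of _ "\<tau> - {p}"])
  qed
  then have "finite (stellar K \<phi> p)" by (rule finite_subset) (simp add: abstract_complexD(1)[OF assms(1)])
  moreover have "\<tau>' \<in> stellar K \<phi> p" if "\<tau> \<in> stellar K \<phi> p" "\<tau>' \<subseteq> \<tau>" for \<tau> \<tau>'
  proof -
    have "\<tau>' - {p} \<in> K" using that abstract_complex_subset[OF assms(1), of "\<tau> - {p}" "\<tau>' - {p}"]
      by (auto simp: stellar_def)
    moreover have "(\<tau>' - {p}) \<union> \<phi> \<in> K" if "p \<in> \<tau>'"
      using that \<open>\<tau> \<in> _\<close> \<open>\<tau>' \<subseteq> \<tau>\<close> by (intro abstract_complex_subset[OF assms(1), of "(\<tau> - {p}) \<union> \<phi>" "(\<tau>' - {p}) \<union> \<phi>"])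
       (auto simp: stellar_def)
    ultimately show ?thesis using that by (auto simp: stellar_def)
  qed
  moreover have "finite \<tau>" if "\<tau> \<in> stellar K \<phi> p" for \<tau>
    using that abstract_complex_finite[OF assms(1), of "\<tau> - {p}"] by (auto simp: stellar_def)
  moreover have "{} \<in> stellar K \<phi> p" using assms by (auto simp: stellar_def abstract_complex_def)
  ultimately show ?thesis by (intro abstract_complexI)
qed

locale stellar_point =
  fixes K :: "'v::real_normed_vector set set" and l :: "'v \<Rightarrow> real"
  assumes realized: "realized K" and l: "l \<in> bary_coords K"
begin

definition "\<phi> = {v. l v \<noteq> 0}"
definition "p = bary_point l"

text \<open>\<open>F\<close> translates barycentric coordinates of the subdivision into those of \<open>K\<close>. It is inverted by
  \<open>c p = Min {F c v / l v | v \<in> \<phi>}\<close>.\<close>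

definition F :: "('v \<Rightarrow> real) \<Rightarrow> 'v \<Rightarrow> real" where
  "F c = (\<lambda>w. (if w = p then 0 else c w) + c p * l w)"

lemma ac: "abstract_complex K" using realized by (rule realized_abstract)

lemma phi: "\<phi> \<in> K" "finite \<phi>" "\<phi> \<noteq> {}"
proof -
  show "\<phi> \<in> K" using l by (auto simp: \<phi>_def bary_coords_def)
  then show "finite \<phi>" using ac abstract_complex_finite by blast
  have "(\<Sum>v\<in>\<phi>. l v) = 1" using l by (simp add: \<phi>_def bary_coords_def)
  then show "\<phi> \<noteq> {}" by auto
qed

lemma p_vertex: assumes "p \<in> \<Union>K" shows "l = vertex_coord p" "\<phi> = {p}"
proof -
  show "l = vertex_coord p"
    using realized_inj[OF realized l vertex_coord_bary_coords[OF ac assms]] by (simp add: p_def bary_sum_vertex_coord)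
  have "{v. vertex_coord p v \<noteq> 0} = {p}" by (auto simp: vertex_coord_def)
  then show "\<phi> = {p}" using \<open>l = vertex_coord p\<close> by (simp add: \<phi>_def)
qed

text \<open>Spreading the weight of \<open>p\<close> according to \<open>l\<close> is invisible to
  every \<open>f\<close> whose value at \<open>p\<close> is its \<open>l\<close>-average. The
  identity as \<open>f\<close> gives the point, the constant 1 the total mass.\<close>

lemma bary_sum_F:
  assumes "finite {v. c v \<noteq> 0}" "f p = bary_sum f l" shows "bary_sum f (F c) = bary_sum f c"
proof -
  define W where "W = insert p ({v. c v \<noteq> 0} \<union> \<phi>)"
  have W: "finite W" "p \<in> W" "\<phi> \<subseteq> W" using assms(1) phi by (auto simp: W_def)
  have "bary_sum f (F c) = (\<Sum>w\<in>W. F c w *\<^sub>R f w)"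
    using W by (intro bary_sum_sum) (auto simp: W_def F_def \<phi>_def split: if_splits)
  also have "\<dots> = (\<Sum>w\<in>W. (if w = p then 0 else c w) *\<^sub>R f w) + (\<Sum>w\<in>W. c p *\<^sub>R (l w *\<^sub>R f w))"
    by (simp add: F_def algebra_simps sum.distrib)
  also have "(\<Sum>w\<in>W. c p *\<^sub>R (l w *\<^sub>R f w)) = c p *\<^sub>R f p"
    using W bary_sum_sum[of W l f] assms(2) by (simp add: \<phi>_def del: scaleR_scaleR flip: scaleR_sum_right)
  also have "(\<Sum>w\<in>W. (if w = p then 0 else c w) *\<^sub>R f w) = (\<Sum>w\<in>W - {p}. c w *\<^sub>R f w)"
    using W by (subst sum.remove[of W p]) (auto intro: sum.cong)
  also have "\<dots> + c p *\<^sub>R f p = (\<Sum>w\<in>W. c w *\<^sub>R f w)"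
    using W by (subst sum.remove[of W p]) auto
  also have "\<dots> = bary_sum f c" using W by (intro bary_sum_sum[symmetric]) (auto simp: W_def)
  finally show ?thesis .
qed

abbreviation "K' \<equiv> stellar K \<phi> p"

lemma ac': "abstract_complex K'" using ac phi by (intro abstract_stellar)

lemma F_mem: assumes c: "c \<in> bary_coords K'" shows "F c \<in> bary_coords K" "bary_point (F c) = bary_point c"
proof -
  let ?s = "{v. c v \<noteq> 0}"
  have s: "?s - {p} \<in> K" "c p \<noteq> 0 \<longrightarrow> (?s - {p}) \<union> \<phi> \<in> K"
    using c by (auto simp: bary_coords_def stellar_def)
  have nn: "0 \<le> c v" for v using c by (auto simp: bary_coords_def)
  have lnn: "0 \<le> l v" for v using l by (auto simp: bary_coords_def)
  have f: "finite ?s" using c ac' bary_coords_finite by blast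
  have "\<exists>\<rho>\<in>K. {w. F c w \<noteq> 0} \<subseteq> \<rho>"
  proof (cases "c p = 0")
    case True
    then have "{w. F c w \<noteq> 0} \<subseteq> ?s - {p}" by (auto simp: F_def)
    then show ?thesis using s by blast
  next
    case False
    have "{w. F c w \<noteq> 0} \<subseteq> (?s - {p}) \<union> \<phi>" by (auto simp: F_def \<phi>_def)
    then show ?thesis using s False by blast
  qed
  then have "{w. F c w \<noteq> 0} \<in> K" using abstract_complex_subset[OF ac] by blast
  moreover have "bary_sum (\<lambda>_. 1::real) (F c) = 1"
    using bary_sum_F[OF f, of "\<lambda>_. 1::real"] bary_coords_mass[OF l] bary_coords_mass[OF c] by simp
  ultimately show "F c \<in> bary_coords K" using nn lnn by (simp add: bary_coords_def bary_sum_one F_def)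
  show "bary_point (F c) = bary_point c" using f by (intro bary_sum_F) (auto simp: p_def)
qed

lemma F_le: assumes "c \<in> bary_coords K'" "d \<in> bary_coords K'" "F c = F d" shows "d p \<le> c p"
proof -
  have "\<not> \<phi> \<subseteq> {v. c v \<noteq> 0} - {p}" using assms(1) by (auto simp: bary_coords_def stellar_def)
  then obtain v where v: "v \<in> \<phi>" "v = p \<or> c v = 0" by auto
  then have "F c v = c p * l v" by (auto simp: F_def)
  moreover have "F d v \<ge> d p * l v" using assms(2) by (auto simp: F_def bary_coords_def)
  moreover have "l v > 0" using v l by (auto simp: \<phi>_def bary_coords_def order_less_le)
  ultimately show ?thesis using assms(3) by (metis mult_le_cancel_right_pos)
qed

lemma F_inj: "inj_on F (bary_coords K')"
proof
  fix c d assume cd: "c \<in> bary_coords K'" "d \<in> bary_coords K'" "F c = F d"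
  then have p: "c p = d p" using F_le by (metis order_antisym)
  have "c w = d w" for w using fun_cong[OF cd(3), of w] p by (cases "w = p") (auto simp: F_def)
  then show "c = d" by auto
qed

lemma F_surj: assumes c: "c \<in> bary_coords K" shows "\<exists>c'\<in>bary_coords K'. F c' = c"
proof -
  let ?s = "{v. c v \<noteq> 0}"
  have s: "?s \<in> K" "\<And>v. 0 \<le> c v" using c by (auto simp: bary_coords_def)
  have pK: "p \<in> \<Union>K" if "c p \<noteq> 0" using that s by blast
  have lnn: "0 \<le> l v" for v using l by (auto simp: bary_coords_def)
  have f: "finite ?s" using c ac bary_coords_finite by blast
  show ?thesis
  proof (cases "\<phi> \<subseteq> ?s")
    case False
    have "c p = 0" using pK p_vertex(2) False by force
    then have "?s - {p} = ?s" by auto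
    then have "c \<in> bary_coords K'" using c False \<open>c p = 0\<close> by (simp add: bary_coords_def stellar_def)
    moreover have "F c = c" using \<open>c p = 0\<close> by (auto simp: F_def)
    ultimately show ?thesis by blast
  next
    case True
    \<comment> \<open>The largest multiple of \<open>l\<close> that can be subtracted from
      \<open>c\<close>; it uses up the weight of some vertex \<open>v0\<close> of \<phi>, so that
      \<phi> no longer lies in the support.\<close>
    define \<mu> where "\<mu> = Min ((\<lambda>v. c v / l v) ` \<phi>)"
    have "\<mu> \<in> (\<lambda>v. c v / l v) ` \<phi>" unfolding \<mu>_def using phi by (intro Min_in) auto
    then obtain v0 where v0: "v0 \<in> \<phi>" "\<mu> = c v0 / l v0" by blast
    have lpos: "l v > 0" if "v \<in> \<phi>" for v using that lnn by (auto simp: \<phi>_def order_less_le)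
    have le: "\<mu> * l v \<le> c v" for v
    proof (cases "v \<in> \<phi>")
      case True
      then have "\<mu> \<le> c v / l v" unfolding \<mu>_def using phi by (intro Min_le) auto
      then show ?thesis using lpos[OF True] by (simp add: pos_le_divide_eq)
    qed (use s in \<open>auto simp: \<phi>_def\<close>)
    have mu: "\<mu> \<ge> 0" using v0 lpos[OF v0(1)] s(2)[of v0] by simp
    define c' where "c' w = (if w = p then \<mu> else c w - \<mu> * l w)" for w
    \<comment> \<open>The weight at \<open>p\<close> is overwritten by \<mu>, which is consistent
      only if \<open>\<mu> * l p = c p\<close>. Either \<phi> is \<open>{p}\<close>, or
      \<open>p\<close> is no vertex of \<open>K\<close> and both sides vanish.\<close>
    have lp: "\<mu> * l p = c p"
    proof (cases "p \<in> \<Union>K")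
      case True
      then have "v0 = p" using p_vertex v0 by auto
      moreover have "l p = 1" using fun_cong[OF p_vertex(1)[OF True], of p] by (simp add: vertex_coord_def)
      ultimately show ?thesis using v0 by simp
    next
      case False
      then have "c p = 0" "l p = 0" using pK phi by (auto simp: \<phi>_def)
      then show ?thesis by simp
    qed
    have Fc: "F c' = c"
    proof
      show "F c' w = c w" for w using lp by (cases "w = p") (simp_all add: F_def c'_def)
    qed
    have sub: "{v. c' v \<noteq> 0} - {p} \<subseteq> ?s"
    proof
      fix v assume v: "v \<in> {v. c' v \<noteq> 0} - {p}"
      show "v \<in> ?s"
      proof (cases "v \<in> \<phi>")
        case False
        then have "v \<noteq> p" "c' v \<noteq> 0" "l v = 0" using v by (simp_all add: \<phi>_def)
        then show ?thesis by (simp add: c'_def)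
      qed (use True in blast)
    qed
    then have f': "finite {v. c' v \<noteq> 0}" using f finite_subset by fastforce
    have "\<not> \<phi> \<subseteq> {v. c' v \<noteq> 0} - {p}"
    proof -
      have "v0 = p \<or> c' v0 = 0" using v0 lpos[OF v0(1)] by (auto simp: c'_def)
      then show ?thesis using v0 by auto
    qed
    moreover have "{v. c' v \<noteq> 0} - {p} \<in> K" "({v. c' v \<noteq> 0} - {p}) \<union> \<phi> \<in> K"
      by (rule abstract_complex_subset[OF ac s(1)], use sub True in blast)+
    moreover have "bary_sum (\<lambda>_. 1::real) c' = 1"
      using bary_sum_F[OF f', of "\<lambda>_. 1::real"] Fc bary_coords_mass[OF l] bary_coords_mass[OF c] by simp
    ultimately have "c' \<in> bary_coords K'" using mu le by (simp add: bary_coords_def stellar_def bary_sum_one c'_def)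
    then show ?thesis using Fc by blast
  qed
qed

lemma stellar_realized: "realized K'"
proof -
  have "inj_on bary_point (bary_coords K')"
  proof (rule inj_onI)
    fix c d assume cd: "c \<in> bary_coords K'" "d \<in> bary_coords K'" "bary_point c = bary_point d"
    then have "F c = F d" by (intro realized_inj[OF realized] F_mem) (simp_all add: F_mem(2))
    then show "c = d" using cd F_inj by (simp add: inj_on_def)
  qed
  then show ?thesis using ac' by (simp add: realized_def)
qed

lemma stellar_carrier: "carrier_of K' = carrier_of K"
proof -
  have "bary_point ` bary_coords K' = bary_point ` bary_coords K"
  proof (intro equalityI subsetI)
    fix x assume "x \<in> bary_point ` bary_coords K'"
    then obtain c where "x = bary_point c" "c \<in> bary_coords K'" by (rule imageE)
    then show "x \<in> bary_point ` bary_coords K" using F_mem by (intro image_eqI[of _ _ "F c"]) simp_all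
  next
    fix x assume "x \<in> bary_point ` bary_coords K"
    then obtain c where c: "x = bary_point c" "c \<in> bary_coords K" by (rule imageE)
    obtain c' where "c' \<in> bary_coords K'" "F c' = c" using F_surj[OF c(2)] by (rule bexE)
    then show "x \<in> bary_point ` bary_coords K'" using c F_mem(2)[of c'] by (intro image_eqI[of _ _ c']) simp_all
  qed
  then show ?thesis using ac ac' by (simp add: carrier_coords)
qed

lemma stellar_refines: "refines K' K"
  unfolding refines_def
proof
  fix \<tau> assume t: "\<tau> \<in> K'"
  show "\<exists>\<sigma>\<in>K. \<tau> \<subseteq> convex hull \<sigma>"
  proof (cases "p \<in> \<tau>")
    case True
    have "p \<in> convex hull \<phi>" unfolding p_def using phi by (intro bary_point_in_hull[OF l]) (auto simp: \<phi>_def)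
    then have "p \<in> convex hull ((\<tau> - {p}) \<union> \<phi>)" by (meson hull_mono in_mono sup_ge2)
    moreover have "\<tau> - {p} \<subseteq> convex hull ((\<tau> - {p}) \<union> \<phi>)" by (meson hull_subset sup_ge1 order_trans)
    ultimately show ?thesis using t True by (intro bexI[of _ "(\<tau> - {p}) \<union> \<phi>"]) (auto simp: stellar_def)
  next
    case False
    then show ?thesis using t hull_subset[of \<tau> convex] by (intro bexI[of _ \<tau>]) (auto simp: stellar_def)
  qed
qed

end

section \<open>Subdivision of edges and cutting along zero sets\<close>

definition edge_step :: "'v::real_normed_vector set set \<Rightarrow> 'v set set \<Rightarrow> bool" where
  "edge_step K K' \<longleftrightarrow> (\<exists>a b t. a \<noteq> b \<and> {a, b} \<in> K \<and> 0 < t \<and> t < 1 \<and>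
     K' = stellar K {a, b} ((1 - t) *\<^sub>R a + t *\<^sub>R b))"

definition edge_coord :: "'v \<Rightarrow> 'v \<Rightarrow> real \<Rightarrow> 'v \<Rightarrow> real" where
  "edge_coord a b t v = (if v = a then 1 - t else if v = b then t else 0)"

lemma edge_coord: assumes "a \<noteq> b" "0 < t" "t < 1"
  shows "{v. edge_coord a b t v \<noteq> 0} = {a, b}" "bary_sum f (edge_coord a b t) = (1 - t) *\<^sub>R f a + t *\<^sub>R f b"
  "abstract_complex K \<Longrightarrow> {a, b} \<in> K \<Longrightarrow> edge_coord a b t \<in> bary_coords K"
proof -
  show "{v. edge_coord a b t v \<noteq> 0} = {a, b}" using assms by (auto simp: edge_coord_def)
  then show "bary_sum f (edge_coord a b t) = (1 - t) *\<^sub>R f a + t *\<^sub>R f b"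
    using assms by (subst bary_sum_sum[of "{a,b}"]) (auto simp: edge_coord_def)
  show "abstract_complex K \<Longrightarrow> {a, b} \<in> K \<Longrightarrow> edge_coord a b t \<in> bary_coords K"
    using assms by (rule_tac bary_coordsI[of K "{a,b}"]) (auto simp: edge_coord_def)
qed

lemma edge_stellar:
  assumes "realized K" "a \<noteq> b" "{a, b} \<in> K" "0 < t" "t < 1"
  defines "m \<equiv> (1 - t) *\<^sub>R a + t *\<^sub>R b"
  shows "realized (stellar K {a, b} m)" "carrier_of (stellar K {a, b} m) = carrier_of K"
    "refines (stellar K {a, b} m) K" "m \<notin> \<Union>K"
proof -
  interpret stellar_point K "edge_coord a b t"
    using assms edge_coord(3) by unfold_locales (auto simp: realized_def)
  have [simp]: "\<phi> = {a,b}" "p = m" using assms edge_coord[of a b t] by (auto simp: \<phi>_def p_def m_def)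
  show "realized (stellar K {a, b} m)" "carrier_of (stellar K {a, b} m) = carrier_of K"
    "refines (stellar K {a, b} m) K"
    using stellar_realized stellar_carrier stellar_refines by simp_all
  show "m \<notin> \<Union>K"
  proof
    assume "m \<in> \<Union>K"
    then have "{a, b} = {m}" using p_vertex(2) by simp
    then show False using assms(2) by auto
  qed
qed

lemma edge_step_props:
  assumes "realized K" "edge_step K K'"
  shows "realized K'" "carrier_of K' = carrier_of K" "refines K' K" "\<Union>K \<subseteq> \<Union>K'"
proof -
  obtain a b t where s: "a \<noteq> b" "{a, b} \<in> K" "0 < t" "t < 1"
     "K' = stellar K {a, b} ((1 - t) *\<^sub>R a + t *\<^sub>R b)" (is "_ = stellar K _ ?m")
    using assms(2) unfolding edge_step_def by blast
  note e = edge_stellar[OF assms(1) s(1-4)]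
  show "realized K'" "carrier_of K' = carrier_of K" "refines K' K" unfolding s(5) by (fact e)+
  show "\<Union>K \<subseteq> \<Union>K'"
  proof
    fix v assume v: "v \<in> \<Union>K"
    then have "v \<noteq> ?m" using e(4) by blast
    moreover have "{v} \<in> K"
      using v abstract_complex_vertex[OF realized_abstract[OF assms(1)]] by (rule iffD1[rotated])
    moreover have "\<not> {a, b} \<subseteq> {v}" using s(1) by blast
    ultimately have "{v} \<in> K'" unfolding s(5) stellar_def by simp
    then show "v \<in> \<Union>K'" by blast
  qed
qed

lemma edge_step_rtrancl_props:
  assumes "edge_step\<^sup>*\<^sup>* K K'" "realized K"
  shows "realized K' \<and> carrier_of K' = carrier_of K \<and> refines K' K \<and> \<Union>K \<subseteq> \<Union>K'"
  using assms
proof induction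
  case base then show ?case by (simp add: refines_refl)
next
  case (step L M)
  then have L: "realized L" "carrier_of L = carrier_of K" "refines L K" "\<Union>K \<subseteq> \<Union>L" by simp_all
  note M = edge_step_props[OF L(1) step.hyps(2)]
  show ?case using L M refines_trans[OF M(3) L(3)] subset_trans[OF L(4) M(4)] by simp
qed

text \<open>Every edge crossing the zero set of \<open>h\<close> is starred at its zero. The new edges all end in a zero
  of \<open>h\<close>, so the number of crossing edges drops.\<close>

lemma cut:
  fixes h :: "'v::real_normed_vector \<Rightarrow> real"
  assumes "realized K" "simplexwise_affine K h"
  shows "\<exists>K'. edge_step\<^sup>*\<^sup>* K K' \<and> (\<forall>\<sigma>\<in>K'. (\<forall>v\<in>\<sigma>. 0 \<le> h v) \<or> (\<forall>v\<in>\<sigma>. h v \<le> 0)) \<and>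
    (\<forall>v\<in>\<Union>K'. v \<in> \<Union>K \<or> h v = 0)"
  using assms
proof (induction "card {e\<in>K. \<exists>a b. e = {a,b} \<and> h a < 0 \<and> 0 < h b}" arbitrary: K rule: less_induct)
  case less
  let ?C = "\<lambda>K. {e\<in>K. \<exists>a b. e = {a,b} \<and> h a < 0 \<and> 0 < h b}"
  have ac: "abstract_complex K" using less.prems realized_abstract by blast
  show ?case
  proof (cases "?C K = {}")
    case True
    have "(\<forall>v\<in>\<sigma>. 0 \<le> h v) \<or> (\<forall>v\<in>\<sigma>. h v \<le> 0)" if s: "\<sigma> \<in> K" for \<sigma>
    proof (rule ccontr)
      assume "\<not> ?thesis"
      then obtain v w where "v \<in> \<sigma>" "w \<in> \<sigma>" "h v < 0" "0 < h w" by (auto simp: not_le)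
      then have "{v,w} \<in> ?C K" using abstract_complex_subset[OF ac s] by auto
      then show False using True by blast
    qed
    then show ?thesis by blast
  next
    case False
    then obtain a b where ab: "{a,b} \<in> K" "h a < 0" "0 < h b" by blast
    define t where "t = h a / (h a - h b)"
    have t: "0 < t" "t < 1" using ab by (auto simp: t_def divide_simps)
    have neq: "a \<noteq> b" using ab by auto
    define m where "m = (1 - t) *\<^sub>R a + t *\<^sub>R b"
    define K' where "K' = stellar K {a,b} m"
    have edge_step: "edge_step K K'" unfolding edge_step_def K'_def m_def using ab t neq by blast
    have "h (bary_point (edge_coord a b t)) = bary_sum h (edge_coord a b t)"
      using less.prems(2) edge_coord(3)[OF neq t ac ab(1)] by (auto simp: simplexwise_affine_def)
    then have "h m = (1 - t) * h a + t * h b" by (simp add: m_def edge_coord(2)[OF neq t])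
    also have "\<dots> = 0" using ab by (simp add: t_def field_simps)
    finally have hm: "h m = 0" .
    note p = edge_step_props[OF less.prems(1) edge_step]
    have sub: "?C K' \<subseteq> ?C K - {{a,b}}"
    proof
      fix e assume e: "e \<in> ?C K'"
      then have "m \<notin> e" using hm by auto
      then have "e - {m} = e" by auto
      then have "e \<in> K" "\<not> {a,b} \<subseteq> e" using e by (auto simp: K'_def stellar_def)
      then show "e \<in> ?C K - {{a,b}}" using e by auto
    qed
    have "finite (?C K)" using ac by (auto simp: abstract_complex_def)
    then have "card (?C K') < card (?C K)" using sub ab by (intro psubset_card_mono) auto
    moreover have "simplexwise_affine K' h" using simplexwise_affine_refines[OF ac realized_abstract[OF p(1)] p(3) less.prems(2)] .
    ultimately obtain K'' where K'': "edge_step\<^sup>*\<^sup>* K' K''" "\<forall>\<sigma>\<in>K''. (\<forall>v\<in>\<sigma>. 0 \<le> h v) \<or> (\<forall>v\<in>\<sigma>. h v \<le> 0)"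
        "\<forall>v\<in>\<Union>K''. v \<in> \<Union>K' \<or> h v = 0"
      using less.hyps[OF _ p(1)] by blast
    have K'_vertex: "v \<in> \<Union>K \<or> v = m" if vK': "v \<in> \<Union>K'" for v
    proof -
      obtain \<tau> where "\<tau> \<in> K'" "v \<in> \<tau>" using vK' by auto
      then have "\<tau> - {m} \<in> K" "v = m \<or> v \<in> \<tau> - {m}" by (auto simp: K'_def stellar_def)
      then show ?thesis by blast
    qed
    have "v \<in> \<Union>K \<or> h v = 0" if "v \<in> \<Union>K''" for v
      using bspec[OF K''(3) that] K'_vertex[of v] hm by metis
    moreover have "edge_step\<^sup>*\<^sup>* K K''" using edge_step K''(1) by (rule converse_rtranclp_into_rtranclp)
    ultimately show ?thesis using K''(2) by (intro exI[of _ K''] conjI ballI) simp_all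
  qed
qed

section \<open>Simplexwise affine representatives\<close>

text \<open>Among the subsets whose hull contains \<open>x\<close>, one of least cardinality is
  independent: moving the weights along an affine dependence until the first of them vanishes would
  give a smaller one.\<close>

lemma caratheodory_independent:
  fixes F :: "'v::real_normed_vector set"
  assumes "finite F" "x \<in> convex hull F"
  shows "\<exists>Q\<subseteq>F. \<not> affine_dependent Q \<and> x \<in> convex hull Q"
proof -
  let ?P = "\<lambda>Q. Q \<subseteq> F \<and> x \<in> convex hull Q"
  obtain Q where Q: "Q \<subseteq> F" "x \<in> convex hull Q" and min: "\<And>Q'. ?P Q' \<Longrightarrow> card Q \<le> card Q'"
    using ex_has_least_nat[of ?P F card] assms(2) by blast
  have f: "finite Q" using Q(1) assms(1) finite_subset by blast
  have "\<not> affine_dependent Q"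
  proof
    assume "affine_dependent Q"
    then obtain U where U: "sum U Q = 0" "\<exists>v\<in>Q. U v \<noteq> 0" "(\<Sum>v\<in>Q. U v *\<^sub>R v) = 0"
      using affine_dependent_explicit_finite[OF f] by blast
    obtain c where c: "\<And>v. v \<in> Q \<Longrightarrow> 0 \<le> c v" "sum c Q = 1" "(\<Sum>v\<in>Q. c v *\<^sub>R v) = x"
      using Q(2) f by (auto simp: convex_hull_finite)
    define P where "P = {v\<in>Q. U v > 0}"
    have "P \<noteq> {}"
    proof
      assume "P = {}"
      then have le: "\<And>v. v \<in> Q \<Longrightarrow> 0 \<le> - U v" by (auto simp: P_def not_less)
      have "sum (\<lambda>v. - U v) Q = 0" using U(1) by (simp add: sum_negf)
      then have "\<forall>v\<in>Q. - U v = 0" using sum_nonneg_eq_0_iff[OF f, of "\<lambda>v. - U v"] le by simp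
      then show False using U(2) by simp
    qed
    have fP: "finite P" using f by (simp add: P_def)
    \<comment> \<open>The length at which the first weight with positive \<open>U\<close> is used
      up: the weight of \<open>v0\<close> becomes 0 and all others stay nonnegative.\<close>
    define t where "t = Min ((\<lambda>v. c v / U v) ` P)"
    have "t \<in> (\<lambda>v. c v / U v) ` P" unfolding t_def using fP \<open>P \<noteq> {}\<close> by (intro Min_in) auto
    then obtain v0 where v0: "v0 \<in> P" "t = c v0 / U v0" by blast
    have t0: "t \<ge> 0" using v0 c by (simp add: P_def)
    define c' where "c' v = c v - t * U v" for v
    have nn: "0 \<le> c' v" if v: "v \<in> Q" for v
    proof (cases "U v > 0")
      case True
      then have "t \<le> c v / U v" unfolding t_def using fP v by (intro Min_le) (auto simp: P_def)
      then show ?thesis using True by (simp add: c'_def pos_le_divide_eq)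
    next
      case False
      then have "t * U v \<le> 0" using t0 by (simp add: mult_nonneg_nonpos)
      then show ?thesis using c(1)[OF v] by (simp add: c'_def)
    qed
    have v0Q: "v0 \<in> Q" "c' v0 = 0" using v0 by (auto simp: P_def c'_def)
    have "sum c' Q = 1" using U(1) c(2) by (simp add: c'_def sum_subtractf flip: sum_distrib_left)
    then have s1: "sum c' (Q - {v0}) = 1" using sum.remove[OF f v0Q(1), of c'] v0Q by simp
    have "(\<Sum>v\<in>Q. c' v *\<^sub>R v) = (\<Sum>v\<in>Q. c v *\<^sub>R v) - t *\<^sub>R (\<Sum>v\<in>Q. U v *\<^sub>R v)"
      by (simp add: c'_def scaleR_sum_right sum_subtractf algebra_simps)
    then have "(\<Sum>v\<in>Q. c' v *\<^sub>R v) = x" using U(3) c(3) by simp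
    then have s2: "(\<Sum>v\<in>Q - {v0}. c' v *\<^sub>R v) = x"
      using sum.remove[OF f v0Q(1), of "\<lambda>v. c' v *\<^sub>R v"] v0Q by simp
    have "x \<in> convex hull (Q - {v0})"
      unfolding convex_hull_finite[OF finite_Diff[OF f]] using s1 s2 nn by (intro CollectI exI[of _ c']) auto
    then have "card Q \<le> card (Q - {v0})" using Q(1) by (intro min) auto
    then show False using f v0Q(1) by (metis card_Diff1_less not_less)
  qed
  then show ?thesis using Q by blast
qed

section \<open>Cutting out simplices by half-spaces\<close>

definition affine_fun :: "('v::real_normed_vector \<Rightarrow> real) \<Rightarrow> bool" where
  "affine_fun h \<longleftrightarrow> (\<exists>g a. linear g \<and> h = (\<lambda>x. g x + a))"

lemma affine_fun_simplexwise_affine: assumes "affine_fun h" shows "simplexwise_affine K h"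
  unfolding simplexwise_affine_def
proof
  fix c assume c: "c \<in> bary_coords K"
  obtain g a where g: "linear g" "h = (\<lambda>x. g x + a)" using assms by (auto simp: affine_fun_def)
  have "(\<Sum>v | c v \<noteq> 0. c v) = 1" using c by (simp add: bary_coords_def)
  then have "(\<Sum>v | c v \<noteq> 0. c v * a) = a" by (simp flip: sum_distrib_right)
  then show "h (bary_point c) = bary_sum h c"
    by (simp add: g(2) bary_sum_def linear_sum[OF g(1)] linear_scale[OF g(1)] algebra_simps sum.distrib)
qed

lemma affine_fun_convex: assumes "affine_fun h" shows "convex {x. 0 \<le> h x}" "convex {x. h x \<le> 0}"
proof -
  obtain g a where g: "linear g" "h = (\<lambda>x. g x + a)" using assms by (auto simp: affine_fun_def)
  have *: "h (u *\<^sub>R x + v *\<^sub>R y) = u * h x + v * h y" if "u + v = 1" for u v x y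
  proof -
    have "a = u * a + v * a" using that by (simp flip: distrib_right)
    then show ?thesis by (simp add: g(2) linear_add[OF g(1)] linear_scale[OF g(1)] algebra_simps)
  qed
  show "convex {x. 0 \<le> h x}" "convex {x. h x \<le> 0}"
    by (rule convexI; simp add: * mult_nonneg_nonpos add_nonpos_nonpos)+
qed

lemma dual_basis:
  fixes B :: "'v::real_normed_vector set"
  assumes "independent B" "finite B"
  shows "\<exists>g. (\<forall>b. linear (g b)) \<and> (\<forall>b. \<forall>x\<in>B. g b x = (if x = b then 1 else (0::real))) \<and>
    (\<forall>y\<in>span B. y = (\<Sum>b\<in>B. g b y *\<^sub>R b))"
proof -
  have "\<exists>g. linear g \<and> (\<forall>x\<in>B. g x = (if x = b then 1 else (0::real)))" for b
    using linear_independent_extend[OF assms(1), of "\<lambda>x. if x = b then 1 else (0::real)"] by blast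
  then obtain g where g: "\<And>b. linear (g b)" "\<And>b x. x \<in> B \<Longrightarrow> g b x = (if x = b then 1 else (0::real))"
    by metis
  have "y = (\<Sum>b\<in>B. g b y *\<^sub>R b)" if y: "y \<in> span B" for y
  proof -
    obtain r where r: "y = (\<Sum>b\<in>B. r b *\<^sub>R b)" using y real_vector.span_finite[OF assms(2)] by auto
    have "g b y = r b" if b: "b \<in> B" for b
    proof -
      have "g b y = (\<Sum>b'\<in>B. r b' * g b b')" unfolding r by (simp add: linear_sum[OF g(1)] linear_scale[OF g(1)])
      also have "\<dots> = (\<Sum>b'\<in>B. if b' = b then r b' else 0)" using g(2) by (intro sum.cong) auto
      also have "\<dots> = r b" using assms(2) b by simp
      finally show ?thesis .
    qed
    then show ?thesis using r by simp
  qed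
  then show ?thesis using g by blast
qed

text \<open>In coordinates based at the vertex \<open>q0\<close>, the simplex is the set where the
  coordinates along \<open>D\<close> are nonnegative with sum at most 1 and the remaining ones
  vanish. The description is confined to the hull of a finite set, because there finitely many
  coordinates suffice.\<close>

lemma simplex_halfspaces:
  fixes W :: "'v::real_normed_vector set"
  assumes W: "finite W" and Q: "finite Q" "\<not> affine_dependent Q" "Q \<noteq> {}"
  shows "\<exists>H. finite H \<and> (\<forall>h\<in>H. affine_fun h) \<and>
    (\<forall>x\<in>convex hull W. x \<in> convex hull Q \<longleftrightarrow> (\<forall>h\<in>H. 0 \<le> h x))"
proof -
  obtain q0 where q0: "q0 \<in> Q" using Q(3) by blast
  let ?s = "\<lambda>x. - q0 + x"
  define D where "D = ?s ` (Q - {q0})"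
  define V where "V = ?s ` (W \<union> Q)"
  have "independent D"
    using affine_dependent_iff_dependent[of q0 "Q - {q0}"] Q(2) q0 by (simp add: D_def insert_absorb)
  moreover have DV: "D \<subseteq> V" by (auto simp: D_def V_def)
  ultimately obtain B where B: "D \<subseteq> B" "B \<subseteq> V" "independent B" "V \<subseteq> span B"
    using real_vector.maximal_independent_subset_extend by metis
  have fB: "finite B" using B(2) W Q(1) finite_subset by (auto simp: V_def)
  have fD: "finite D" using B(1) fB finite_subset by blast
  obtain g where g: "\<And>b. linear (g b)" "\<And>b x. x \<in> B \<Longrightarrow> g b x = (if x = b then 1 else (0::real))"
      "\<And>y. y \<in> span B \<Longrightarrow> y = (\<Sum>b\<in>B. g b y *\<^sub>R b)"
    using dual_basis[OF B(3) fB] by blast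
  define k where "k b x = g b (?s x)" for b x
  define m where "m x = 1 - (\<Sum>b\<in>D. k b x)" for x
  \<comment> \<open>\<open>m\<close> is the barycentric coordinate at \<open>q0\<close>. The
    functions \<open>k b\<close> for \<open>b\<close> outside \<open>D\<close> enter with both signs
    and thereby force a point into the affine hull of \<open>Q\<close>.\<close>
  define H where "H = insert m (k ` B \<union> (\<lambda>b x. - k b x) ` (B - D))"
  have ka: "k b x = g b x + (- g b q0)" for b x
    by (simp add: k_def linear_add[OF g(1)] linear_neg[OF g(1)] linear_diff[OF g(1)])
  have haffk: "affine_fun (k b)" for b unfolding affine_fun_def using ka g(1) by blast
  have "affine_fun m"
  proof -
    have "linear (\<lambda>x. - (\<Sum>b\<in>D. g b x))"
      by (rule linearI) (simp_all add: linear_add[OF g(1)] linear_scale[OF g(1)] sum.distrib sum_distrib_left)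
    moreover have "m = (\<lambda>x. - (\<Sum>b\<in>D. g b x) + (1 - (\<Sum>b\<in>D. - g b q0)))"
      by (rule ext) (simp add: m_def ka sum.distrib sum_subtractf sum_negf)
    ultimately show ?thesis unfolding affine_fun_def by blast
  qed
  moreover have "affine_fun (\<lambda>x. - k b x)" for b
  proof -
    have "linear (\<lambda>x. - g b x)"
      by (rule linearI) (simp_all add: linear_add[OF g(1)] linear_scale[OF g(1)])
    moreover have "(\<lambda>x. - k b x) = (\<lambda>x. - g b x + g b q0)" by (simp add: ka)
    ultimately show ?thesis unfolding affine_fun_def by blast
  qed
  ultimately have hH: "\<forall>h\<in>H. affine_fun h" using haffk by (auto simp: H_def)
  have fH: "finite H" using fB by (simp add: H_def)
  have kq: "k b q0 = 0" for b by (simp add: k_def linear_0[OF g(1)])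
  have kq': "k b q = (if ?s q = b then 1 else 0)" if "q \<in> Q - {q0}" for b q
    using that B(1) g(2)[of "?s q" b] by (auto simp: k_def D_def)
  have vert: "0 \<le> h q" if q: "q \<in> Q" and h: "h \<in> H" for q h
  proof (cases "q = q0")
    case True
    then show ?thesis using h by (auto simp: H_def m_def kq)
  next
    case False
    then have qq: "q \<in> Q - {q0}" using q by simp
    then have sD: "?s q \<in> D" by (auto simp: D_def)
    have "m q = 0" using fD sD by (simp add: m_def kq'[OF qq])
    moreover have "0 \<le> k b q" for b by (simp add: kq'[OF qq])
    moreover have "k b q = 0" if "b \<notin> D" for b using that sD by (auto simp: kq'[OF qq])
    ultimately show ?thesis using h by (auto simp: H_def)
  qed
  have "x \<in> convex hull Q \<longleftrightarrow> (\<forall>h\<in>H. 0 \<le> h x)" if x: "x \<in> convex hull W" for x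
  proof
    assume xQ: "x \<in> convex hull Q"
    show "\<forall>h\<in>H. 0 \<le> h x"
    proof
      fix h assume h: "h \<in> H"
      then have "convex hull Q \<subseteq> {x. 0 \<le> h x}"
        using vert affine_fun_convex(1) hH by (intro hull_minimal) auto
      then show "0 \<le> h x" using xQ by blast
    qed
  next
    assume H: "\<forall>h\<in>H. 0 \<le> h x"
    have k0: "k b x = 0" if "b \<in> B - D" for b
    proof -
      have "k b \<in> H" "(\<lambda>x. - k b x) \<in> H" using that by (auto simp: H_def)
      then have "0 \<le> k b x" "0 \<le> - k b x" using bspec[OF H] by fastforce+
      then show ?thesis by simp
    qed
    have kp: "0 \<le> k b x" if "b \<in> B" for b
    proof -
      have "k b \<in> H" using that by (auto simp: H_def)
      then show ?thesis using H by blast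
    qed
    have mp: "0 \<le> m x" using H by (auto simp: H_def)
    have "?s x \<in> convex hull V" unfolding V_def using x
      by (simp only: convex_hull_translation) (meson hull_mono imageI subsetD sup_ge1)
    then have "?s x \<in> span B"
      by (meson B(4) convex_hull_subset_span real_vector.span_minimal real_vector.subspace_span subsetD)
    then have "?s x = (\<Sum>b\<in>B. k b x *\<^sub>R b)" unfolding k_def by (rule g(3))
    also have "\<dots> = (\<Sum>b\<in>D. k b x *\<^sub>R b)" using fB B(1) k0 by (intro sum.mono_neutral_right) auto
    also have "\<dots> = (\<Sum>q\<in>Q-{q0}. k (?s q) x *\<^sub>R ?s q)" unfolding D_def by (subst sum.reindex) (auto simp: inj_on_def)
    also have "\<dots> = (\<Sum>q\<in>Q-{q0}. k (?s q) x *\<^sub>R q) - (\<Sum>q\<in>Q-{q0}. k (?s q) x) *\<^sub>R q0"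
      by (simp add: algebra_simps sum_subtractf scaleR_sum_left)
    finally have e: "x = (\<Sum>q\<in>Q-{q0}. k (?s q) x *\<^sub>R q) + (1 - (\<Sum>q\<in>Q-{q0}. k (?s q) x)) *\<^sub>R q0"
      by (simp add: algebra_simps)
    define c where "c q = (if q = q0 then 1 - (\<Sum>q\<in>Q-{q0}. k (?s q) x) else k (?s q) x)" for q
    have mm: "m x = 1 - (\<Sum>q\<in>Q-{q0}. k (?s q) x)" unfolding m_def D_def by (subst sum.reindex) (auto simp: inj_on_def)
    have "\<forall>q\<in>Q. 0 \<le> c q"
    proof
      fix q assume "q \<in> Q"
      then have "?s q \<in> B" if "q \<noteq> q0" using that B(1) by (auto simp: D_def)
      then show "0 \<le> c q" using kp mp mm by (auto simp: c_def)
    qed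
    moreover have "sum c Q = 1" using Q(1) q0 by (subst sum.remove[of _ q0]) (auto simp: c_def)
    moreover have "(\<Sum>q\<in>Q. c q *\<^sub>R q) = x"
    proof -
      have "(\<Sum>q\<in>Q. c q *\<^sub>R q) = (\<Sum>q\<in>Q-{q0}. c q *\<^sub>R q) + c q0 *\<^sub>R q0"
        using sum.remove[OF Q(1) q0, of "\<lambda>q. c q *\<^sub>R q"] by simp
      also have "(\<Sum>q\<in>Q-{q0}. c q *\<^sub>R q) = (\<Sum>q\<in>Q-{q0}. k (?s q) x *\<^sub>R q)"
        by (intro sum.cong) (auto simp: c_def)
      also have "c q0 = 1 - (\<Sum>q\<in>Q-{q0}. k (?s q) x)" by (simp add: c_def)
      also note e[symmetric]
      finally show ?thesis .
    qed
    ultimately show "x \<in> convex hull Q" unfolding convex_hull_finite[OF Q(1)] by blast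
  qed
  then show ?thesis using fH hH by blast
qed

text \<open>Later cuts do not spoil earlier ones: half-spaces are convex, so a simplex on one side
  is refined by simplices on the same side.\<close>

lemma multi_cut:
  assumes "realized K" "finite H" "\<forall>h\<in>H. affine_fun h"
  shows "\<exists>K'. edge_step\<^sup>*\<^sup>* K K' \<and> (\<forall>h\<in>H. \<forall>\<sigma>\<in>K'. (\<forall>v\<in>\<sigma>. 0 \<le> h v) \<or> (\<forall>v\<in>\<sigma>. h v \<le> 0))"
  using assms(2,3)
proof induction
  case empty then show ?case by blast
next
  case (insert h H)
  then obtain K' where K': "edge_step\<^sup>*\<^sup>* K K'" "\<forall>h\<in>H. \<forall>\<sigma>\<in>K'. (\<forall>v\<in>\<sigma>. 0 \<le> h v) \<or> (\<forall>v\<in>\<sigma>. h v \<le> 0)"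
    by blast
  have g: "realized K'" using edge_step_rtrancl_props[OF K'(1) assms(1)] by simp
  have "simplexwise_affine K' h" using insert.prems by (intro affine_fun_simplexwise_affine) simp
  from cut[OF g this] obtain K'' where K'': "edge_step\<^sup>*\<^sup>* K' K''" "\<forall>\<sigma>\<in>K''. (\<forall>v\<in>\<sigma>. 0 \<le> h v) \<or> (\<forall>v\<in>\<sigma>. h v \<le> 0)"
    by blast
  have r: "refines K'' K'" using edge_step_rtrancl_props[OF K''(1) g] by simp
  have "(\<forall>v\<in>\<sigma>. 0 \<le> h' v) \<or> (\<forall>v\<in>\<sigma>. h' v \<le> 0)" if h': "h' \<in> H" and s: "\<sigma> \<in> K''" for h' \<sigma>
  proof -
    obtain \<tau> where t: "\<tau> \<in> K'" "\<sigma> \<subseteq> convex hull \<tau>" using r s unfolding refines_def by blast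
    have ha: "affine_fun h'" using insert.prems h' by simp
    from K'(2) h' t(1) have "\<tau> \<subseteq> {v. 0 \<le> h' v} \<or> \<tau> \<subseteq> {v. h' v \<le> 0}" by blast
    then have "convex hull \<tau> \<subseteq> {v. 0 \<le> h' v} \<or> convex hull \<tau> \<subseteq> {v. h' v \<le> 0}"
      using affine_fun_convex[OF ha] by (metis hull_minimal)
    then show ?thesis using t(2) by blast
  qed
  then have "\<forall>h\<in>insert h H. \<forall>\<sigma>\<in>K''. (\<forall>v\<in>\<sigma>. 0 \<le> h v) \<or> (\<forall>v\<in>\<sigma>. h v \<le> 0)"
    using K''(2) by simp
  moreover have "edge_step\<^sup>*\<^sup>* K K''" using K'(1) K''(1) by (rule rtranclp_trans)
  ultimately show ?case by blast
qed

lemma carrier_subset_hull: "carrier_of K \<subseteq> convex hull (\<Union>K)"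
  unfolding carrier_of_def by (meson UN_least Sup_upper hull_mono)

lemma vertex_in_carrier: "\<sigma> \<in> K \<Longrightarrow> v \<in> \<sigma> \<Longrightarrow> v \<in> carrier_of K"
  unfolding carrier_of_def by (meson UN_iff hull_inc)

text \<open>After cutting along all hyperplanes that define the simplices in \<open>\<Q>\<close>,
  the barycentre of \<sigma> decides where \<sigma> lies. It belongs to some \<open>Q\<close>, so
  each function defining \<open>Q\<close> has a nonnegative mean over the vertices of \<sigma>; as
  its values there do not change sign, none of them is negative.\<close>

lemma refine_cover:
  fixes K :: "'v::real_normed_vector set set"
  assumes K: "realized K" and Q: "finite \<Q>" "\<And>Q. Q \<in> \<Q> \<Longrightarrow> finite Q \<and> \<not> affine_dependent Q"
    and cov: "carrier_of K \<subseteq> (\<Union>Q\<in>\<Q>. convex hull Q)"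
  shows "\<exists>K'. edge_step\<^sup>*\<^sup>* K K' \<and> (\<forall>\<sigma>\<in>K'. \<sigma> \<noteq> {} \<longrightarrow> (\<exists>Q\<in>\<Q>. \<sigma> \<subseteq> convex hull Q))"
proof -
  let ?W = "\<Union>K"
  have fW: "finite ?W" using K realized_abstract abstract_complex_finite_vertices by blast
  have "\<exists>H. Q \<in> \<Q> - {{}} \<longrightarrow> finite H \<and> (\<forall>h\<in>H. affine_fun h) \<and>
    (\<forall>x\<in>convex hull ?W. x \<in> convex hull Q \<longleftrightarrow> (\<forall>h\<in>H. 0 \<le> h x))" for Q
    using simplex_halfspaces[OF fW, of Q] Q(2)[of Q] by blast
  then obtain H where H: "\<And>Q. Q \<in> \<Q> - {{}} \<Longrightarrow> finite (H Q) \<and> (\<forall>h\<in>H Q. affine_fun h) \<and>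
    (\<forall>x\<in>convex hull ?W. x \<in> convex hull Q \<longleftrightarrow> (\<forall>h\<in>H Q. 0 \<le> h x))" by metis
  define HH where "HH = (\<Union>Q\<in>\<Q> - {{}}. H Q)"
  have HH: "finite HH" "\<forall>h\<in>HH. affine_fun h" unfolding HH_def using H Q(1) by auto
  obtain K' where K': "edge_step\<^sup>*\<^sup>* K K'" "\<forall>h\<in>HH. \<forall>\<sigma>\<in>K'. (\<forall>v\<in>\<sigma>. 0 \<le> h v) \<or> (\<forall>v\<in>\<sigma>. h v \<le> 0)"
    using multi_cut[OF K HH] by blast
  have p: "realized K'" "carrier_of K' = carrier_of K" using edge_step_rtrancl_props[OF K'(1) K] by simp_all
  have ac: "abstract_complex K'" using p(1) by (rule realized_abstract)
  have "\<exists>Q\<in>\<Q>. \<sigma> \<subseteq> convex hull Q" if s: "\<sigma> \<in> K'" "\<sigma> \<noteq> {}" for \<sigma>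
  proof -
    have fs: "finite \<sigma>" using ac s(1) by (rule abstract_complex_finite)
    define c where "c v = (if v \<in> \<sigma> then 1 / real (card \<sigma>) else 0)" for v
    have n: "card \<sigma> \<noteq> 0" using fs s by simp
    have c: "c \<in> bary_coords K'" using n by (intro bary_coordsI[OF ac s(1)]) (auto simp: c_def)
    define x where "x = bary_point c"
    have "x \<in> carrier_of K'" unfolding x_def carrier_coords[OF ac] using c by blast
    then have xK: "x \<in> carrier_of K" using p(2) by simp
    then obtain Q where Q: "Q \<in> \<Q>" "x \<in> convex hull Q" using cov by blast
    then have "Q \<in> \<Q> - {{}}" by auto
    note HQ = H[OF this]
    have xW: "x \<in> convex hull ?W" using xK carrier_subset_hull by blast
    have "v \<in> convex hull Q" if v: "v \<in> \<sigma>" for v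
    proof -
      have vW: "v \<in> convex hull ?W" using vertex_in_carrier[OF s(1) v] p(2) carrier_subset_hull by blast
      have "0 \<le> h v" if h: "h \<in> H Q" for h
      proof -
        have hH: "h \<in> HH" using h \<open>Q \<in> \<Q> - {{}}\<close> by (auto simp: HH_def)
        then have "affine_fun h" using HH by blast
        then have "h x = bary_sum h c" using affine_fun_simplexwise_affine[of h K'] c by (auto simp: simplexwise_affine_def x_def)
        also have "\<dots> = (\<Sum>v\<in>\<sigma>. c v * h v)" using fs by (subst bary_sum_sum[of \<sigma>]) (auto simp: c_def)
        also have "\<dots> = (\<Sum>v\<in>\<sigma>. h v) / card \<sigma>" by (simp add: c_def sum_divide_distrib)
        finally have hx: "h x = (\<Sum>v\<in>\<sigma>. h v) / card \<sigma>" .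
        have "0 \<le> h x" using HQ xW Q(2) h by blast
        then have s0: "0 \<le> (\<Sum>v\<in>\<sigma>. h v)" using n hx by (simp add: zero_le_divide_iff)
        consider "\<forall>v\<in>\<sigma>. 0 \<le> h v" | "\<forall>v\<in>\<sigma>. h v \<le> 0" using K'(2) hH s(1) by blast
        then show ?thesis
        proof cases
          case 2
          have "(\<Sum>v\<in>\<sigma>. h v) \<le> h v + (\<Sum>v\<in>\<sigma>-{v}. 0)" using fs v 2
            by (subst sum.remove[OF fs v]) (intro add_mono sum_mono, auto)
          then show ?thesis using s0 by simp
        qed (use v in blast)
      qed
      then show ?thesis using HQ vW by blast
    qed
    then show ?thesis using Q(1) by blast
  qed
  then show ?thesis using K'(1) by blast
qed

section \<open>Affine pieces of a polyhedral relation\<close>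

lemma bary_sum_Pair: "bary_sum (\<lambda>v. (f v, g v)) c = (bary_sum f c, bary_sum g c)"
  by (simp add: bary_sum_def prod_eq_iff fst_sum snd_sum)

lemma bary_sum_linear:
  assumes "finite {v. c v \<noteq> 0}" "finite {v. d v \<noteq> 0}"
  shows "bary_sum f (\<lambda>v. s * c v + t * d v) = s *\<^sub>R bary_sum f c + t *\<^sub>R bary_sum f d"
proof -
  let ?W = "{v. c v \<noteq> 0} \<union> {v. d v \<noteq> 0}"
  have f: "finite ?W" using assms by simp
  have "bary_sum f (\<lambda>v. s * c v + t * d v) = (\<Sum>v\<in>?W. (s * c v + t * d v) *\<^sub>R f v)" using f by (intro bary_sum_sum) auto
  also have "\<dots> = s *\<^sub>R (\<Sum>v\<in>?W. c v *\<^sub>R f v) + t *\<^sub>R (\<Sum>v\<in>?W. d v *\<^sub>R f v)"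
    by (simp add: scaleR_sum_right sum.distrib algebra_simps)
  also have "\<dots> = s *\<^sub>R bary_sum f c + t *\<^sub>R bary_sum f d"
    using bary_sum_sum[OF f, of c f] bary_sum_sum[OF f, of d f] by simp
  finally show ?thesis .
qed

lemma bary_sum_in_convex:
  assumes "c \<in> bary_coords K" "abstract_complex K" "convex C" "\<And>v. c v \<noteq> 0 \<Longrightarrow> f v \<in> C"
  shows "bary_sum f c \<in> C"
  unfolding bary_sum_def
  using assms bary_coords_finite[OF assms(2,1)] by (intro convex_sum) (auto simp: bary_coords_def)

text \<open>The part of \<open>R\<close> over a simplex of \<open>L\<close> is a finite union of
  polytopes. Their projections to the domain are covered by finitely many independent simplices, and
  a refinement of \<open>K\<close> subordinate to this cover has the required properties: above one
  of its simplices a single convex piece of \<open>R\<close> contains the images of all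
  vertices.\<close>

lemma pl_iso_simplexwise:
  fixes K :: "'v::real_normed_vector set set" and L :: "'w::real_normed_vector set set"
  assumes K: "realized K" and R: "pl_iso R (carrier_of K) (carrier_of L)" and L: "abstract_complex L"
  shows "\<exists>K' f. edge_step\<^sup>*\<^sup>* K K' \<and> (\<forall>c\<in>bary_coords K'. (bary_point c, bary_sum f c) \<in> R) \<and>
     (\<forall>\<sigma>\<in>K'. \<exists>\<tau>\<in>L. f ` \<sigma> \<subseteq> convex hull \<tau>)"
proof -
  have fL: "finite L" using L by (rule abstract_complexD)
  have cR: "polyhedral R" and D: "Domain R = carrier_of K" "Range R = carrier_of L" and sv: "single_valued R"
    using R by (auto simp: pl_iso_def)
  have "\<exists>\<F>. \<tau> \<in> L \<longrightarrow> finite \<F> \<and> (\<forall>F\<in>\<F>. finite F) \<and> R O Id_on (convex hull \<tau>) = (\<Union>F\<in>\<F>. convex hull F)" for \<tau>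
    using cR L polyhedral_relcomp[of R "Id_on (convex hull \<tau>)"] polyhedral_Id_on[of "convex hull \<tau>"] polyhedral_hull[of \<tau>]
      abstract_complexD(3)[OF L, of \<tau>] unfolding polyhedral_def[of "_ O _"] by blast
  then obtain \<F> where F: "\<And>\<tau>. \<tau> \<in> L \<Longrightarrow> finite (\<F> \<tau>) \<and> (\<forall>F\<in>\<F> \<tau>. finite F) \<and>
      R O Id_on (convex hull \<tau>) = (\<Union>F\<in>\<F> \<tau>. convex hull F)" by metis
  have piece: "p \<in> R \<and> snd p \<in> convex hull \<tau>" if "\<tau> \<in> L" "F \<in> \<F> \<tau>" "p \<in> convex hull F" for \<tau> F p
  proof -
    have "p \<in> R O Id_on (convex hull \<tau>)" using F[OF that(1)] that(2,3) by blast
    then show ?thesis by auto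
  qed
  have lin_fst: "linear (fst :: 'v \<times> 'w \<Rightarrow> 'v)" by (auto intro!: linearI)
  define f where "f v = (THE y. (v, y) \<in> R)" for v
  have f: "f v = y" if "(v, y) \<in> R" for v y
    unfolding f_def using that sv by (auto simp: single_valued_def)
  \<comment> \<open>By Caratheodory's theorem the independent subsets of the projected spanning sets
    cover the projections.\<close>
  define \<Q> where "\<Q> = {Q. \<exists>\<tau>\<in>L. \<exists>F\<in>\<F> \<tau>. Q \<subseteq> fst ` F \<and> \<not> affine_dependent Q}"
  have fin: "finite Q \<and> \<not> affine_dependent Q" if Q: "Q \<in> \<Q>" for Q
  proof -
    obtain \<tau> F' where *: "\<tau> \<in> L" "F' \<in> \<F> \<tau>" "Q \<subseteq> fst ` F'" "\<not> affine_dependent Q"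
      using Q by (auto simp: \<Q>_def)
    then have "finite F'" using F by blast
    then show ?thesis using * finite_subset by blast
  qed
  have "finite (\<Union>\<tau>\<in>L. \<Union>F\<in>\<F> \<tau>. Pow (fst ` F))" using fL F by auto
  then have "finite \<Q>" by (rule rev_finite_subset) (auto simp: \<Q>_def)
  moreover have "carrier_of K \<subseteq> (\<Union>Q\<in>\<Q>. convex hull Q)"
  proof
    fix x assume "x \<in> carrier_of K"
    then obtain y where xy: "(x, y) \<in> R" using D by blast
    then have "y \<in> carrier_of L" using D by blast
    then obtain \<tau> where \<tau>: "\<tau> \<in> L" "y \<in> convex hull \<tau>" by (auto simp: carrier_of_def)
    then have "(x, y) \<in> R O Id_on (convex hull \<tau>)" using xy by auto
    then obtain F' where F': "F' \<in> \<F> \<tau>" "(x, y) \<in> convex hull F'" using F[OF \<tau>(1)] by auto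
    have "x \<in> fst ` (convex hull F')" using F'(2) by force
    then have "x \<in> convex hull (fst ` F')" by (simp add: convex_hull_linear_image[OF lin_fst])
    moreover have "finite (fst ` F')" using F[OF \<tau>(1)] F' by blast
    ultimately obtain Q where "Q \<subseteq> fst ` F'" "\<not> affine_dependent Q" "x \<in> convex hull Q"
      using caratheodory_independent by blast
    then show "x \<in> (\<Union>Q\<in>\<Q>. convex hull Q)" using \<tau>(1) F'(1) by (auto simp: \<Q>_def)
  qed
  ultimately obtain K' where K': "edge_step\<^sup>*\<^sup>* K K'" "\<forall>\<sigma>\<in>K'. \<sigma> \<noteq> {} \<longrightarrow> (\<exists>Q\<in>\<Q>. \<sigma> \<subseteq> convex hull Q)"
    using refine_cover[OF K, of \<Q>] fin by blast
  have ac: "abstract_complex K'" using edge_step_rtrancl_props[OF K'(1) K] realized_abstract by blast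
  have key: "\<exists>\<tau>\<in>L. \<exists>F\<in>\<F> \<tau>. \<forall>v\<in>\<sigma>. (v, f v) \<in> convex hull F" if s: "\<sigma> \<in> K'" "\<sigma> \<noteq> {}" for \<sigma>
  proof -
    obtain Q where Q: "Q \<in> \<Q>" "\<sigma> \<subseteq> convex hull Q" using K'(2) s by blast
    then obtain \<tau> F' where *: "\<tau> \<in> L" "F' \<in> \<F> \<tau>" "Q \<subseteq> fst ` F'" by (auto simp: \<Q>_def)
    have "\<forall>v\<in>\<sigma>. (v, f v) \<in> convex hull F'"
    proof
      fix v assume "v \<in> \<sigma>"
      then have "v \<in> convex hull (fst ` F')" using Q(2) hull_mono[OF *(3)] by blast
      then have "v \<in> fst ` (convex hull F')" by (simp add: convex_hull_linear_image[OF lin_fst])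
      then obtain p where p: "p \<in> convex hull F'" "v = fst p" by blast
      have "p \<in> R" using piece[OF *(1,2) p(1)] by simp
      then have "f v = snd p" using f[of v "snd p"] p(2) by simp
      then show "(v, f v) \<in> convex hull F'" using p by simp
    qed
    then show ?thesis using * by blast
  qed
  have A: "\<forall>c\<in>bary_coords K'. (bary_point c, bary_sum f c) \<in> R"
  proof
    fix c assume c: "c \<in> bary_coords K'"
    let ?\<sigma> = "{v. c v \<noteq> 0}"
    have "(\<Sum>v\<in>?\<sigma>. c v) = 1" using c by (simp add: bary_coords_def)
    then have "?\<sigma> \<noteq> {}" by (metis sum.empty zero_neq_one)
    moreover have "?\<sigma> \<in> K'" using c by (simp add: bary_coords_def)
    ultimately have "?\<sigma> \<in> K'" "?\<sigma> \<noteq> {}" by simp_all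
    from key[OF this] obtain \<tau> F' where *: "\<tau> \<in> L" "F' \<in> \<F> \<tau>" "\<forall>v\<in>?\<sigma>. (v, f v) \<in> convex hull F'" by blast
    \<comment> \<open>The combination of the points \<open>(v, f v)\<close> stays in one convex
      piece of \<open>R\<close>, so the affine extension of \<open>f\<close> has its graph in
      \<open>R\<close>.\<close>
    have "bary_sum (\<lambda>v. (v, f v)) c \<in> convex hull F'"
      using * by (intro bary_sum_in_convex[OF c ac]) auto
    then show "(bary_point c, bary_sum f c) \<in> R" using piece[OF *(1,2)] by (simp add: bary_sum_Pair)
  qed
  have "\<exists>\<tau>\<in>L. f ` \<sigma> \<subseteq> convex hull \<tau>" if s: "\<sigma> \<in> K'" for \<sigma>
  proof (cases "\<sigma> = {}")
    case True
    then show ?thesis using abstract_complexD(2)[OF L] by auto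
  next
    case False
    from key[OF s this] obtain \<tau> F' where *: "\<tau> \<in> L" "F' \<in> \<F> \<tau>" "\<forall>v\<in>\<sigma>. (v, f v) \<in> convex hull F'" by blast
    have "f v \<in> convex hull \<tau>" if v: "v \<in> \<sigma>" for v
      using piece[OF *(1,2) bspec[OF *(3) v]] by simp
    then have "f ` \<sigma> \<subseteq> convex hull \<tau>" by (rule image_subsetI)
    then show ?thesis using *(1) by (rule bexI)
  qed
  then have B: "\<forall>\<sigma>\<in>K'. \<exists>\<tau>\<in>L. f ` \<sigma> \<subseteq> convex hull \<tau>" by (rule ballI)
  show ?thesis by (rule exI[of _ K'], rule exI[of _ f], rule conjI[OF K'(1)], rule conjI[OF A B])
qed

section \<open>PL homeomorphisms and polyhedral relations\<close>

lemma affine_graph_hull: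
  assumes f: "affine_map_on (convex hull \<sigma>) f"
  shows "(\<lambda>x. (x, f x)) ` (convex hull \<sigma>) = convex hull ((\<lambda>x. (x, f x)) ` \<sigma>)"
proof (rule equalityI)
  let ?g = "\<lambda>x. (x, f x)"
  have aff: "f ((1 - t) *\<^sub>R x + t *\<^sub>R y) = (1 - t) *\<^sub>R f x + t *\<^sub>R f y"
    if "x \<in> convex hull \<sigma>" "y \<in> convex hull \<sigma>" "0 \<le> t" "t \<le> 1" for x y t
    using f that by (simp add: affine_map_on_def)
  let ?A = "{x \<in> convex hull \<sigma>. ?g x \<in> convex hull (?g ` \<sigma>)}"
  have "convex ?A"
  proof (rule convex_alt[THEN iffD2], intro ballI allI impI)
    fix x y and t :: real assume xy: "x \<in> ?A" "y \<in> ?A" and t: "0 \<le> t \<and> t \<le> 1"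
    let ?z = "(1 - t) *\<^sub>R x + t *\<^sub>R y"
    have "?z \<in> convex hull \<sigma>" using xy t by (intro convexD[OF convex_convex_hull]) auto
    moreover have "(1 - t) *\<^sub>R ?g x + t *\<^sub>R ?g y \<in> convex hull (?g ` \<sigma>)"
      using xy t by (intro convexD[OF convex_convex_hull]) auto
    moreover have "(1 - t) *\<^sub>R ?g x + t *\<^sub>R ?g y = ?g ?z" using aff[of x y t] xy t by simp
    ultimately show "?z \<in> ?A" by simp
  qed
  moreover have "\<sigma> \<subseteq> ?A" by (auto intro: hull_inc)
  ultimately have "convex hull \<sigma> \<subseteq> ?A" by (intro hull_minimal)
  then show "?g ` (convex hull \<sigma>) \<subseteq> convex hull (?g ` \<sigma>)" by blast
  show "convex hull (?g ` \<sigma>) \<subseteq> ?g ` (convex hull \<sigma>)"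
  proof (rule hull_minimal)
    show "?g ` \<sigma> \<subseteq> ?g ` (convex hull \<sigma>)" by (intro image_mono hull_subset)
    show "convex (?g ` (convex hull \<sigma>))"
    proof (rule convex_alt[THEN iffD2], intro ballI allI impI)
      fix p q and t :: real assume pq: "p \<in> ?g ` (convex hull \<sigma>)" "q \<in> ?g ` (convex hull \<sigma>)" and t: "0 \<le> t \<and> t \<le> 1"
      obtain x where x: "p = ?g x" "x \<in> convex hull \<sigma>" using pq(1) by (rule imageE)
      obtain y where y: "q = ?g y" "y \<in> convex hull \<sigma>" using pq(2) by (rule imageE)
      let ?z = "(1 - t) *\<^sub>R x + t *\<^sub>R y"
      have "?z \<in> convex hull \<sigma>" using x y t by (intro convexD[OF convex_convex_hull]) auto
      moreover have "(1 - t) *\<^sub>R p + t *\<^sub>R q = ?g ?z" using aff[of x y t] x y t by simp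
      ultimately show "(1 - t) *\<^sub>R p + t *\<^sub>R q \<in> ?g ` (convex hull \<sigma>)" by (rule image_eqI[rotated])
    qed
  qed
qed

lemma pl_homeomorphic_imp_pl_iso:
  assumes "pl_homeomorphic K L" shows "\<exists>R. pl_iso R (carrier_of K) (carrier_of L)"
proof -
  obtain f g where h: "homeomorphism (carrier_of K) (carrier_of L) f g" and pl: "pl_map K L f"
    using assms unfolding pl_homeomorphic_def by blast
  obtain K' where K': "subdivision_of K' K" "\<forall>\<sigma>\<in>K'. affine_map_on (convex hull \<sigma>) f"
    using pl unfolding pl_map_def by blast
  have c: "carrier_of K' = carrier_of K" and ac: "abstract_complex K'"
    using K'(1) by (auto simp: subdivision_of_def geometric_complex_def)
  let ?g = "\<lambda>x. (x, f x)"
  let ?R = "?g ` carrier_of K"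
  have "?R = (\<Union>\<sigma>\<in>K'. convex hull (?g ` \<sigma>))"
    unfolding c[symmetric] unfolding carrier_of_def image_UN
    using K'(2) by (intro SUP_cong refl affine_graph_hull) blast
  also have "polyhedral \<dots>" using abstract_complexD[OF ac] by (intro polyhedral_UN polyhedral_hull) auto
  finally have "polyhedral ?R" .
  moreover have "Domain ?R = carrier_of K" by auto
  moreover have "Range ?R = carrier_of L"
    unfolding homeomorphism_image1[OF h, symmetric] Range_snd by (simp add: image_image)
  moreover have "single_valued ?R" by (rule single_valuedI) auto
  moreover have "single_valued (?R\<inverse>)"
  proof (rule single_valuedI)
    fix x y z assume "(x, y) \<in> ?R\<inverse>" "(x, z) \<in> ?R\<inverse>"
    then have "y \<in> carrier_of K" "z \<in> carrier_of K" "f y = f z" by auto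
    then show "y = z" using homeomorphism_apply1[OF h] by metis
  qed
  ultimately have "pl_iso ?R (carrier_of K) (carrier_of L)" by (simp add: pl_iso_def)
  then show ?thesis by blast
qed

lemma bary_coords_convex:
  assumes "abstract_complex K" "\<sigma> \<in> K" "c \<in> bary_coords K" "d \<in> bary_coords K"
    "{v. c v \<noteq> 0} \<subseteq> \<sigma>" "{v. d v \<noteq> 0} \<subseteq> \<sigma>" "0 \<le> t" "t \<le> 1"
  shows "(\<lambda>v. (1 - t) * c v + t * d v) \<in> bary_coords K"
proof (rule bary_coordsI[OF assms(1,2)])
  have f: "finite \<sigma>" using assms by (rule_tac abstract_complex_finite)
  have z: "c v = 0" "d v = 0" if "v \<notin> \<sigma>" for v using that assms(5,6) by auto
  show "0 \<le> (1 - t) * c v + t * d v" for v using assms by (auto simp: bary_coords_def)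
  show "(1 - t) * c v + t * d v = 0" if "v \<notin> \<sigma>" for v using z that by simp
  have "sum c \<sigma> = 1" "sum d \<sigma> = 1"
    using bary_sum_sum[OF f assms(5), of "\<lambda>_. 1::real"] bary_sum_sum[OF f assms(6), of "\<lambda>_. 1::real"]
      bary_coords_mass assms(3,4) by force+
  then show "(\<Sum>v\<in>\<sigma>. (1 - t) * c v + t * d v) = 1"
    by (simp add: sum.distrib flip: sum_distrib_left)
qed

lemma hull_coords_in:
  assumes "abstract_complex K" "\<sigma> \<in> K" "x \<in> convex hull \<sigma>"
  shows "\<exists>c\<in>bary_coords K. x = bary_point c \<and> {v. c v \<noteq> 0} \<subseteq> \<sigma>"
proof -
  have f: "finite \<sigma>" using assms(1,2) by (rule abstract_complex_finite)
  obtain c where "x = bary_point c" "\<forall>v. 0 \<le> c v" "\<forall>v. v \<notin> \<sigma> \<longrightarrow> c v = 0" "sum c \<sigma> = 1"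
    using assms(3) unfolding convex_hull_coords[OF f] by blast
  then show ?thesis using assms(1,2) by (intro bexI[of _ c]) (auto intro: bary_coordsI)
qed

text \<open>Since \<open>R\<close> is single-valued, a function with graph in \<open>R\<close>
  agrees with the simplexwise affine representative, and the subdivision belonging to the latter
  serves for the former.\<close>

lemma pl_iso_imp_pl_map:
  assumes K: "realized K" and L: "abstract_complex L" and R: "pl_iso R (carrier_of K) (carrier_of L)"
    and f: "\<And>x. x \<in> carrier_of K \<Longrightarrow> (x, f x) \<in> R"
  shows "pl_map K L f"
proof -
  have sv: "single_valued R" and D: "Range R = carrier_of L" using R by (auto simp: pl_iso_def)
  obtain K' f' where K': "edge_step\<^sup>*\<^sup>* K K'" and f': "\<forall>c\<in>bary_coords K'. (bary_point c, bary_sum f' c) \<in> R"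
    using pl_iso_simplexwise[OF K R L] by blast
  have p: "realized K'" "carrier_of K' = carrier_of K" "refines K' K"
    using edge_step_rtrancl_props[OF K' K] by simp_all
  have ac: "abstract_complex K'" using p(1) by (rule realized_abstract)
  have ff: "f (bary_point c) = bary_sum f' c" if c: "c \<in> bary_coords K'" for c
  proof -
    have "bary_point c \<in> carrier_of K" unfolding p(2)[symmetric] carrier_coords[OF ac] using c by (rule imageI)
    then have "(bary_point c, f (bary_point c)) \<in> R" by (rule f)
    moreover have "(bary_point c, bary_sum f' c) \<in> R" using f' c by (rule bspec)
    ultimately show ?thesis using sv by (rule single_valuedD[rotated])
  qed
  have "affine_map_on (convex hull \<sigma>) f" if s: "\<sigma> \<in> K'" for \<sigma>
    unfolding affine_map_on_def
  proof (intro ballI)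
    fix x y and t :: real assume xy: "x \<in> convex hull \<sigma>" "y \<in> convex hull \<sigma>" and t: "t \<in> {0..1}"
    obtain c where c: "c \<in> bary_coords K'" "x = bary_point c" "{v. c v \<noteq> 0} \<subseteq> \<sigma>"
      using hull_coords_in[OF ac s xy(1)] by blast
    obtain d where d: "d \<in> bary_coords K'" "y = bary_point d" "{v. d v \<noteq> 0} \<subseteq> \<sigma>"
      using hull_coords_in[OF ac s xy(2)] by blast
    note fin = bary_coords_finite[OF ac c(1)] bary_coords_finite[OF ac d(1)]
    let ?e = "\<lambda>v. (1 - t) * c v + t * d v"
    have e: "?e \<in> bary_coords K'" using bary_coords_convex[OF ac s c(1) d(1) c(3) d(3)] t by simp
    have "f ((1 - t) *\<^sub>R x + t *\<^sub>R y) = f (bary_point ?e)"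
      using bary_sum_linear[OF fin, of "\<lambda>v. v" "1 - t" t] c d by simp
    also have "\<dots> = (1 - t) *\<^sub>R bary_sum f' c + t *\<^sub>R bary_sum f' d" using ff[OF e] bary_sum_linear[OF fin] by simp
    also have "\<dots> = (1 - t) *\<^sub>R f x + t *\<^sub>R f y" using ff[OF c(1)] ff[OF d(1)] c(2) d(2) by simp
    finally show "f ((1 - t) *\<^sub>R x + t *\<^sub>R y) = (1 - t) *\<^sub>R f x + t *\<^sub>R f y" .
  qed
  moreover have "subdivision_of K' K"
    unfolding subdivision_of_def
  proof (intro conjI ballI)
    show "geometric_complex K'" using p(1) by (rule realized_imp_geometric)
    show "carrier_of K' = carrier_of K" by (fact p(2))
    fix \<sigma> assume "\<sigma> \<in> K'"
    then obtain \<tau> where "\<tau> \<in> K" "\<sigma> \<subseteq> convex hull \<tau>" using p(3) unfolding refines_def by blast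
    then show "\<exists>\<tau>\<in>K. convex hull \<sigma> \<subseteq> convex hull \<tau>"
      by (intro bexI[of _ \<tau>] hull_minimal convex_convex_hull)
  qed
  moreover have "f ` carrier_of K \<subseteq> carrier_of L" using f D by blast
  ultimately show ?thesis unfolding pl_map_def by blast
qed

lemma pl_iso_imp_pl_homeomorphic:
  assumes K: "realized K" and L: "realized L" and R: "pl_iso R (carrier_of K) (carrier_of L)"
  shows "pl_homeomorphic K L"
proof -
  obtain f g where h: "homeomorphism (carrier_of K) (carrier_of L) f g" and f: "\<forall>x\<in>carrier_of K. (x, f x) \<in> R"
    using pl_iso_homeomorphism[OF R] by blast
  have "pl_map K L f" using f by (intro pl_iso_imp_pl_map[OF K realized_abstract[OF L] R]) blast
  moreover have "pl_map L K g"
  proof (rule pl_iso_imp_pl_map[OF L realized_abstract[OF K] pl_iso_converse[OF R]])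
    fix y assume y: "y \<in> carrier_of L"
    then have "g y \<in> carrier_of K" using homeomorphism_image2[OF h] by blast
    then have "(g y, f (g y)) \<in> R" using f by blast
    then show "(y, g y) \<in> R\<inverse>" using homeomorphism_apply2[OF h y] by simp
  qed
  ultimately show ?thesis using h unfolding pl_homeomorphic_def by blast
qed

section \<open>Simplicial isomorphisms as relations\<close>

definition simp_rel :: "('v::real_normed_vector \<Rightarrow> 'w::real_normed_vector) \<Rightarrow> 'v set set \<Rightarrow> ('v \<times> 'w) set" where
  "simp_rel b K = (\<lambda>c. (bary_point c, bary_sum b c)) ` bary_coords K"

lemma simp_rel_mono: "A \<subseteq> K \<Longrightarrow> simp_rel b A \<subseteq> simp_rel b K"
  unfolding simp_rel_def by (intro image_mono bary_coords_mono)

lemma simp_rel_cong: "(\<And>v. v \<in> \<Union>K \<Longrightarrow> b v = b' v) \<Longrightarrow> simp_rel b K = simp_rel b' K"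
proof -
  assume *: "\<And>v. v \<in> \<Union>K \<Longrightarrow> b v = b' v"
  have "bary_sum b c = bary_sum b' c" if "c \<in> bary_coords K" for c
  proof (rule bary_sum_cong)
    fix v assume "c v \<noteq> 0"
    then show "b v = b' v" using that by (intro *) (auto simp: bary_coords_def)
  qed
  then show ?thesis unfolding simp_rel_def by (intro image_cong) simp_all
qed

lemma simp_rel_id: assumes "abstract_complex K" "\<And>v. v \<in> \<Union>K \<Longrightarrow> b v = v" shows "simp_rel b K = Id_on (carrier_of K)"
proof -
  have "simp_rel b K = simp_rel (\<lambda>v. v) K" using assms(2) by (rule simp_rel_cong)
  also have "\<dots> = Id_on (carrier_of K)" unfolding carrier_coords[OF assms(1)] simp_rel_def by auto
  finally show ?thesis .
qed

lemma polyhedral_simp_rel: assumes "abstract_complex K" shows "polyhedral (simp_rel b K)"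
proof -
  let ?g = "\<lambda>v. (v, b v)"
  have "simp_rel b K = (\<Union>\<sigma>\<in>K. convex hull (?g ` \<sigma>))"
  proof (intro equalityI subsetI)
    fix p assume "p \<in> simp_rel b K"
    then obtain c where c: "c \<in> bary_coords K" "p = (bary_point c, bary_sum b c)" unfolding simp_rel_def by (rule imageE)
    have "bary_sum ?g c \<in> convex hull (?g ` {v. c v \<noteq> 0})"
      by (rule bary_sum_in_convex[OF c(1) assms]) (auto intro: hull_inc)
    then show "p \<in> (\<Union>\<sigma>\<in>K. convex hull (?g ` \<sigma>))"
      using c by (auto simp: bary_sum_Pair bary_coords_def)
  next
    fix p assume "p \<in> (\<Union>\<sigma>\<in>K. convex hull (?g ` \<sigma>))"
    then obtain \<sigma> where s: "\<sigma> \<in> K" "p \<in> convex hull (?g ` \<sigma>)" by (rule UN_E)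
    have f: "finite \<sigma>" using assms s(1) by (rule abstract_complex_finite)
    obtain u where u: "\<And>x. x \<in> ?g ` \<sigma> \<Longrightarrow> 0 \<le> u x" "sum u (?g ` \<sigma>) = 1" "(\<Sum>x\<in>?g ` \<sigma>. u x *\<^sub>R x) = p"
      using s(2) unfolding convex_hull_finite[OF finite_imageI[OF f]] by blast
    define c where "c v = (if v \<in> \<sigma> then u (?g v) else 0)" for v
    have inj: "inj_on ?g \<sigma>" by (rule inj_onI) simp
    have "c \<in> bary_coords K"
    proof (rule bary_coordsI[OF assms s(1)])
      show "0 \<le> c v" for v using u(1) by (simp add: c_def)
      show "v \<notin> \<sigma> \<Longrightarrow> c v = 0" for v by (simp add: c_def)
      show "sum c \<sigma> = 1" using u(2) unfolding sum.reindex[OF inj] by (simp add: c_def o_def)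
    qed
    moreover have "bary_sum ?g c = p"
    proof -
      have "bary_sum ?g c = (\<Sum>v\<in>\<sigma>. c v *\<^sub>R ?g v)" using f by (intro bary_sum_sum) (auto simp: c_def)
      also have "\<dots> = p" unfolding u(3)[symmetric] sum.reindex[OF inj] by (simp add: c_def o_def)
      finally show ?thesis .
    qed
    ultimately show "p \<in> simp_rel b K" unfolding simp_rel_def bary_sum_Pair by (intro image_eqI[of _ _ c]) simp_all
  qed
  also have "polyhedral \<dots>" using abstract_complexD[OF assms] by (intro polyhedral_UN polyhedral_hull) auto
  finally show ?thesis .
qed

definition push_coord :: "('v \<Rightarrow> 'w) \<Rightarrow> 'v set \<Rightarrow> ('v \<Rightarrow> real) \<Rightarrow> 'w \<Rightarrow> real" where
  "push_coord b V c w = (if w \<in> b ` V then c (inv_into V b w) else 0)"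

lemma push_coord_vertex: "inj_on b V \<Longrightarrow> v \<in> V \<Longrightarrow> push_coord b V c (b v) = c v"
  by (simp add: push_coord_def)

lemma push_coord_support: assumes "inj_on b V" "{v. c v \<noteq> 0} \<subseteq> V"
  shows "{w. push_coord b V c w \<noteq> 0} = b ` {v. c v \<noteq> 0}"
proof (intro equalityI subsetI)
  fix w assume w: "w \<in> {w. push_coord b V c w \<noteq> 0}"
  then have "w \<in> b ` V" by (auto simp: push_coord_def split: if_splits)
  then obtain v where "w = b v" "v \<in> V" by (rule imageE)
  then show "w \<in> b ` {v. c v \<noteq> 0}" using w push_coord_vertex[OF assms(1)] by auto
next
  fix w assume "w \<in> b ` {v. c v \<noteq> 0}"
  then obtain v where "w = b v" "c v \<noteq> 0" by auto
  then show "w \<in> {w. push_coord b V c w \<noteq> 0}" using assms push_coord_vertex[OF assms(1), of v] by auto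
qed

lemma bary_sum_push_coord:
  assumes "inj_on b V" "{v. c v \<noteq> 0} \<subseteq> V"
  shows "bary_sum f (push_coord b V c) = bary_sum (\<lambda>v. f (b v)) c"
proof -
  have inj: "inj_on b {v. c v \<noteq> 0}" using assms by (rule inj_on_subset)
  show ?thesis unfolding bary_sum_def push_coord_support[OF assms] sum.reindex[OF inj] o_def
    using assms push_coord_vertex[OF assms(1)] by (intro sum.cong) auto
qed

lemma push_coord_bary_coords:
  assumes "inj_on b (\<Union>K)" "c \<in> bary_coords K"
  shows "push_coord b (\<Union>K) c \<in> bary_coords ((`) b ` K)"
proof -
  have s: "{v. c v \<noteq> 0} \<subseteq> \<Union>K" using assms(2) by (auto simp: bary_coords_def)
  have "bary_sum (\<lambda>_. 1::real) (push_coord b (\<Union>K) c) = 1"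
    using bary_sum_push_coord[OF assms(1) s, of "\<lambda>_. 1::real"] bary_coords_mass[OF assms(2)] by simp
  moreover have "0 \<le> push_coord b (\<Union>K) c w" for w using assms(2) by (simp add: push_coord_def bary_coords_def)
  ultimately show ?thesis using assms(2) by (simp add: bary_coords_def bary_sum_one push_coord_support[OF assms(1) s])
qed

lemma pull_bary_coords:
  assumes "inj_on b (\<Union>K)" "d \<in> bary_coords ((`) b ` K)"
  shows "\<exists>c\<in>bary_coords K. d = push_coord b (\<Union>K) c"
proof -
  let ?V = "\<Union>K"
  define c where "c v = (if v \<in> ?V then d (b v) else 0)" for v
  obtain \<sigma> where s: "\<sigma> \<in> K" "{w. d w \<noteq> 0} = b ` \<sigma>" using assms(2) by (auto simp: bary_coords_def)
  have dc: "d = push_coord b ?V c"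
  proof
    fix w show "d w = push_coord b ?V c w"
    proof (cases "w \<in> b ` ?V")
      case True
      then obtain v where v: "w = b v" "v \<in> ?V" by (rule imageE)
      have "push_coord b ?V c w = c v" unfolding v(1) using assms(1) v(2) by (rule push_coord_vertex)
      then show ?thesis using v by (simp add: c_def)
    next
      case False
      then have "w \<notin> b ` \<sigma>" using s(1) by blast
      then have "d w = 0" using s(2) by blast
      then show ?thesis unfolding push_coord_def using False by (simp only: if_False)
    qed
  qed
  have sup: "{v. c v \<noteq> 0} \<subseteq> ?V" unfolding c_def by (auto split: if_splits)
  have "b ` {v. c v \<noteq> 0} = b ` \<sigma>" using push_coord_support[OF assms(1) sup] dc s(2) by simp
  then have "{v. c v \<noteq> 0} = \<sigma>" using inj_on_image_eq_iff[OF assms(1) sup] s(1) by blast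
  then have "{v. c v \<noteq> 0} \<in> K" using s(1) by simp
  moreover have "0 \<le> c v" for v using assms(2) by (simp add: c_def bary_coords_def)
  moreover have "bary_sum (\<lambda>_. 1::real) c = 1"
    using bary_sum_push_coord[OF assms(1) sup, of "\<lambda>_. 1::real"] bary_coords_mass[OF assms(2)] dc by simp
  ultimately have "c \<in> bary_coords K" by (simp add: bary_coords_def bary_sum_one)
  then show ?thesis using dc by blast
qed

lemma abstract_image: assumes "abstract_complex K" shows "abstract_complex ((`) b ` K)"
proof (rule abstract_complexI)
  show "finite ((`) b ` K)" using abstract_complexD(1)[OF assms] by simp
  show "{} \<in> (`) b ` K" using abstract_complexD(2)[OF assms] by (simp add: image_iff)
  show "finite \<sigma>" if "\<sigma> \<in> (`) b ` K" for \<sigma> using that abstract_complexD(3)[OF assms] by auto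
  show "\<tau> \<in> (`) b ` K" if s: "\<sigma> \<in> (`) b ` K" "\<tau> \<subseteq> \<sigma>" for \<sigma> \<tau>
  proof -
    obtain \<rho> where r: "\<rho> \<in> K" "\<sigma> = b ` \<rho>" using s(1) by auto
    then obtain \<rho>' where "\<rho>' \<subseteq> \<rho>" "\<tau> = b ` \<rho>'" using s(2) by (metis subset_imageE)
    then show ?thesis using abstract_complexD(4)[OF assms r(1)] by auto
  qed
qed

text \<open>Uniqueness of coordinates enters twice: in \<open>K\<close> it makes the relation a
  function, in \<open>L\<close> it makes this function injective.\<close>

lemma pl_iso_simp_rel:
  assumes K: "realized K" and L: "realized L" and b: "inj_on b (\<Union>K)" and eq: "L = (`) b ` K"
  shows "pl_iso (simp_rel b K) (carrier_of K) (carrier_of L)"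
proof -
  have ac: "abstract_complex K" "abstract_complex L" using K L realized_abstract by auto
  have sup: "{v. c v \<noteq> 0} \<subseteq> \<Union>K" if "c \<in> bary_coords K" for c using that by (auto simp: bary_coords_def)
  have bp: "bary_sum b c = bary_point (push_coord b (\<Union>K) c)" if "c \<in> bary_coords K" for c
    using bary_sum_push_coord[OF b sup[OF that], of "\<lambda>v. v"] by simp
  have pm: "push_coord b (\<Union>K) c \<in> bary_coords L" if "c \<in> bary_coords K" for c
    unfolding eq using b that by (rule push_coord_bary_coords)
  have "Domain (simp_rel b K) = carrier_of K" unfolding simp_rel_def carrier_coords[OF ac(1)] by auto
  moreover have "Range (simp_rel b K) = carrier_of L"
  proof (intro equalityI subsetI)
    fix y assume "y \<in> Range (simp_rel b K)"
    then obtain c where "c \<in> bary_coords K" "y = bary_sum b c" unfolding simp_rel_def by auto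
    then show "y \<in> carrier_of L" unfolding carrier_coords[OF ac(2)] using pm bp by simp
  next
    fix y assume "y \<in> carrier_of L"
    then obtain d where d: "d \<in> bary_coords L" "y = bary_point d" unfolding carrier_coords[OF ac(2)] by blast
    obtain c where c: "c \<in> bary_coords K" "d = push_coord b (\<Union>K) c" using pull_bary_coords[OF b] d(1) eq by blast
    then have "(bary_point c, y) \<in> simp_rel b K" unfolding simp_rel_def using bp d by simp
    then show "y \<in> Range (simp_rel b K)" by (rule RangeI)
  qed
  moreover have "single_valued (simp_rel b K)"
  proof (rule single_valuedI)
    fix x y z assume "(x, y) \<in> simp_rel b K" "(x, z) \<in> simp_rel b K"
    then obtain c d where "c \<in> bary_coords K" "d \<in> bary_coords K" "x = bary_point c" "x = bary_point d" "y = bary_sum b c" "z = bary_sum b d"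
      unfolding simp_rel_def by auto
    then show "y = z" using realized_inj[OF K, of c d] by simp
  qed
  moreover have "single_valued ((simp_rel b K)\<inverse>)"
  proof (rule single_valuedI)
    fix x y z assume "(x, y) \<in> (simp_rel b K)\<inverse>" "(x, z) \<in> (simp_rel b K)\<inverse>"
    then obtain c d where cd: "c \<in> bary_coords K" "d \<in> bary_coords K" "y = bary_point c" "z = bary_point d" "x = bary_sum b c" "x = bary_sum b d"
      unfolding simp_rel_def by auto
    then have e: "push_coord b (\<Union>K) c = push_coord b (\<Union>K) d" using realized_inj[OF L pm pm] bp by simp
    have "c v = d v" for v
    proof (cases "v \<in> \<Union>K")
      case True
      show ?thesis using push_coord_vertex[OF b True, of c] push_coord_vertex[OF b True, of d] e by simp
    next
      case False
      then have "c v = 0" "d v = 0" using sup[OF cd(1)] sup[OF cd(2)] by blast+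
      then show ?thesis by simp
    qed
    then have "c = d" by (rule ext)
    then show "y = z" using cd by simp
  qed
  ultimately show ?thesis using polyhedral_simp_rel[OF ac(1)] by (simp add: pl_iso_def)
qed

section \<open>Cones\<close>

text \<open>For \<open>a\<close> outside \<open>Q\<close> this is the cone \<open>a * Q\<close>. If
  \<open>a\<close> is a vertex of \<open>Q\<close>, it is the cone with apex \<open>a\<close> over
  the antistar of \<open>a\<close>, that is the ball \<open>B\<^sub>a\<close>; it contains
  \<open>Q\<close> and has no further vertices. One formula serves both uses.\<close>

definition cone_complex :: "'v \<Rightarrow> 'v set set \<Rightarrow> 'v set set" where
  "cone_complex a Q = {\<tau>. \<tau> - {a} \<in> Q}"

text \<open>The apex is inserted separately so that the cone over the empty set is a point. The
  parameter \<open>t\<close> is the weight of the base point, so \<open>t = 0\<close> is the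
  apex.\<close>

definition cone_over :: "'v::real_normed_vector \<Rightarrow> 'v set \<Rightarrow> 'v set" where
  "cone_over a X = insert a {(1 - t) *\<^sub>R a + t *\<^sub>R x |t x. 0 \<le> t \<and> t \<le> 1 \<and> x \<in> X}"

text \<open>General position of the apex: a point of the cone determines its height and, away from
  the apex, its base point.\<close>

definition cone_pos :: "'v::real_normed_vector \<Rightarrow> 'v set \<Rightarrow> bool" where
  "cone_pos a X \<longleftrightarrow> (\<forall>x\<in>X. \<forall>y\<in>X. \<forall>s\<in>{0..1}. \<forall>t\<in>{0..1}.
     (1 - s) *\<^sub>R a + s *\<^sub>R x = (1 - t) *\<^sub>R a + t *\<^sub>R y \<longrightarrow> s = t \<and> (s = 0 \<or> x = y))"

lemma cone_posD:
  assumes "cone_pos a X" "x \<in> X" "y \<in> X" "0 \<le> s" "s \<le> 1" "0 \<le> t" "t \<le> 1"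
    "(1 - s) *\<^sub>R a + s *\<^sub>R x = (1 - t) *\<^sub>R a + t *\<^sub>R y"
  shows "s = t \<and> (s = 0 \<or> x = y)"
proof -
  have st: "s \<in> {0..1}" "t \<in> {0..1}" using assms(4-7) by simp_all
  show ?thesis by (rule assms(1)[unfolded cone_pos_def, rule_format, OF assms(2,3) st assms(8)])
qed

text \<open>The graph of a coned map is the cone over its graph in the product space, so the facts
  on \<open>cone_over\<close> apply to relations as well.\<close>

definition cone_rel :: "'v::real_normed_vector \<Rightarrow> 'w::real_normed_vector \<Rightarrow> ('v \<times> 'w) set \<Rightarrow> ('v \<times> 'w) set" where
  "cone_rel a b R = cone_over (a, b) R"

lemma cone_rel_iff: "(p, q) \<in> cone_rel a b R \<longleftrightarrow> p = a \<and> q = b \<or> (\<exists>t x y. 0 \<le> t \<and> t \<le> 1 \<and> (x, y) \<in> R \<and>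
   p = (1 - t) *\<^sub>R a + t *\<^sub>R x \<and> q = (1 - t) *\<^sub>R b + t *\<^sub>R y)"
  unfolding cone_rel_def cone_over_def by force

lemma cone_over_mono: "X \<subseteq> Y \<Longrightarrow> cone_over a X \<subseteq> cone_over a Y"
  unfolding cone_over_def by blast

lemma cone_rel_mono: "R \<subseteq> S \<Longrightarrow> cone_rel a b R \<subseteq> cone_rel a b S"
  unfolding cone_rel_def by (rule cone_over_mono)

 

lemma cone_over_superset: "X \<subseteq> cone_over a X"
proof
  fix p assume "p \<in> X"
  then show "p \<in> cone_over a X" unfolding cone_over_def by (intro insertI2 CollectI exI[of _ 1] exI[of _ p]) simp
qed

lemma cone_rel_superset: "R \<subseteq> cone_rel a b R"
  unfolding cone_rel_def by (rule cone_over_superset)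

lemma Domain_cone_rel: "Domain (cone_rel a b R) = cone_over a (Domain R)"
proof (intro equalityI subsetI)
  fix x assume "x \<in> Domain (cone_rel a b R)"
  then show "x \<in> cone_over a (Domain R)" by (force simp: cone_rel_iff cone_over_def)
next
  fix x assume "x \<in> cone_over a (Domain R)"
  then consider "x = a" | t u v where "x = (1 - t) *\<^sub>R a + t *\<^sub>R u" "0 \<le> t" "t \<le> 1" "(u, v) \<in> R"
    by (auto simp: cone_over_def)
  then show "x \<in> Domain (cone_rel a b R)"
  proof cases
    case 1 then show ?thesis by (auto simp: cone_rel_iff)
  next
    case 2
    then have "(x, (1 - t) *\<^sub>R b + t *\<^sub>R v) \<in> cone_rel a b R" by (auto simp: cone_rel_iff)
    then show ?thesis by (rule DomainI)
  qed
qed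

lemma cone_rel_converse: "(cone_rel a b R)\<inverse> = cone_rel b a (R\<inverse>)"
proof -
  have *: "(q, p) \<in> cone_rel b a (R\<inverse>)" if "(p, q) \<in> cone_rel a b R" for p q a b and R :: "('c::real_normed_vector \<times> 'd::real_normed_vector) set"
    using that unfolding cone_rel_iff by blast
  show ?thesis using *[of _ _ a b R] *[of _ _ b a "R\<inverse>"] by auto
qed

lemma Range_cone_rel: "Range (cone_rel a b R) = cone_over b (Range R)"
  using Domain_cone_rel[of b a "R\<inverse>"] by (simp flip: cone_rel_converse)

lemma cone_rel_Id_on: "cone_rel a a (Id_on X) = Id_on (cone_over a X)"
  by (auto simp: cone_rel_def cone_over_def)

lemma polyhedral_cone_over: assumes "polyhedral X" shows "polyhedral (cone_over a X)"
proof -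
  obtain \<F> where F: "finite \<F>" "\<forall>F\<in>\<F>. finite F" "X = (\<Union>F\<in>\<F>. convex hull F)"
    using assms unfolding polyhedral_def by blast
  have *: "convex hull (insert a F) = insert a {(1 - t) *\<^sub>R a + t *\<^sub>R x |t x. 0 \<le> t \<and> t \<le> 1 \<and> x \<in> convex hull F}" for F
  proof (cases "F = {}")
    case False
    show ?thesis
    proof (intro equalityI subsetI)
      fix x assume "x \<in> convex hull (insert a F)"
      then obtain u v b where "0 \<le> u" "0 \<le> v" "u + v = 1" "b \<in> convex hull F" "x = u *\<^sub>R a + v *\<^sub>R b"
        unfolding convex_hull_insert[OF False] by blast
      then show "x \<in> insert a {(1 - t) *\<^sub>R a + t *\<^sub>R x |t x. 0 \<le> t \<and> t \<le> 1 \<and> x \<in> convex hull F}"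
        by (intro insertI2 CollectI exI[of _ v] exI[of _ b]) (auto simp: eq_diff_eq)
    next
      fix x assume x: "x \<in> insert a {(1 - t) *\<^sub>R a + t *\<^sub>R x |t x. 0 \<le> t \<and> t \<le> 1 \<and> x \<in> convex hull F}"
      have "convex hull F \<subseteq> convex hull (insert a F)" by (rule hull_mono) blast
      moreover have "a \<in> convex hull (insert a F)" by (rule hull_inc) simp
      ultimately show "x \<in> convex hull (insert a F)" using x by (auto intro!: convexD)
    qed
  qed simp
  have "cone_over a X = convex hull {a} \<union> (\<Union>F\<in>\<F>. convex hull (insert a F))"
    unfolding * cone_over_def F(3) by auto
  also have "polyhedral \<dots>" using F by (intro polyhedral_Un polyhedral_UN polyhedral_hull) auto
  finally show ?thesis .
qed

lemma single_valued_cone_rel: assumes sv: "single_valued R" and a: "cone_pos a (Domain R)"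
  shows "single_valued (cone_rel a b R)"
proof (cases "R = {}")
  case True
  then show ?thesis by (auto simp: single_valued_def cone_rel_iff)
next
  case False
  \<comment> \<open>Any pair in \<open>R\<close> allows the apex to be written with parameter 0,
    which brings all points of the cone into one form.\<close>
  then obtain x0 y0 where xy0: "(x0, y0) \<in> R" by fastforce
  have form: "\<exists>t x y. 0 \<le> t \<and> t \<le> 1 \<and> (x, y) \<in> R \<and>
   p = (1 - t) *\<^sub>R a + t *\<^sub>R x \<and> q = (1 - t) *\<^sub>R b + t *\<^sub>R y" if "(p, q) \<in> cone_rel a b R" for p q
    using that xy0 unfolding cone_rel_iff
    by (elim disjE) (rule exI[of _ 0], rule exI[of _ x0], rule exI[of _ y0], simp)
  show ?thesis
  proof (rule single_valuedI)
    fix p q q' assume "(p, q) \<in> cone_rel a b R" "(p, q') \<in> cone_rel a b R"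
    then obtain t x y t' x' y' where 1: "0 \<le> t" "t \<le> 1" "(x, y) \<in> R"
     "p = (1 - t) *\<^sub>R a + t *\<^sub>R x" "q = (1 - t) *\<^sub>R b + t *\<^sub>R y"
     and 2: "0 \<le> t'" "t' \<le> 1" "(x', y') \<in> R"
     "p = (1 - t') *\<^sub>R a + t' *\<^sub>R x'" "q' = (1 - t') *\<^sub>R b + t' *\<^sub>R y'" by (blast dest!: form)
    have "x \<in> Domain R" "x' \<in> Domain R" using 1(3) 2(3) by auto
    moreover have "(1 - t) *\<^sub>R a + t *\<^sub>R x = (1 - t') *\<^sub>R a + t' *\<^sub>R x'" using 1(4) 2(4) by (rule subst)
    ultimately have e: "t = t' \<and> (t = 0 \<or> x = x')" using 1(1,2) 2(1,2) by (intro cone_posD[OF a])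
    show "q = q'"
    proof (cases "t = 0")
      case True
      then show ?thesis using 1 2 e by simp
    next
      case False
      then have "x = x'" using e by blast
      then have "y = y'" using sv 1(3) 2(3) by (auto dest: single_valuedD)
      then show ?thesis using 1 2 e by simp
    qed
  qed
qed

lemma pl_iso_cone_rel: assumes R: "pl_iso R X Y" and a: "cone_pos a X" and b: "cone_pos b Y"
  shows "pl_iso (cone_rel a b R) (cone_over a X) (cone_over b Y)"
proof -
  have D: "Domain R = X" "Range R = Y" and sv: "single_valued R" "single_valued (R\<inverse>)" and c: "polyhedral R"
    using R by (simp_all add: pl_iso_def)
  have "single_valued (cone_rel a b R)" using sv a D by (simp add: single_valued_cone_rel)
  moreover have "single_valued ((cone_rel a b R)\<inverse>)" unfolding cone_rel_converse
    using sv b D by (simp add: single_valued_cone_rel)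
  moreover have "polyhedral (cone_rel a b R)" unfolding cone_rel_def using c by (rule polyhedral_cone_over)
  ultimately show ?thesis using D by (simp add: pl_iso_def Domain_cone_rel Range_cone_rel)
qed

lemma abstract_cone_complex: assumes "abstract_complex Q" shows "abstract_complex (cone_complex a Q)"
proof (rule abstract_complexI)
  have "cone_complex a Q \<subseteq> Q \<union> insert a ` Q"
  proof
    fix \<tau> assume t: "\<tau> \<in> cone_complex a Q"
    show "\<tau> \<in> Q \<union> insert a ` Q"
    proof (cases "a \<in> \<tau>")
      case True
      then have "\<tau> = insert a (\<tau> - {a})" by blast
      then show ?thesis using t unfolding cone_complex_def by blast
    qed (use t in \<open>simp add: cone_complex_def\<close>)
  qed
  then show "finite (cone_complex a Q)" by (rule finite_subset) (simp add: abstract_complexD(1)[OF assms])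
  show "{} \<in> cone_complex a Q" using abstract_complexD(2)[OF assms] by (simp add: cone_complex_def)
  show "finite \<sigma>" if "\<sigma> \<in> cone_complex a Q" for \<sigma>
    using abstract_complexD(3)[OF assms, of "\<sigma> - {a}"] that by (simp add: cone_complex_def)
  show "\<tau> \<in> cone_complex a Q" if "\<sigma> \<in> cone_complex a Q" "\<tau> \<subseteq> \<sigma>" for \<sigma> \<tau>
    using abstract_complexD(4)[OF assms, of "\<sigma> - {a}" "\<tau> - {a}"] that by (auto simp: cone_complex_def)
qed

lemma cone_complex_mono: "A \<subseteq> B \<Longrightarrow> cone_complex a A \<subseteq> cone_complex a B" by (auto simp: cone_complex_def)

lemma cone_complex_superset: "abstract_complex Q \<Longrightarrow> Q \<subseteq> cone_complex a Q"
  by (auto simp: cone_complex_def intro: abstract_complex_subset)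

lemma cone_complex_commute: "cone_complex a (cone_complex b Q) = cone_complex b (cone_complex a Q)"
proof -
  have "\<tau> - {a} - {b} = \<tau> - {b} - {a}" for \<tau> by blast
  then show ?thesis by (simp add: cone_complex_def)
qed

lemma cone_complex_vertices: "abstract_complex Q \<Longrightarrow> \<Union>(cone_complex a Q) = insert a (\<Union>Q)"
proof -
  assume ac: "abstract_complex Q"
  have "{a} \<in> cone_complex a Q" using abstract_complexD(2)[OF ac] by (simp add: cone_complex_def)
  moreover have "Q \<subseteq> cone_complex a Q" using ac by (rule cone_complex_superset)
  moreover have "\<tau> \<subseteq> insert a (\<Union>Q)" if "\<tau> \<in> cone_complex a Q" for \<tau> using that by (auto simp: cone_complex_def)
  ultimately show ?thesis by blast
qed

text \<open>The parameter \<open>t\<close> is the weight lying off \<open>a\<close>; if it is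
  positive, the coordinates off \<open>a\<close> are divided by it.\<close>

lemma bary_coords_cone_complex:
  assumes ac: "abstract_complex Q" and a: "a \<notin> \<Union>Q"
  shows "bary_coords (cone_complex a Q) = insert (vertex_coord a)
    {(\<lambda>v. (1 - t) * vertex_coord a v + t * d v) |t d. 0 \<le> t \<and> t \<le> 1 \<and> d \<in> bary_coords Q}"
proof (intro equalityI subsetI)
  fix c assume c: "c \<in> bary_coords (cone_complex a Q)"
  have ac': "abstract_complex (cone_complex a Q)" using ac by (rule abstract_cone_complex)
  have f: "finite {v. c v \<noteq> 0}" using ac' c by (rule bary_coords_finite)
  have nn: "0 \<le> c v" for v using c by (simp add: bary_coords_def)
  have S: "{v. c v \<noteq> 0} - {a} \<in> Q" using c by (simp add: bary_coords_def cone_complex_def)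
  have "bary_sum (\<lambda>_. 1::real) c = (\<Sum>v\<in>insert a {v. c v \<noteq> 0}. c v)"
    using f bary_sum_sum[of "insert a {v. c v \<noteq> 0}" c "\<lambda>_. 1::real"] by auto
  also have "\<dots> = c a + (\<Sum>v\<in>{v. c v \<noteq> 0} - {a}. c v)" using f
    by (subst sum.remove[of _ a]) (auto simp: insert_Diff_if intro: sum.cong)
  finally have m: "(\<Sum>v\<in>{v. c v \<noteq> 0} - {a}. c v) = 1 - c a" using bary_coords_mass[OF c] by simp
  define t where "t = 1 - c a"
  have t: "0 \<le> t" "t \<le> 1" using m sum_nonneg[of "{v. c v \<noteq> 0} - {a}" c] nn by (auto simp: t_def)
  show "c \<in> insert (vertex_coord a) {(\<lambda>v. (1 - t) * vertex_coord a v + t * d v) |t d. 0 \<le> t \<and> t \<le> 1 \<and> d \<in> bary_coords Q}"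
  proof (cases "t = 0")
    case True
    then have "(\<Sum>v\<in>{v. c v \<noteq> 0} - {a}. c v) = 0" using m by (simp add: t_def)
    then have "\<forall>v\<in>{v. c v \<noteq> 0} - {a}. c v = 0"
      using sum_nonneg_eq_0_iff[of "{v. c v \<noteq> 0} - {a}" c] f nn by simp
    then have "c v = vertex_coord a v" for v using True by (auto simp: vertex_coord_def t_def)
    then show ?thesis by (auto)
  next
    case False
    then have tp: "t > 0" using t by simp
    define d where "d v = (if v = a then 0 else c v / t)" for v
    have "d \<in> bary_coords Q"
    proof (rule bary_coordsI[OF ac S])
      show "0 \<le> d v" for v using nn tp by (simp add: d_def)
      show "d v = 0" if "v \<notin> {v. c v \<noteq> 0} - {a}" for v using that by (auto simp: d_def)
      have "sum d ({v. c v \<noteq> 0} - {a}) = (\<Sum>v\<in>{v. c v \<noteq> 0} - {a}. c v / t)"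
        by (intro sum.cong) (auto simp: d_def)
      also have "\<dots> = 1" using m tp by (simp add: t_def flip: sum_divide_distrib)
      finally show "sum d ({v. c v \<noteq> 0} - {a}) = 1" .
    qed
    moreover have "c = (\<lambda>v. (1 - t) * vertex_coord a v + t * d v)"
    proof
      show "c v = (1 - t) * vertex_coord a v + t * d v" for v
        using tp by (cases "v = a") (auto simp: d_def vertex_coord_def t_def)
    qed
    ultimately show ?thesis using t by blast
  qed
next
  fix c assume "c \<in> insert (vertex_coord a) {(\<lambda>v. (1 - t) * vertex_coord a v + t * d v) |t d. 0 \<le> t \<and> t \<le> 1 \<and> d \<in> bary_coords Q}"
  then consider "c = vertex_coord a" | t d where "c = (\<lambda>v. (1 - t) * vertex_coord a v + t * d v)" "0 \<le> t" "t \<le> 1" "d \<in> bary_coords Q"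
    by blast
  then show "c \<in> bary_coords (cone_complex a Q)"
  proof cases
    case 1
    have "a \<in> \<Union>(cone_complex a Q)" using cone_complex_vertices[OF ac] by simp
    then show ?thesis unfolding 1 by (rule vertex_coord_bary_coords[OF abstract_cone_complex[OF ac]])
  next
    case 2
    let ?s = "insert a {v. d v \<noteq> 0}"
    have dQ: "{v. d v \<noteq> 0} \<in> Q" using 2(4) by (simp add: bary_coords_def)
    then have na: "a \<notin> {v. d v \<noteq> 0}" using a by blast
    then have "?s \<in> cone_complex a Q" using dQ by (simp add: cone_complex_def)
    moreover have "d \<in> bary_coords (cone_complex a Q)" using 2(4) bary_coords_mono[OF cone_complex_superset[OF ac]] by blast
    moreover have "vertex_coord a \<in> bary_coords (cone_complex a Q)"
      by (rule vertex_coord_bary_coords[OF abstract_cone_complex[OF ac]]) (simp add: cone_complex_vertices[OF ac] del: Union_iff)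
    moreover have "{v. vertex_coord a v \<noteq> 0} \<subseteq> ?s" by (auto simp: vertex_coord_def)
    ultimately show ?thesis unfolding 2(1) using 2(2,3) abstract_cone_complex[OF ac]
      by (intro bary_coords_convex[of _ ?s]) auto
  qed
qed

lemma vertex_coord_finite: "finite {v. vertex_coord a v \<noteq> 0}" by (simp add: vertex_coord_def)

lemma bary_sum_cone_over:
  assumes "abstract_complex Q" "d \<in> bary_coords Q"
  shows "bary_sum f (\<lambda>v. (1 - t) * vertex_coord a v + t * d v) = (1 - t) *\<^sub>R f a + t *\<^sub>R bary_sum f d"
  using bary_sum_linear[OF vertex_coord_finite bary_coords_finite[OF assms], of f "1 - t" a t] by (simp add: bary_sum_vertex_coord)

lemma image_bary_coords_cone_complex:
  assumes ac: "abstract_complex Q" and a: "a \<notin> \<Union>Q"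
  shows "bary_sum f ` bary_coords (cone_complex a Q) = cone_over (f a) (bary_sum f ` bary_coords Q)"
proof -
  have "bary_sum f ` bary_coords (cone_complex a Q) = insert (f a) {(1 - t) *\<^sub>R f a + t *\<^sub>R bary_sum f d |t d. 0 \<le> t \<and> t \<le> 1 \<and> d \<in> bary_coords Q}"
    unfolding bary_coords_cone_complex[OF ac a] image_insert bary_sum_vertex_coord
  proof (intro arg_cong2[where f=insert] refl equalityI subsetI)
    fix x assume "x \<in> bary_sum f ` {\<lambda>v. (1 - t) * vertex_coord a v + t * d v |t d. 0 \<le> t \<and> t \<le> 1 \<and> d \<in> bary_coords Q}"
    then obtain t d where "x = bary_sum f (\<lambda>v. (1 - t) * vertex_coord a v + t * d v)" "0 \<le> t" "t \<le> 1" "d \<in> bary_coords Q"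
      by blast
    then show "x \<in> {(1 - t) *\<^sub>R f a + t *\<^sub>R bary_sum f d |t d. 0 \<le> t \<and> t \<le> 1 \<and> d \<in> bary_coords Q}"
      unfolding bary_sum_cone_over[OF ac \<open>d \<in> bary_coords Q\<close>] by blast
  next
    fix x assume "x \<in> {(1 - t) *\<^sub>R f a + t *\<^sub>R bary_sum f d |t d. 0 \<le> t \<and> t \<le> 1 \<and> d \<in> bary_coords Q}"
    then obtain t d where td: "x = (1 - t) *\<^sub>R f a + t *\<^sub>R bary_sum f d" "0 \<le> t" "t \<le> 1" "d \<in> bary_coords Q"
      by blast
    have "x = bary_sum f (\<lambda>v. (1 - t) * vertex_coord a v + t * d v)" unfolding td(1) by (rule bary_sum_cone_over[OF ac td(4), symmetric])
    then show "x \<in> bary_sum f ` {\<lambda>v. (1 - t) * vertex_coord a v + t * d v |t d. 0 \<le> t \<and> t \<le> 1 \<and> d \<in> bary_coords Q}"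
      using td(2-4) by blast
  qed
  also have "\<dots> = cone_over (f a) (bary_sum f ` bary_coords Q)" unfolding cone_over_def by blast
  finally show ?thesis .
qed

lemma carrier_cone_complex:
  assumes "abstract_complex Q" "a \<notin> \<Union>Q"
  shows "carrier_of (cone_complex a Q) = cone_over a (carrier_of Q)"
  using image_bary_coords_cone_complex[OF assms] carrier_coords[OF abstract_cone_complex[OF assms(1)], of a]
    carrier_coords[OF assms(1)] by metis

lemma simp_rel_cone_complex:
  assumes "abstract_complex Q" "a \<notin> \<Union>Q"
  shows "simp_rel b (cone_complex a Q) = cone_rel a (b a) (simp_rel b Q)"
  unfolding simp_rel_def cone_rel_def bary_sum_Pair[symmetric]
  using image_bary_coords_cone_complex[OF assms, of "\<lambda>v. (v, b v)"] .

text \<open>The coordinate at \<open>a\<close> gives the height of a point, the coordinates at the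
  other vertices give its base point.\<close>

lemma realized_cone_pos:
  assumes g: "realized (cone_complex a Q)" and ac: "abstract_complex Q" and a: "a \<notin> \<Union>Q"
  shows "cone_pos a (carrier_of Q)"
  unfolding cone_pos_def
proof (intro ballI impI)
  fix x y and s t :: real assume xy: "x \<in> carrier_of Q" "y \<in> carrier_of Q" and st: "s \<in> {0..1}" "t \<in> {0..1}"
    and e: "(1 - s) *\<^sub>R a + s *\<^sub>R x = (1 - t) *\<^sub>R a + t *\<^sub>R y"
  obtain c where c: "x = bary_point c" "c \<in> bary_coords Q" using xy(1) unfolding carrier_coords[OF ac] by blast
  obtain d where d: "y = bary_point d" "d \<in> bary_coords Q" using xy(2) unfolding carrier_coords[OF ac] by blast
  let ?c = "\<lambda>v. (1 - s) * vertex_coord a v + s * c v" and ?d = "\<lambda>v. (1 - t) * vertex_coord a v + t * d v"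
  have st01: "0 \<le> s" "s \<le> 1" "0 \<le> t" "t \<le> 1" using st by simp_all
  have "?c \<in> bary_coords (cone_complex a Q)"
    unfolding bary_coords_cone_complex[OF ac a] using c(2) st01(1,2) by blast
  moreover have "?d \<in> bary_coords (cone_complex a Q)"
    unfolding bary_coords_cone_complex[OF ac a] using d(2) st01(3,4) by blast
  moreover have "bary_point ?c = bary_point ?d"
    using e c d bary_sum_cone_over[OF ac c(2), of "\<lambda>v. v"] bary_sum_cone_over[OF ac d(2), of "\<lambda>v. v"] by simp
  ultimately have eq: "?c = ?d" by (rule realized_inj[OF g])
  have "{v. c v \<noteq> 0} \<in> Q" "{v. d v \<noteq> 0} \<in> Q" using c d by (simp_all add: bary_coords_def)
  then have ca: "c a = 0" "d a = 0" using a by blast+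
  then have st': "s = t" using fun_cong[OF eq, of a] by (simp add: vertex_coord_def)
  have "c v = d v" if "s \<noteq> 0" for v
    using fun_cong[OF eq, of v] st' that ca by (cases "v = a") (auto simp: vertex_coord_def)
  then have "s \<noteq> 0 \<Longrightarrow> c = d" by (intro ext) blast
  then show "s = t \<and> (s = 0 \<or> x = y)" using st' c(1) d(1) by blast
qed

section \<open>Links and antistars\<close>

definition link :: "'v set set \<Rightarrow> 'v \<Rightarrow> 'v set set" where
  "link K u = {\<sigma>. u \<notin> \<sigma> \<and> insert u \<sigma> \<in> K}"

definition antistar :: "'v set set \<Rightarrow> 'v \<Rightarrow> 'v set set" where
  "antistar K u = {\<sigma> \<in> K. u \<notin> \<sigma>}"

lemma antistar_subset: "antistar K u \<subseteq> K" by (auto simp: antistar_def)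

lemma link_subset_antistar: assumes "abstract_complex K" shows "link K u \<subseteq> antistar K u"
proof
  fix \<sigma> assume s: "\<sigma> \<in> link K u"
  then have "\<sigma> \<in> K" using abstract_complexD(4)[OF assms, of "insert u \<sigma>" \<sigma>] by (simp add: link_def subset_insertI)
  then show "\<sigma> \<in> antistar K u" using s by (simp add: link_def antistar_def)
qed

lemma link_subset: "abstract_complex K \<Longrightarrow> link K u \<subseteq> K"
  by (rule subset_trans[OF link_subset_antistar antistar_subset])

lemma abstract_antistar: assumes "abstract_complex K" shows "abstract_complex (antistar K u)"
proof (rule abstract_complexI)
  show "finite (antistar K u)" by (rule finite_subset[OF antistar_subset abstract_complexD(1)[OF assms]])
  show "{} \<in> antistar K u" using abstract_complexD(2)[OF assms] by (simp add: antistar_def)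
  show "finite \<sigma>" if "\<sigma> \<in> antistar K u" for \<sigma> using that abstract_complexD(3)[OF assms] by (simp add: antistar_def)
  show "\<tau> \<in> antistar K u" if "\<sigma> \<in> antistar K u" "\<tau> \<subseteq> \<sigma>" for \<sigma> \<tau>
    using that abstract_complexD(4)[OF assms, of \<sigma> \<tau>] by (auto simp: antistar_def)
qed

lemma abstract_link: assumes ac: "abstract_complex K" and u: "u \<in> \<Union>K" shows "abstract_complex (link K u)"
proof (rule abstract_complexI)
  show "finite (link K u)" by (rule finite_subset[OF link_subset[OF ac] abstract_complexD(1)[OF ac]])
  show "{} \<in> link K u" using iffD1[OF abstract_complex_vertex[OF ac] u] by (simp add: link_def)
  show "finite \<sigma>" if "\<sigma> \<in> link K u" for \<sigma>
    using abstract_complexD(3)[OF ac, of "insert u \<sigma>"] that by (simp add: link_def)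
  show "\<tau> \<in> link K u" if "\<sigma> \<in> link K u" "\<tau> \<subseteq> \<sigma>" for \<sigma> \<tau>
    using that abstract_complexD(4)[OF ac, of "insert u \<sigma>" "insert u \<tau>"] by (auto simp: link_def)
qed

lemma realized_antistar: "realized K \<Longrightarrow> realized (antistar K u)"
  by (rule realized_subcomplex[OF _ antistar_subset abstract_antistar[OF realized_abstract]])

lemma realized_link: "realized K \<Longrightarrow> u \<in> \<Union>K \<Longrightarrow> realized (link K u)"
  by (rule realized_subcomplex[OF _ link_subset[OF realized_abstract] abstract_link[OF realized_abstract]])

section \<open>Renaming a vertex\<close>

lemma rename_iff:
  assumes "a \<noteq> a'" "a' \<notin> \<Union>K"
  shows "\<tau> \<in> (`) (id(a := a')) ` K \<longleftrightarrow> a \<notin> \<tau> \<and> (if a' \<in> \<tau> then insert a (\<tau> - {a'}) else \<tau>) \<in> K"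
proof
  let ?b = "id(a := a')"
  assume "\<tau> \<in> (`) ?b ` K"
  then obtain \<sigma> where s: "\<sigma> \<in> K" "\<tau> = ?b ` \<sigma>" by (rule imageE)
  have na: "a' \<notin> \<sigma>" using s(1) assms(2) by blast
  show "a \<notin> \<tau> \<and> (if a' \<in> \<tau> then insert a (\<tau> - {a'}) else \<tau>) \<in> K"
  proof (cases "a \<in> \<sigma>")
    case True
    have "\<tau> = insert a' (\<sigma> - {a})" unfolding s(2) using True by (auto simp: image_iff)
    moreover have "insert a (\<sigma> - {a}) = \<sigma>" using True by blast
    ultimately show ?thesis using s(1) na assms(1) by (auto simp: insert_Diff_if)
  next
    case False
    have "\<tau> = \<sigma>" unfolding s(2) using False by (auto simp: image_iff)
    then show ?thesis using s(1) na False by simp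
  qed
next
  let ?b = "id(a := a')"
  assume a: "a \<notin> \<tau> \<and> (if a' \<in> \<tau> then insert a (\<tau> - {a'}) else \<tau>) \<in> K"
  show "\<tau> \<in> (`) ?b ` K"
  proof (cases "a' \<in> \<tau>")
    case True
    have "?b ` (insert a (\<tau> - {a'})) = \<tau>" using a True by (auto simp: image_iff)
    then show ?thesis using a True by (metis imageI)
  next
    case False
    have "?b ` \<tau> = \<tau>" using a by (auto simp: image_iff)
    then show ?thesis using a False by (metis imageI)
  qed
qed

lemma rename_inj: "a' \<notin> V \<Longrightarrow> inj_on (id(a := a')) V"
  by (auto simp: inj_on_def)

lemma pl_iso_rename:
  assumes "realized K" "realized L" "a \<noteq> a'" "a' \<notin> \<Union>K"
    "\<And>\<tau>. \<tau> \<in> L \<longleftrightarrow> a \<notin> \<tau> \<and> (if a' \<in> \<tau> then insert a (\<tau> - {a'}) else \<tau>) \<in> K"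
  shows "pl_iso (simp_rel (id(a := a')) K) (carrier_of K) (carrier_of L)"
proof (rule pl_iso_simp_rel[OF assms(1,2) rename_inj[OF assms(4)]])
  show "L = (`) (id(a := a')) ` K" using assms(5) rename_iff[OF assms(3,4)] by blast
qed

text \<open>The second claim records that the base is fixed pointwise, so that the renaming can be
  glued to or composed with maps that are the identity there.\<close>

lemma pl_iso_rename_apex:
  assumes Q: "abstract_complex Q" "a \<notin> \<Union>Q" "a' \<notin> \<Union>Q" "a \<noteq> a'" and g: "realized (cone_complex a Q)" "realized (cone_complex a' Q)"
  shows "pl_iso (simp_rel (id(a := a')) (cone_complex a Q)) (carrier_of (cone_complex a Q)) (carrier_of (cone_complex a' Q))"
    "Id_on (carrier_of Q) \<subseteq> simp_rel (id(a := a')) (cone_complex a Q)"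
proof -
  have iff: "\<tau> \<in> cone_complex a' Q \<longleftrightarrow> a \<notin> \<tau> \<and> (if a' \<in> \<tau> then insert a (\<tau> - {a'}) else \<tau>) \<in> cone_complex a Q" for \<tau>
  proof (cases "a \<in> \<tau>")
    case True
    then have "\<tau> \<notin> cone_complex a' Q" using Q(2,4) by (auto simp: cone_complex_def)
    then show ?thesis using True by simp
  next
    case False
    then have "insert a (\<tau> - {a'}) - {a} = \<tau> - {a'}" "\<tau> - {a} = \<tau>" by auto
    moreover have "a' \<notin> \<tau> \<Longrightarrow> \<tau> - {a'} = \<tau>" by simp
    ultimately show ?thesis using False by (simp add: cone_complex_def)
  qed
  have na: "a' \<notin> \<Union>(cone_complex a Q)" unfolding cone_complex_vertices[OF Q(1)] using Q(3,4) by blast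
  show "pl_iso (simp_rel (id(a := a')) (cone_complex a Q)) (carrier_of (cone_complex a Q)) (carrier_of (cone_complex a' Q))"
    by (rule pl_iso_rename[OF g Q(4) na iff])
  have "Id_on (carrier_of Q) = simp_rel (id(a := a')) Q"
    by (rule simp_rel_id[OF Q(1), symmetric]) (use Q(2) in auto)
  then show "Id_on (carrier_of Q) \<subseteq> simp_rel (id(a := a')) (cone_complex a Q)"
    using simp_rel_mono[OF cone_complex_superset[OF Q(1)]] by metis
qed

section \<open>Exchanging the apex of a cone\<close>

lemma Id_on_mono: "A \<subseteq> B \<Longrightarrow> Id_on A \<subseteq> Id_on B" by auto

text \<open>By \<open>h\<close> the cone \<open>w * B\<close> is \<open>{w, y} * N\<close> with the edge \<open>wy\<close> in place. Its subdivision at the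
  midpoint \<open>m\<close> is mapped piecewise: \<open>{w, m} * N\<close> goes to \<open>{w, x} * N\<close> by \<open>m \<mapsto> x\<close>, and \<open>{m, y} * N\<close> goes to
  \<open>x * B\<close> by coning the inverse of \<open>h\<close>.\<close>

lemma cone_exchange:
  fixes B N :: "'v::real_normed_vector set set"
  assumes g: "realized (cone_complex y (cone_complex x (cone_complex w B)))" and B: "abstract_complex B" and N: "abstract_complex N" "N \<subseteq> B"
    and neq: "x \<noteq> w" "x \<noteq> y" "w \<noteq> y" and nB: "x \<notin> \<Union>B" "w \<notin> \<Union>B" "y \<notin> \<Union>B"
    and h: "pl_iso h (carrier_of B) (carrier_of (cone_complex y N))" "Id_on (carrier_of N) \<subseteq> h"
  shows "\<exists>R. pl_iso R (carrier_of (cone_complex w B)) (carrier_of (cone_complex x B) \<union> carrier_of (cone_complex x (cone_complex w N))) \<and>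
    Id_on (carrier_of B) \<subseteq> R \<and> Id_on (carrier_of (cone_complex w N)) \<subseteq> R"
proof -
  have nN: "x \<notin> \<Union>N" "w \<notin> \<Union>N" "y \<notin> \<Union>N" using nB N(2) by blast+
  let ?X = "cone_complex y (cone_complex x (cone_complex w B))"
  note ac = abstract_cone_complex[OF B] abstract_cone_complex[OF N(1)] abstract_cone_complex[OF abstract_cone_complex[OF B]]
    abstract_cone_complex[OF abstract_cone_complex[OF N(1)]]
  have sub_wB: "cone_complex w B \<subseteq> ?X" using cone_complex_superset[OF ac(1)] cone_complex_superset[OF ac(3)] by blast
  have sub_xB: "cone_complex x B \<subseteq> ?X"
    using cone_complex_mono[OF cone_complex_superset[OF B]] cone_complex_superset[OF ac(3)] by blast
  have sub_wN: "cone_complex w N \<subseteq> cone_complex w B" by (rule cone_complex_mono[OF N(2)])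
  have sub_xwN: "cone_complex x (cone_complex w N) \<subseteq> ?X"
    using cone_complex_mono[OF sub_wN] cone_complex_superset[OF ac(3)] by blast
  have sub_wyN: "cone_complex w (cone_complex y N) \<subseteq> ?X"
    unfolding cone_complex_commute[of w y] using cone_complex_mono[OF subset_trans[OF sub_wN cone_complex_superset[OF ac(1)]]] .
  define C where "C = cone_complex w (cone_complex y N)"
  have gC: "realized C" unfolding C_def by (rule realized_subcomplex[OF g sub_wyN ac(4)])
  have g_wB: "realized (cone_complex w B)" by (rule realized_subcomplex[OF g sub_wB ac(1)])
  have g_xB: "realized (cone_complex x B)" by (rule realized_subcomplex[OF g sub_xB ac(1)])
  have g_xwN: "realized (cone_complex x (cone_complex w N))" by (rule realized_subcomplex[OF g sub_xwN ac(4)])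
  define m where "m = (1 - 1/2) *\<^sub>R w + (1/2) *\<^sub>R y"
  have wyC: "{w, y} \<in> C" using abstract_complexD(2)[OF N(1)] neq by (simp add: C_def cone_complex_def insert_Diff_if)
  define C' where "C' = stellar C {w, y} m"
  have edge_step: "realized C'" "carrier_of C' = carrier_of C" "m \<notin> \<Union>C"
    using edge_stellar[OF gC neq(3) wyC, of "1/2"] unfolding C'_def m_def by simp_all
  have VC: "\<Union>C = insert w (insert y (\<Union>N))"
    unfolding C_def cone_complex_vertices[OF ac(2)] cone_complex_vertices[OF N(1)] ..
  have nm: "m \<noteq> w" "m \<noteq> y" "m \<notin> \<Union>N" using edge_step(3) unfolding VC by blast+
  define C1 where "C1 = cone_complex m (cone_complex w N)"
  define C2 where "C2 = cone_complex m (cone_complex y N)"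
  \<comment> \<open>A face of the subdivision contains at most one of \<open>w\<close> and
    \<open>y\<close>, and this splits it into the two halves of the edge, joined with
    \<open>N\<close>.\<close>
  have C'_eq: "C' = C1 \<union> C2"
  proof (intro equalityI subsetI)
    fix \<tau> assume t: "\<tau> \<in> C'"
    then have "\<tau> - {m} - {w} - {y} \<in> N" and n: "\<not> {w, y} \<subseteq> \<tau> - {m}"
      by (simp_all add: C'_def stellar_def C_def cone_complex_def)
    moreover from n have "w \<notin> \<tau> \<or> y \<notin> \<tau>" using nm by blast
    moreover have "\<tau> - {m} - {w} - {y} = \<tau> - {m} - {w}" if "y \<notin> \<tau>" using that by blast
    moreover have "\<tau> - {m} - {w} - {y} = \<tau> - {m} - {y}" if "w \<notin> \<tau>" using that by blast
    ultimately show "\<tau> \<in> C1 \<union> C2" by (auto simp: C1_def C2_def cone_complex_def)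
  next
    fix \<tau> assume "\<tau> \<in> C1 \<union> C2"
    then consider "\<tau> - {m} - {w} \<in> N" | "\<tau> - {m} - {y} \<in> N" by (auto simp: C1_def C2_def cone_complex_def)
    then have *: "\<tau> - {m} - {w} - {y} \<in> N \<and> \<not> {w, y} \<subseteq> \<tau> - {m}"
    proof cases
      case 1
      then have "y \<notin> \<tau> - {m} - {w}" using nN(3) by blast
      then have "y \<notin> \<tau> - {m}" using neq(3) by blast
      then show ?thesis using 1 by simp
    next
      case 2
      then have "w \<notin> \<tau> - {m} - {y}" using nN(2) by blast
      then have "w \<notin> \<tau> - {m}" using neq(3) by blast
      then show ?thesis using 2 by simp
    qed
    moreover have "(\<tau> - {m}) \<union> {w, y} - {w} - {y} = \<tau> - {m} - {w} - {y}" by blast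
    ultimately show "\<tau> \<in> C'" by (simp add: C'_def stellar_def C_def cone_complex_def)
  qed
  have gC1: "realized C1" unfolding C1_def by (rule realized_subcomplex[OF edge_step(1) _ ac(4)]) (simp add: C'_eq C1_def)
  have gC2: "realized C2" unfolding C2_def by (rule realized_subcomplex[OF edge_step(1) _ ac(4)]) (simp add: C'_eq C2_def)
  have v_wN: "\<Union>(cone_complex w N) = insert w (\<Union>N)" and v_yN: "\<Union>(cone_complex y N) = insert y (\<Union>N)"
    by (rule cone_complex_vertices[OF N(1)])+
  have m_yN: "m \<notin> \<Union>(cone_complex y N)" and m_wN: "m \<notin> \<Union>(cone_complex w N)" and w_yN: "w \<notin> \<Union>(cone_complex y N)"
    and x_wN: "x \<notin> \<Union>(cone_complex w N)"
    unfolding v_wN v_yN using nm nN neq by blast+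
  define H where "H = cone_rel w w h"
  have H: "pl_iso H (carrier_of (cone_complex w B)) (carrier_of C)"
    unfolding H_def C_def carrier_cone_complex[OF B nB(2)] carrier_cone_complex[OF ac(2) w_yN]
    by (rule pl_iso_cone_rel[OF h(1) realized_cone_pos[OF g_wB B nB(2)] realized_cone_pos[OF gC[unfolded C_def] ac(2) w_yN]])
  \<comment> \<open>The inverse of \<open>h\<close> is coned with \<open>m\<close> sent to
    \<open>x\<close>; preceded by \<open>H\<close>, it is the identity on \<open>B\<close>.\<close>
  define Q1 where "Q1 = cone_rel m x (h\<inverse>)"
  have Q1: "pl_iso Q1 (carrier_of C2) (carrier_of (cone_complex x B))"
    unfolding Q1_def C2_def carrier_cone_complex[OF B nB(1)] carrier_cone_complex[OF ac(2) m_yN]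
    by (rule pl_iso_cone_rel[OF pl_iso_converse[OF h(1)] realized_cone_pos[OF gC2[unfolded C2_def] ac(2) m_yN] realized_cone_pos[OF g_xB B nB(1)]])
  show ?thesis
  proof (cases "m = x")
    case False
    define Q2 where "Q2 = simp_rel (id(m := x)) C1"
    have Q2: "pl_iso Q2 (carrier_of C1) (carrier_of (cone_complex x (cone_complex w N)))"
      and Q2_id: "Id_on (carrier_of (cone_complex w N)) \<subseteq> Q2"
      unfolding Q2_def C1_def
      by (rule pl_iso_rename_apex[OF ac(2) m_wN x_wN False gC1[unfolded C1_def] g_xwN])+
    \<comment> \<open>The two pieces meet in \<open>m * N\<close>, and both map it to
      \<open>x * N\<close> by moving only the apex.\<close>
    define G where "G = cone_rel m x (Id_on (carrier_of N))"
    have "G = simp_rel (id(m := x)) (cone_complex m N)"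
    proof -
      have "simp_rel (id(m := x)) N = Id_on (carrier_of N)" by (rule simp_rel_id[OF N(1)]) (use nm in auto)
      then show ?thesis unfolding simp_rel_cone_complex[OF N(1) nm(3)] G_def by simp
    qed
    then have G2: "G \<subseteq> Q2" unfolding Q2_def C1_def
      using simp_rel_mono[OF cone_complex_mono[OF cone_complex_superset[OF N(1)]]] by metis
    have "Id_on (carrier_of N) \<subseteq> h\<inverse>" using h(2) by auto
    then have G1: "G \<subseteq> Q1" unfolding G_def Q1_def by (rule cone_rel_mono)
    have "carrier_of C2 \<inter> carrier_of C1 = carrier_of (C2 \<inter> C1)"
      by (rule carrier_Int[OF edge_step(1) _ _ realized_abstract[OF gC2] realized_abstract[OF gC1]]) (simp_all add: C'_eq)
    also have "\<dots> \<subseteq> carrier_of (cone_complex m N)"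
    proof (rule carrier_mono, rule subsetI)
      fix \<tau> assume "\<tau> \<in> C2 \<inter> C1"
      then have t: "\<tau> - {m} - {y} \<in> N" "\<tau> - {m} - {w} \<in> N" by (simp_all add: C1_def C2_def cone_complex_def)
      then have "y \<notin> \<tau> - {m} - {w}" using nN(3) by blast
      then have "\<tau> - {m} - {y} = \<tau> - {m}" using neq(3) by blast
      then show "\<tau> \<in> cone_complex m N" using t by (simp add: cone_complex_def)
    qed
    also have "\<dots> = Domain G" unfolding G_def Domain_cone_rel carrier_cone_complex[OF N(1) nm(3)] by simp
    finally have I1: "carrier_of C2 \<inter> carrier_of C1 \<subseteq> Domain G" .
    have "carrier_of (cone_complex x B) \<inter> carrier_of (cone_complex x (cone_complex w N)) = carrier_of (cone_complex x B \<inter> cone_complex x (cone_complex w N))"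
      by (rule carrier_Int[OF g sub_xB sub_xwN ac(1) ac(4)])
    also have "\<dots> \<subseteq> carrier_of (cone_complex x N)"
    proof (rule carrier_mono, rule subsetI)
      fix \<tau> assume "\<tau> \<in> cone_complex x B \<inter> cone_complex x (cone_complex w N)"
      then have t: "\<tau> - {x} \<in> B" "\<tau> - {x} - {w} \<in> N" by (simp_all add: cone_complex_def)
      then have "w \<notin> \<tau> - {x}" using nB(2) by blast
      then show "\<tau> \<in> cone_complex x N" using t by (simp add: cone_complex_def)
    qed
    also have "\<dots> = Range G" unfolding G_def Range_cone_rel carrier_cone_complex[OF N(1) nN(1)] by simp
    finally have I2: "carrier_of (cone_complex x B) \<inter> carrier_of (cone_complex x (cone_complex w N)) \<subseteq> Range G" .
    have Q: "pl_iso (Q1 \<union> Q2) (carrier_of C) (carrier_of (cone_complex x B) \<union> carrier_of (cone_complex x (cone_complex w N)))"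
      using pl_iso_Un[OF Q1 Q2 G1 G2 I1 I2] edge_step(2) unfolding C'_eq carrier_Un by (simp add: Un_commute)
    have "Id_on (carrier_of B) \<subseteq> H O (Q1 \<union> Q2)"
    proof
      fix p assume "p \<in> Id_on (carrier_of B)"
      then obtain a where a: "p = (a, a)" "a \<in> carrier_of B" by auto
      then have "a \<in> Domain h" using h(1) by (simp add: pl_iso_def)
      then obtain b where b: "(a, b) \<in> h" by blast
      then have "(a, b) \<in> H" unfolding H_def using cone_rel_superset by blast
      moreover have "(b, a) \<in> Q1" unfolding Q1_def using cone_rel_superset b by blast
      ultimately show "p \<in> H O (Q1 \<union> Q2)" unfolding a(1) by blast
    qed
    moreover have "Id_on (carrier_of (cone_complex w N)) \<subseteq> H O (Q1 \<union> Q2)"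
    proof -
      have "Id_on (carrier_of (cone_complex w N)) = cone_rel w w (Id_on (carrier_of N))"
        unfolding cone_rel_Id_on carrier_cone_complex[OF N(1) nN(2)] ..
      also have "\<dots> \<subseteq> H" unfolding H_def by (rule cone_rel_mono[OF h(2)])
      finally show ?thesis using Q2_id by blast
    qed
    ultimately show ?thesis using pl_iso_relcomp[OF H Q] by blast
  next
    \<comment> \<open>Then \<open>x\<close> would be the midpoint of \<open>w\<close> and
      \<open>y\<close>, although the three are distinct vertices of a realized complex.\<close>
    case True
    have "{x, w} \<in> ?X \<and> {y, w} \<in> ?X \<and> {x} \<in> ?X" using abstract_complexD(2)[OF B] neq by (simp add: cone_complex_def insert_Diff_if)
    then have "{x} \<in> ?X" "{w, y} \<in> ?X" by (simp_all add: insert_commute)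
    note X = this
    have acX: "abstract_complex ?X" using g by (rule realized_abstract)
    have "vertex_coord x \<in> bary_coords ?X" using X(1) by (intro vertex_coord_bary_coords[OF acX]) blast
    moreover have "edge_coord w y (1/2) \<in> bary_coords ?X" using edge_coord(3)[OF neq(3) _ _ acX X(2)] by simp
    moreover have "bary_point (vertex_coord x) = bary_point (edge_coord w y (1/2))"
      unfolding bary_sum_vertex_coord using True edge_coord(2)[OF neq(3), of "1/2" "\<lambda>v. v"] by (simp add: m_def)
    ultimately have "vertex_coord x = edge_coord w y (1/2)" by (rule realized_inj[OF g])
    from fun_cong[OF this, of x] have False using neq by (simp add: vertex_coord_def edge_coord_def)
    then show ?thesis ..
  qed
qed

text \<open>A space with infinitely many independent directions. A complex uses only finitely many
  of them, so there is always room for another apex.\<close>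

type_synonym V = "nat \<Rightarrow>\<^sub>0 real"

section \<open>Apexes in general position\<close>

lemma lookup_linear: "linear (\<lambda>v::'a \<Rightarrow>\<^sub>0 real. Poly_Mapping.lookup v i)"
proof (rule linearI)
  show "Poly_Mapping.lookup (a + b) i = Poly_Mapping.lookup a i + Poly_Mapping.lookup b i" for a b :: "'a \<Rightarrow>\<^sub>0 real" by (simp add: lookup_add)
  show "Poly_Mapping.lookup (r *\<^sub>R a) i = r *\<^sub>R Poly_Mapping.lookup a i" for r and a :: "'a \<Rightarrow>\<^sub>0 real"
  proof -
    have "finite {j. r * Poly_Mapping.lookup a j \<noteq> 0}"
      by (rule finite_subset[OF _ finite_lookup[of a]]) auto
    then show ?thesis by (simp add: scaleR_poly_mapping_def Abs_poly_mapping_inverse)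
  qed
qed

lemma lookup_scaleR: "Poly_Mapping.lookup (r *\<^sub>R a) i = r * Poly_Mapping.lookup (a :: 'a \<Rightarrow>\<^sub>0 real) i"
  using linear_scale[OF lookup_linear, of r a i] by simp

text \<open>The apex is a basis vector in a direction \<open>i\<close> in which all vertices of
  \<open>K\<close> have coordinate 0. The \<open>i\<close>-th coordinate of a point of the cone is
  then its weight at the apex, and the rest is uniqueness of coordinates in
  \<open>K\<close>.\<close>

lemma fresh_apex:
  fixes K :: "V set set"
  assumes "realized K" "finite F"
  shows "\<exists>z. z \<notin> \<Union>K \<and> z \<notin> F \<and> realized (cone_complex z K)"
proof -
  have ac: "abstract_complex K" using assms(1) by (rule realized_abstract)
  have "finite (\<Union>v\<in>\<Union>K \<union> F. Poly_Mapping.keys v)" using abstract_complex_finite_vertices[OF ac] assms(2)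
    by (intro finite_UN_I finite_UnI) simp_all
  then obtain i where i: "i \<notin> (\<Union>v\<in>\<Union>K \<union> F. Poly_Mapping.keys v)" using ex_new_if_finite infinite_UNIV_nat by blast
  then have l0: "Poly_Mapping.lookup v i = 0" if "v \<in> \<Union>K \<union> F" for v using that by (auto simp: in_keys_iff)
  define z :: V where "z = Poly_Mapping.single i 1"
  have lz: "Poly_Mapping.lookup z i = 1" by (simp add: z_def)
  have z: "z \<notin> \<Union>K" "z \<notin> F" using l0[of z] lz by auto
  have lb: "Poly_Mapping.lookup (bary_point d) i = 0" if d: "d \<in> bary_coords K" for d
  proof -
    have "Poly_Mapping.lookup (bary_point d) i = (\<Sum>v | d v \<noteq> 0. d v * Poly_Mapping.lookup v i)"
      unfolding bary_sum_def by (simp add: linear_sum[OF lookup_linear] lookup_scaleR)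
    also have "\<dots> = 0"
    proof (intro sum.neutral ballI)
      fix v assume "v \<in> {v. d v \<noteq> 0}"
      then have "v \<in> \<Union>K" using d by (auto simp: bary_coords_def)
      then show "d v * Poly_Mapping.lookup v i = 0" using l0[of v] by simp
    qed
    finally show ?thesis .
  qed
  have "inj_on bary_point (bary_coords (cone_complex z K))"
  proof (rule inj_onI)
    fix c d assume c: "c \<in> bary_coords (cone_complex z K)" and d: "d \<in> bary_coords (cone_complex z K)" and e: "bary_point c = bary_point d"
    have form: "c = vertex_coord z \<or> (\<exists>t c'. c = (\<lambda>v. (1 - t) * vertex_coord z v + t * c' v) \<and> 0 \<le> t \<and> t \<le> 1 \<and> c' \<in> bary_coords K)"
      if "c \<in> bary_coords (cone_complex z K)" for c using that unfolding bary_coords_cone_complex[OF ac z(1)] by blast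
    have vd: "vertex_coord z = (\<lambda>v. (1 - 0) * vertex_coord z v + 0 * c' v)" for c' by (simp add: fun_eq_iff)
    show "c = d"
    \<comment> \<open>\<open>K\<close> may consist of the empty face alone, and then the cone is a
      single point.\<close>
    proof (cases "bary_coords K = {}")
      case True
      then show ?thesis using form[OF c] form[OF d] by blast
    next
      case False
      then obtain c0 where c0: "c0 \<in> bary_coords K" by blast
      have form': "\<exists>t c'. c = (\<lambda>v. (1 - t) * vertex_coord z v + t * c' v) \<and> c' \<in> bary_coords K"
        if "c \<in> bary_coords (cone_complex z K)" for c using form[OF that] vd[of c0] c0 by metis
      obtain s c' where c': "c = (\<lambda>v. (1 - s) * vertex_coord z v + s * c' v)" "c' \<in> bary_coords K" using form'[OF c] by blast
      obtain t d' where d': "d = (\<lambda>v. (1 - t) * vertex_coord z v + t * d' v)" "d' \<in> bary_coords K" using form'[OF d] by blast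
      have ee: "(1 - s) *\<^sub>R z + s *\<^sub>R bary_point c' = (1 - t) *\<^sub>R z + t *\<^sub>R bary_point d'"
        using e unfolding c'(1) d'(1) bary_sum_cone_over[OF ac c'(2)] bary_sum_cone_over[OF ac d'(2)] .
      have "Poly_Mapping.lookup ((1 - s) *\<^sub>R z + s *\<^sub>R bary_point c') i = 1 - s" "Poly_Mapping.lookup ((1 - t) *\<^sub>R z + t *\<^sub>R bary_point d') i = 1 - t"
        using lb[OF c'(2)] lb[OF d'(2)] lz by (simp_all add: lookup_add lookup_scaleR)
      then have st: "s = t" using ee by simp
      show ?thesis
      proof (cases "t = 0")
        case True
        then show ?thesis unfolding c'(1) d'(1) st by simp
      next
        case False
        then have "bary_point c' = bary_point d'" using ee st by simp
        then have "c' = d'" using realized_inj[OF assms(1) c'(2) d'(2)] by simp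
        then show ?thesis unfolding c'(1) d'(1) st by simp
      qed
    qed
  qed
  then have "realized (cone_complex z K)" using abstract_cone_complex[OF ac] by (simp add: realized_def)
  then show ?thesis using z by blast
qed

section \<open>Independence of the triangulation\<close>

definition link_iso :: "'v::real_normed_vector set set \<Rightarrow> 'v \<Rightarrow> 'w::real_normed_vector set set \<Rightarrow> 'w \<Rightarrow> bool" where
  "link_iso K u L p \<longleftrightarrow> (\<exists>G. pl_iso G (carrier_of (link K u)) (carrier_of (link L p)))"

text \<open>A homeomorphism of antistars that carries link onto link, not necessarily by the
  identity. The restriction \<open>G\<close> to the links is kept as an object of its own, because
  it will be coned.\<close>

definition pair_iso :: "'v::real_normed_vector set set \<Rightarrow> 'v \<Rightarrow> 'w::real_normed_vector set set \<Rightarrow> 'w \<Rightarrow> bool" where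
  "pair_iso K u L p \<longleftrightarrow> (\<exists>R G. pl_iso R (carrier_of (antistar K u)) (carrier_of (antistar L p)) \<and>
     pl_iso G (carrier_of (link K u)) (carrier_of (link L p)) \<and> G \<subseteq> R)"

lemma link_iso_sym: "link_iso K u L p \<Longrightarrow> link_iso L p K u"
  unfolding link_iso_def using pl_iso_converse by blast

lemma link_iso_trans: "link_iso K u L p \<Longrightarrow> link_iso L p M q \<Longrightarrow> link_iso K u M q"
  unfolding link_iso_def using pl_iso_relcomp by blast

lemma pair_iso_sym: "pair_iso K u L p \<Longrightarrow> pair_iso L p K u"
  unfolding pair_iso_def using pl_iso_converse converse_mono by metis

lemma pair_iso_trans: "pair_iso K u L p \<Longrightarrow> pair_iso L p M q \<Longrightarrow> pair_iso K u M q"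
  unfolding pair_iso_def using pl_iso_relcomp relcomp_mono by meson

lemma pair_iso_eq:
  assumes "abstract_complex K" "u \<in> \<Union>K" "carrier_of (antistar K u) = carrier_of (antistar L p)"
    "carrier_of (link K u) = carrier_of (link L p)"
  shows "pair_iso K u L p"
proof -
  have "pl_iso (Id_on (carrier_of (antistar K u))) (carrier_of (antistar K u)) (carrier_of (antistar L p))"
    using pl_iso_Id_on[OF polyhedral_carrier[OF abstract_antistar[OF assms(1)]], of u] assms(3) by simp
  moreover have "pl_iso (Id_on (carrier_of (link K u))) (carrier_of (link K u)) (carrier_of (link L p))"
    using pl_iso_Id_on[OF polyhedral_carrier[OF abstract_link[OF assms(1,2)]]] assms(4) by simp
  moreover have "Id_on (carrier_of (link K u)) \<subseteq> Id_on (carrier_of (antistar K u))"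
    by (rule Id_on_mono[OF carrier_mono[OF link_subset_antistar[OF assms(1)]]])
  ultimately show ?thesis unfolding pair_iso_def by blast
qed

lemma pair_iso_lk: "pair_iso K u L p \<Longrightarrow> link_iso K u L p"
  unfolding pair_iso_def link_iso_def by blast

section \<open>Effect of an edge subdivision on antistar and link\<close>

lemma not_vertex_mono: "A \<subseteq> K \<Longrightarrow> m \<notin> \<Union>K \<Longrightarrow> m \<notin> \<Union>A" by blast

text \<open>If the edge is not in \<open>Q\<close>, the formula for starring returns
  \<open>Q\<close> itself. Hence antistars and links can be treated without asking whether they
  contain the edge.\<close>

lemma stellar_subcomplex_carrier:
  assumes "realized Q" "a \<noteq> b" "0 < t" "t < 1" and m: "m = (1 - t) *\<^sub>R a + t *\<^sub>R b" "m \<notin> \<Union>Q"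
  shows "carrier_of (stellar Q {a, b} m) = carrier_of Q"
proof (cases "{a, b} \<in> Q")
  case True
  then show ?thesis unfolding m(1) using assms by (intro edge_stellar(2))
next
  case False
  have ac: "abstract_complex Q" using assms(1) by (rule realized_abstract)
  have nQ: "\<not> {a, b} \<subseteq> \<sigma>" if "\<sigma> \<in> Q" for \<sigma> using abstract_complexD(4)[OF ac that] False by blast
  have "stellar Q {a, b} m = Q"
  proof (intro equalityI subsetI)
    fix \<tau> assume t: "\<tau> \<in> stellar Q {a, b} m"
    then have "m \<notin> \<tau>" using nQ[of "(\<tau> - {m}) \<union> {a, b}"] by (auto simp: stellar_def)
    then show "\<tau> \<in> Q" using t by (simp add: stellar_def)
  next
    fix \<tau> assume t: "\<tau> \<in> Q"
    then have "m \<notin> \<tau>" using m(2) by blast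
    then have e: "\<tau> - {m} = \<tau>" by simp
    show "\<tau> \<in> stellar Q {a, b} m"
      unfolding stellar_def mem_Collect_eq e using t nQ[OF t] \<open>m \<notin> \<tau>\<close> by blast
  qed
  then show ?thesis by simp
qed

lemma edge_step_cases:
  assumes K: "realized K" and edge_step: "edge_step K K'"
  obtains (far) a b t m where "a \<noteq> b" "{a, b} \<in> K" "0 < t" "t < 1" "m = (1 - t) *\<^sub>R a + t *\<^sub>R b"
      "K' = stellar K {a, b} m" "u \<noteq> a" "u \<noteq> b" "m \<notin> \<Union>K"
    | (near) w t m where "u \<noteq> w" "{u, w} \<in> K" "0 < t" "t < 1" "m = (1 - t) *\<^sub>R u + t *\<^sub>R w"
      "K' = stellar K {u, w} m" "m \<notin> \<Union>K"
proof -
  obtain a b t where s: "a \<noteq> b" "{a, b} \<in> K" "0 < t" "t < 1"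
     "K' = stellar K {a, b} ((1 - t) *\<^sub>R a + t *\<^sub>R b)"
    using edge_step unfolding edge_step_def by blast
  note nm = edge_stellar(4)[OF K s(1-4)]
  show thesis
  proof (cases "u = a \<or> u = b")
    case False
    then show thesis using far[OF s(1-4) refl s(5) _ _ nm] by blast
  next
    case True
    then show thesis
    proof
      assume u: "u = a"
      show thesis using s nm unfolding u[symmetric] by (intro near[of b t]) simp_all
    next
      assume u: "u = b"
      \<comment> \<open>The edge has no preferred direction: exchanging its ends turns
        \<open>t\<close> into \<open>1 - t\<close>.\<close>
      have e: "(1 - t) *\<^sub>R a + t *\<^sub>R b = (1 - (1 - t)) *\<^sub>R u + (1 - t) *\<^sub>R a" using u by simp
      have ab: "{a, b} = {u, a}" using u by blast
      show thesis
        by (rule near[of a "1 - t", OF _ _ _ _ e _ nm]) (use s u in \<open>simp_all add: ab\<close>)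
    qed
  qed
qed

lemma link_stellar:
  assumes "u \<noteq> a" "u \<noteq> b" "u \<noteq> m"
  shows "link (stellar K {a, b} m) u = stellar (link K u) {a, b} m"
proof (rule set_eqI)
  fix \<sigma>
  have 1: "insert u \<sigma> - {m} = insert u (\<sigma> - {m})" using assms(3) by blast
  show "\<sigma> \<in> link (stellar K {a, b} m) u \<longleftrightarrow> \<sigma> \<in> stellar (link K u) {a, b} m"
    unfolding link_def stellar_def mem_Collect_eq 1 using assms by (simp add: insert_commute) blast
qed

lemma antistar_stellar:
  assumes "u \<noteq> a" "u \<noteq> b" "u \<noteq> m"
  shows "antistar (stellar K {a, b} m) u = stellar (antistar K u) {a, b} m"
  unfolding antistar_def stellar_def using assms by auto

text \<open>For an edge without \<open>u\<close>, starring commutes with forming antistar and link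
  and changes neither carrier, so the identity is the required map.\<close>

lemma pair_iso_far:
  assumes K: "realized K" and u: "u \<in> \<Union>K" and s: "a \<noteq> b" "0 < t" "t < 1" "m = (1 - t) *\<^sub>R a + t *\<^sub>R b"
      "u \<noteq> a" "u \<noteq> b" "m \<notin> \<Union>K"
  shows "pair_iso K u (stellar K {a, b} m) u"
proof -
  have um: "u \<noteq> m" using u s(7) by blast
  have ac: "abstract_complex K" using K by (rule realized_abstract)
  have m: "m \<notin> \<Union>(antistar K u)" "m \<notin> \<Union>(link K u)"
    by (rule not_vertex_mono[OF antistar_subset s(7)], rule not_vertex_mono[OF link_subset[OF ac] s(7)])
  show ?thesis
  proof (rule pair_iso_eq[OF ac u])
    show "carrier_of (antistar K u) = carrier_of (antistar (stellar K {a, b} m) u)"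
      unfolding antistar_stellar[OF s(5,6) um] by (rule stellar_subcomplex_carrier[OF realized_antistar[OF K] s(1-4) m(1), symmetric])
    show "carrier_of (link K u) = carrier_of (link (stellar K {a, b} m) u)"
      unfolding link_stellar[OF s(5,6) um] by (rule stellar_subcomplex_carrier[OF realized_link[OF K u] s(1-4) m(2), symmetric])
  qed
qed

text \<open>After the edge \<open>uw\<close> is starred, \<open>u\<close> sees \<open>m\<close>
  wherever it used to see \<open>w\<close>; up to this change of label its link is the old
  one.\<close>

lemma link_near:
  assumes ac: "abstract_complex K" and s: "u \<noteq> w" "{u, w} \<in> K" "m \<notin> \<Union>K"
  shows "\<sigma> \<in> link (stellar K {u, w} m) u \<longleftrightarrow> w \<notin> \<sigma> \<and> (if m \<in> \<sigma> then insert w (\<sigma> - {m}) else \<sigma>) \<in> link K u"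
proof -
  have um: "m \<noteq> u" "m \<noteq> w" using s(2,3) by blast+
  have 1: "insert u \<sigma> - {m} = insert u (\<sigma> - {m})" using um by blast
  have 2: "insert u (\<sigma> - {m}) \<union> {u, w} = insert u (insert w (\<sigma> - {m}))" by blast
  have L: "\<sigma> \<in> link (stellar K {u, w} m) u \<longleftrightarrow> u \<notin> \<sigma> \<and> insert u (\<sigma> - {m}) \<in> K \<and> w \<notin> \<sigma> \<and>
      (m \<in> \<sigma> \<longrightarrow> insert u (insert w (\<sigma> - {m})) \<in> K)"
    unfolding link_def stellar_def mem_Collect_eq 1 2 using um s(1) by blast
  show ?thesis
  proof (cases "m \<in> \<sigma>")
    case True
    have "insert u (insert w (\<sigma> - {m})) \<in> K \<Longrightarrow> insert u (\<sigma> - {m}) \<in> K"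
      by (erule abstract_complexD(4)[OF ac]) blast
    then show ?thesis unfolding L unfolding link_def using True s(1) um by auto
  next
    case False
    then have "\<sigma> - {m} = \<sigma>" by simp
    then show ?thesis unfolding L unfolding link_def using False by auto
  qed
qed

lemma link_iso_near:
  assumes K: "realized K" and K': "realized K'" "K' = stellar K {u, w} m" and u: "u \<in> \<Union>K" "u \<in> \<Union>K'"
    and s: "u \<noteq> w" "{u, w} \<in> K" "m \<notin> \<Union>K"
  shows "link_iso K u K' u"
proof -
  have ac: "abstract_complex K" using K by (rule realized_abstract)
  have wm: "w \<noteq> m" using s(2,3) by blast
  have "m \<notin> \<Union>(link K u)" by (rule not_vertex_mono[OF link_subset[OF ac] s(3)])
  from pl_iso_rename[OF realized_link[OF K u(1)] realized_link[OF K'(1) u(2)] wm this]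
  show ?thesis unfolding link_iso_def K'(2) using link_near[OF ac s] by blast
qed

lemma edge_step_vertex: "realized K \<Longrightarrow> edge_step K K' \<Longrightarrow> u \<in> \<Union>K \<Longrightarrow> u \<in> \<Union>K'"
  using edge_step_props(4) by blast

lemma link_iso_edge_step: assumes K: "realized K" and edge_step: "edge_step K K'" and u: "u \<in> \<Union>K" shows "link_iso K u K' u"
  using K edge_step
proof (cases rule: edge_step_cases[of _ _ u])
  case (far a b t m)
  then show ?thesis using pair_iso_lk[OF pair_iso_far[OF K u]] by simp
next
  case (near w t m)
  then show ?thesis using link_iso_near[OF K edge_step_props(1)[OF K edge_step] near(6) u edge_step_vertex[OF K edge_step u]] by simp
qed

lemma link_iso_refl: "realized K \<Longrightarrow> u \<in> \<Union>K \<Longrightarrow> link_iso K u K u"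
  by (rule pair_iso_lk[OF pair_iso_eq[OF realized_abstract]]) simp_all

lemma link_iso_edge_step_rtrancl:
  assumes "edge_step\<^sup>*\<^sup>* K K'" "realized K" "u \<in> \<Union>K" shows "link_iso K u K' u"
  using assms
proof induction
  case base then show ?case by (rule link_iso_refl)
next
  case (step L M)
  have "realized L" "u \<in> \<Union>L" using edge_step_rtrancl_props[OF step.hyps(1) step.prems(1)] step.prems(2) by blast+
  then show ?case using link_iso_trans step link_iso_edge_step by blast
qed

text \<open>This is Newman's theorem on complements of balls in spheres, in the only form needed.\<close>

definition antistar_cone :: "'v::real_normed_vector set set \<Rightarrow> 'v \<Rightarrow> bool" where
  "antistar_cone K u \<longleftrightarrow> (\<exists>h. pl_iso h (carrier_of (antistar K u)) (carrier_of (cone_complex u (link K u))) \<and>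
     Id_on (carrier_of (link K u)) \<subseteq> h)"

lemma cone_complex_link_subset: "abstract_complex K \<Longrightarrow> cone_complex u (link K u) \<subseteq> K"
proof
  fix \<tau> assume ac: "abstract_complex K" and t: "\<tau> \<in> cone_complex u (link K u)"
  then have "insert u (\<tau> - {u}) \<in> K" by (simp add: cone_complex_def link_def)
  then show "\<tau> \<in> K" by (rule abstract_complexD(4)[OF ac]) blast
qed

lemma apex_not_in_link: "u \<notin> \<Union>(link K u)" by (auto simp: link_def)

text \<open>Starring the edge \<open>uw\<close> at \<open>m\<close> adds the ball \<open>{w, m} * N\<close> to the antistar of \<open>u\<close>. It is absorbed by
  \<open>w * B\<close>, since \<open>B\<close> is a cone over \<open>N\<close> by the hypothesis on the link of \<open>w\<close>.\<close>

lemma pair_iso_near: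
  fixes K :: "V set set"
  assumes K: "realized K" and K': "realized K'" "K' = stellar K {u, w} m" and u: "u \<in> \<Union>K" "u \<in> \<Union>K'"
    and s: "u \<noteq> w" "{u, w} \<in> K" "m \<notin> \<Union>K" and nw: "antistar_cone (link K w) u"
  shows "pair_iso K u K' u"
proof -
  have ac: "abstract_complex K" using K by (rule realized_abstract)
  have acK': "abstract_complex K'" using K'(1) by (rule realized_abstract)
  have dn: "\<sigma> \<in> K" if "insert v \<sigma> \<in> K" for \<sigma> v using that by (rule abstract_complexD(4)[OF ac]) blast
  have mu: "m \<noteq> u" "m \<noteq> w" using s(2,3) by blast+
  have wK: "w \<in> \<Union>K" using s(2) by blast
  define LW where "LW = link K w"
  \<comment> \<open>\<open>B\<close> and \<open>N\<close> are antistar and link of \<open>u\<close>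
    inside the link of \<open>w\<close>. So \<open>N\<close> is the link of the edge
    \<open>uw\<close>, and \<open>w * B\<close> is the star of \<open>w\<close> inside the antistar
    of \<open>u\<close>.\<close>
  define B where "B = antistar LW u"
  define N where "N = link LW u"
  have acLW: "abstract_complex LW" unfolding LW_def by (rule abstract_link[OF ac wK])
  have uLW: "u \<in> \<Union>LW" using s(1,2) by (auto simp: LW_def link_def insert_commute)
  have acB: "abstract_complex B" unfolding B_def by (rule abstract_antistar[OF acLW])
  have acN: "abstract_complex N" unfolding N_def by (rule abstract_link[OF acLW uLW])
  have NB: "N \<subseteq> B" unfolding N_def B_def by (rule link_subset_antistar[OF acLW])
  have B_iff: "\<sigma> \<in> B \<longleftrightarrow> w \<notin> \<sigma> \<and> u \<notin> \<sigma> \<and> insert w \<sigma> \<in> K" for \<sigma>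
    by (auto simp: B_def LW_def antistar_def link_def)
  have N_iff: "\<sigma> \<in> N \<longleftrightarrow> w \<notin> \<sigma> \<and> u \<notin> \<sigma> \<and> insert w (insert u \<sigma>) \<in> K" for \<sigma>
    using s(1) by (auto simp: N_def LW_def link_def)
  have LWK: "LW \<subseteq> K" unfolding LW_def by (rule link_subset[OF ac])
  have BK: "B \<subseteq> K" unfolding B_def by (rule subset_trans[OF antistar_subset LWK])
  have nB: "w \<notin> \<Union>B" "u \<notin> \<Union>B" "m \<notin> \<Union>B"
    by (simp add: B_iff, simp add: B_iff, rule not_vertex_mono[OF BK s(3)])
  have nN: "w \<notin> \<Union>N" "u \<notin> \<Union>N" "m \<notin> \<Union>N"
    by (rule not_vertex_mono[OF NB nB(1)], rule not_vertex_mono[OF NB nB(2)], rule not_vertex_mono[OF NB nB(3)])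
  have wB_K: "cone_complex w B \<subseteq> K"
  proof
    fix \<tau> assume "\<tau> \<in> cone_complex w B"
    then have "insert w (\<tau> - {w}) \<in> K" by (simp add: cone_complex_def B_iff)
    then show "\<tau> \<in> K" by (rule abstract_complexD(4)[OF ac]) blast
  qed
  have g_wB: "realized (cone_complex w B)" by (rule realized_subcomplex[OF K wB_K abstract_cone_complex[OF acB]])
  have v_wB: "\<Union>(cone_complex w B) = insert w (\<Union>B)" by (rule cone_complex_vertices[OF acB])
  \<comment> \<open>As \<open>m\<close> lies on the segment from \<open>u\<close> to
    \<open>w\<close>, its independence from the other vertices cannot be taken for granted. The
    exchange is carried out with a vertex \<open>z\<close> in general position, which is renamed to
    \<open>m\<close> afterwards.\<close>
  obtain z where z: "z \<notin> \<Union>(cone_complex w B)" "z \<notin> {m, u, w}" "realized (cone_complex z (cone_complex w B))"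
    using fresh_apex[OF g_wB, of "{m, u, w}"] by auto
  obtain y where y: "y \<notin> \<Union>(cone_complex z (cone_complex w B))" "y \<notin> {m, u, w, z}" "realized (cone_complex y (cone_complex z (cone_complex w B)))"
    using fresh_apex[OF z(3), of "{m, u, w, z}"] by auto
  have v_zwB: "\<Union>(cone_complex z (cone_complex w B)) = insert z (insert w (\<Union>B))"
    unfolding cone_complex_vertices[OF abstract_cone_complex[OF acB]] v_wB ..
  have zB: "z \<notin> \<Union>B" using z(1) unfolding v_wB by blast
  have yB: "y \<notin> \<Union>B" using y(1) unfolding v_zwB by blast
  have zN: "z \<notin> \<Union>N" and yN: "y \<notin> \<Union>N"
    by (rule not_vertex_mono[OF NB zB], rule not_vertex_mono[OF NB yB])
  have gX: "realized (cone_complex y (cone_complex w (cone_complex z B)))" using y(3) unfolding cone_complex_commute[of z w] .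
  have ac2: "abstract_complex (cone_complex z (cone_complex w B))" "abstract_complex (cone_complex w B)" "abstract_complex (cone_complex w (cone_complex z B))"
    by (intro abstract_cone_complex acB)+
  obtain h0 where h0: "pl_iso h0 (carrier_of B) (carrier_of (cone_complex u N))" "Id_on (carrier_of N) \<subseteq> h0"
    using nw unfolding antistar_cone_def B_def N_def LW_def by blast
  have uN_LW: "cone_complex u N \<subseteq> LW" unfolding N_def by (rule cone_complex_link_subset[OF acLW])
  have g_uN: "realized (cone_complex u N)"
    by (rule realized_subcomplex[OF K subset_trans[OF uN_LW LWK] abstract_cone_complex[OF acN]])
  have "cone_complex y N \<subseteq> cone_complex y (cone_complex z (cone_complex w B))"
    using cone_complex_mono[OF subset_trans[OF NB subset_trans[OF cone_complex_superset[OF acB] cone_complex_superset[OF ac2(2)]]]] .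
  from realized_subcomplex[OF y(3) this abstract_cone_complex[OF acN]] have g_yN: "realized (cone_complex y N)" .
  have uy: "u \<noteq> y" using y(2) by blast
  note ren = pl_iso_rename_apex[OF acN nN(2) yN uy g_uN g_yN]
  define h where "h = h0 O simp_rel (id(u := y)) (cone_complex u N)"
  have h: "pl_iso h (carrier_of B) (carrier_of (cone_complex y N))" unfolding h_def by (rule pl_iso_relcomp[OF h0(1) ren(1)])
  have hN: "Id_on (carrier_of N) \<subseteq> h" unfolding h_def using h0(2) ren(2) by blast
  have neq: "w \<noteq> z" "w \<noteq> y" "z \<noteq> y" using z(2) y(2) by blast+
  obtain R0 where R0: "pl_iso R0 (carrier_of (cone_complex z B)) (carrier_of (cone_complex w B) \<union> carrier_of (cone_complex w (cone_complex z N)))"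
    "Id_on (carrier_of B) \<subseteq> R0" "Id_on (carrier_of (cone_complex z N)) \<subseteq> R0"
    using cone_exchange[OF gX acB acN NB neq nB(1) zB yB h hN] by blast
  have "cone_complex z B \<subseteq> cone_complex z (cone_complex w B)" by (rule cone_complex_mono[OF cone_complex_superset[OF acB]])
  from realized_subcomplex[OF z(3) this abstract_cone_complex[OF acB]] have g_zB: "realized (cone_complex z B)" .
  \<comment> \<open>Moves the apex from \<open>w\<close> to \<open>z\<close> over the fixed base
    \<open>B\<close>. The exchange applied next maps \<open>z * B\<close> to \<open>w * B\<close>
    enlarged by \<open>{w, z} * N\<close>.\<close>
  define P where "P = cone_rel w z (Id_on (carrier_of B))"
  have P: "pl_iso P (carrier_of (cone_complex w B)) (carrier_of (cone_complex z B))"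
    unfolding P_def carrier_cone_complex[OF acB nB(1)] carrier_cone_complex[OF acB zB]
    by (rule pl_iso_cone_rel[OF pl_iso_Id_on[OF polyhedral_carrier[OF acB]] realized_cone_pos[OF g_wB acB nB(1)] realized_cone_pos[OF g_zB acB zB]])
  define D where "D = cone_complex w B \<union> cone_complex w (cone_complex z N)"
  define D' where "D' = cone_complex w B \<union> cone_complex w (cone_complex m N)"
  have acD: "abstract_complex D" "abstract_complex D'" unfolding D_def D'_def
    by (intro abstract_complex_Un abstract_cone_complex acB acN)+
  have "cone_complex w (cone_complex z N) \<subseteq> cone_complex w (cone_complex z B)" by (rule cone_complex_mono[OF cone_complex_mono[OF NB]])
  then have D_sub: "D \<subseteq> cone_complex z (cone_complex w B)" unfolding D_def cone_complex_commute[of w z]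
    using cone_complex_superset[OF ac2(2), of z] by blast
  have gD: "realized D" by (rule realized_subcomplex[OF z(3) D_sub acD(1)])
  have D'_K': "D' \<subseteq> K'"
  proof
    fix \<tau> assume "\<tau> \<in> D'"
    then consider "\<tau> \<in> cone_complex w B" | "\<tau> - {w} - {m} \<in> N" by (auto simp: D'_def cone_complex_def)
    then show "\<tau> \<in> K'"
    proof cases
      case 1
      then have t: "\<tau> \<in> K" using wB_K by blast
      have "u \<notin> \<tau> - {w}" using 1 by (simp add: cone_complex_def B_iff)
      moreover have "m \<notin> \<tau>" using t s(3) by blast
      ultimately show ?thesis unfolding K'(2) stellar_def using t s(1) by auto
    next
      case 2
      then have u': "u \<notin> \<tau>" and i: "insert w (insert u (\<tau> - {w} - {m})) \<in> K"
        using s(1) mu(1) by (auto simp: N_iff)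
      have e: "insert w (insert u (\<tau> - {w} - {m})) = (\<tau> - {m}) \<union> {u, w}" using mu by blast
      have "(\<tau> - {m}) \<union> {u, w} \<in> K" using i unfolding e .
      moreover from this have "\<tau> - {m} \<in> K" by (rule abstract_complexD(4)[OF ac]) blast
      ultimately show ?thesis unfolding K'(2) stellar_def using u' by simp
    qed
  qed
  have gD': "realized D'" by (rule realized_subcomplex[OF K'(1) D'_K' acD(2)])
  have zm: "z \<noteq> m" using z(2) by blast
  have "\<Union>D = insert w (\<Union>B) \<union> insert w (insert z (\<Union>N))"
    unfolding D_def Union_Un_distrib v_wB cone_complex_vertices[OF abstract_cone_complex[OF acN]] cone_complex_vertices[OF acN] ..
  then have mD: "m \<notin> \<Union>D" using nB(3) nN(3) mu zm by auto
  define S where "S = simp_rel (id(z := m)) D"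
  have S: "pl_iso S (carrier_of D) (carrier_of D')"
    unfolding S_def
  proof (rule pl_iso_rename[OF gD gD' zm mD])
    fix \<tau>
    have zD': "z \<notin> \<Union>D'"
    proof -
      have "\<Union>D' = insert w (\<Union>B) \<union> insert w (insert m (\<Union>N))"
        unfolding D'_def Union_Un_distrib v_wB cone_complex_vertices[OF abstract_cone_complex[OF acN]] cone_complex_vertices[OF acN] ..
      then show ?thesis using zB zN z(2) by auto
    qed
    show "\<tau> \<in> D' \<longleftrightarrow> z \<notin> \<tau> \<and> (if m \<in> \<tau> then insert z (\<tau> - {m}) else \<tau>) \<in> D"
    proof (cases "z \<in> \<tau>")
      case True
      then show ?thesis using zD' by blast
    next
      case False
      show ?thesis
      proof (cases "m \<in> \<tau>")
        case True
        have "\<tau> \<notin> cone_complex w B" using True nB(3) mu by (auto simp: cone_complex_def)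
        moreover have "insert z (\<tau> - {m}) \<notin> cone_complex w B" using zB z(2) by (auto simp: cone_complex_def)
        moreover have "insert z (\<tau> - {m}) - {w} - {z} = \<tau> - {w} - {m}" using False by blast
        ultimately show ?thesis using True False by (simp add: D_def D'_def cone_complex_def)
      next
        case F: False
        then have "\<tau> - {w} - {m} = \<tau> - {w}" "\<tau> - {w} - {z} = \<tau> - {w}" using False by blast+
        then show ?thesis using F False by (simp add: D_def D'_def cone_complex_def)
      qed
    qed
  qed
  have SB: "Id_on (carrier_of B) \<subseteq> S"
  proof -
    have "Id_on (carrier_of B) = simp_rel (id(z := m)) B" by (rule simp_rel_id[OF acB, symmetric]) (use zB in auto)
    also have "\<dots> \<subseteq> S" unfolding S_def D_def using cone_complex_superset[OF acB, of w] by (intro simp_rel_mono) blast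
    finally show ?thesis .
  qed
  have SN: "cone_rel z m (Id_on (carrier_of N)) \<subseteq> S"
  proof -
    have "simp_rel (id(z := m)) N = Id_on (carrier_of N)" by (rule simp_rel_id[OF acN]) (use zN in auto)
    then have "cone_rel z m (Id_on (carrier_of N)) = simp_rel (id(z := m)) (cone_complex z N)"
      unfolding simp_rel_cone_complex[OF acN zN] by simp
    also have "\<dots> \<subseteq> S" unfolding S_def D_def
      using cone_complex_superset[OF abstract_cone_complex[OF acN], of z w] by (intro simp_rel_mono) blast
    finally show ?thesis .
  qed
  have "pl_iso R0 (carrier_of (cone_complex z B)) (carrier_of D)" using R0(1) unfolding D_def carrier_Un .
  from pl_iso_relcomp[OF P pl_iso_relcomp[OF this S]]
  have R1: "pl_iso (P O R0 O S) (carrier_of (cone_complex w B)) (carrier_of D')" .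
  have R1B: "Id_on (carrier_of B) \<subseteq> P O R0 O S"
  proof
    fix p assume "p \<in> Id_on (carrier_of B)"
    then obtain a where a: "p = (a, a)" "(a, a) \<in> Id_on (carrier_of B)" by auto
    have "(a, a) \<in> P" unfolding P_def using cone_rel_superset a(2) by blast
    moreover have "(a, a) \<in> R0" using R0(2) a(2) by blast
    moreover have "(a, a) \<in> S" using SB a(2) by blast
    ultimately show "p \<in> P O R0 O S" unfolding a(1) by blast
  qed
  \<comment> \<open>On \<open>w * N\<close>, the part of the link of \<open>u\<close> around
    \<open>w\<close>, the composite only moves the apex from \<open>w\<close> to \<open>m\<close>,
    in agreement with the change of the link.\<close>
  define G1 where "G1 = cone_rel w m (Id_on (carrier_of N))"
  have G1: "G1 \<subseteq> P O R0 O S"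
  proof
    fix q assume q: "q \<in> G1"
    obtain q1 q2 where q12: "q = (q1, q2)" by fastforce
    obtain r where r: "(q1, r) \<in> cone_rel w z (Id_on (carrier_of N))" "(r, q2) \<in> cone_rel z m (Id_on (carrier_of N))"
      "r \<in> cone_over z (carrier_of N)"
      using q unfolding q12 G1_def cone_rel_iff cone_over_def by blast
    have "(q1, r) \<in> P" using r(1) cone_rel_mono[OF Id_on_mono[OF carrier_mono[OF NB]]] unfolding P_def by blast
    moreover have "(r, r) \<in> R0" using R0(3) r(3) unfolding carrier_cone_complex[OF acN zN] by blast
    moreover have "(r, q2) \<in> S" using SN r(2) by blast
    ultimately show "q \<in> P O R0 O S" unfolding q12 by blast
  qed
  \<comment> \<open>The faces with neither \<open>u\<close> nor \<open>w\<close>. They are common to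
    \<open>K\<close> and \<open>K'\<close>, and the map is the identity on them.\<close>
  define A0 where "A0 = antistar (antistar K u) w"
  have A0K: "A0 \<subseteq> K" "A0 \<subseteq> K'"
  proof -
    show A: "A0 \<subseteq> K" by (auto simp: A0_def antistar_def)
    show "A0 \<subseteq> K'"
    proof
      fix \<tau> assume t: "\<tau> \<in> A0"
      then have "m \<notin> \<tau>" "u \<notin> \<tau>" "\<tau> \<in> K" using s(3) A by (auto simp: A0_def antistar_def)
      then show "\<tau> \<in> K'" unfolding K'(2) stellar_def by simp
    qed
  qed
  have acA0: "abstract_complex A0" unfolding A0_def by (intro abstract_antistar ac)
  have A_eq: "antistar K u = A0 \<union> cone_complex w B"
  proof (rule set_eqI)
    fix \<tau> show "\<tau> \<in> antistar K u \<longleftrightarrow> \<tau> \<in> A0 \<union> cone_complex w B"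
    proof (cases "w \<in> \<tau>")
      case True
      then have "insert w (\<tau> - {w}) = \<tau>" by blast
      then show ?thesis using True s(1) by (auto simp: A0_def antistar_def cone_complex_def B_iff)
    next
      case False
      then have "\<tau> - {w} = \<tau>" by simp
      then show ?thesis using False dn[of w \<tau>] by (auto simp: A0_def antistar_def cone_complex_def B_iff)
    qed
  qed
  have A'_eq: "antistar K' u = A0 \<union> D'"
  proof (intro equalityI subsetI)
    fix \<tau> assume "\<tau> \<in> antistar K' u"
    then have t: "u \<notin> \<tau>" "\<tau> - {m} \<in> K" "m \<in> \<tau> \<Longrightarrow> (\<tau> - {m}) \<union> {u, w} \<in> K"
      by (auto simp: antistar_def K'(2) stellar_def)
    show "\<tau> \<in> A0 \<union> D'"
    proof (cases "m \<in> \<tau>")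
      case True
      have "insert w (insert u (\<tau> - {w} - {m})) = (\<tau> - {m}) \<union> {u, w}" using mu by blast
      then have "\<tau> - {w} - {m} \<in> N" using t(3)[OF True] t(1) by (simp add: N_iff)
      then show ?thesis by (simp add: D'_def cone_complex_def)
    next
      case False
      then have "\<tau> \<in> antistar K u" using t by (simp add: antistar_def)
      then show ?thesis unfolding A_eq D'_def by blast
    qed
  next
    fix \<tau> assume t: "\<tau> \<in> A0 \<union> D'"
    have "u \<notin> \<tau>"
    proof -
      have "u \<notin> \<Union>D'" unfolding D'_def Union_Un_distrib v_wB cone_complex_vertices[OF abstract_cone_complex[OF acN]] cone_complex_vertices[OF acN]
        using nB(2) nN(2) s(1) mu by auto
      then show ?thesis using t by (auto simp: A0_def antistar_def)
    qed
    moreover have "\<tau> \<in> K'" using t A0K(2) D'_K' by blast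
    ultimately show "\<tau> \<in> antistar K' u" by (simp add: antistar_def)
  qed
  define R where "R = Id_on (carrier_of A0) \<union> (P O R0 O S)"
  have "carrier_of A0 \<inter> carrier_of (cone_complex w B) = carrier_of (A0 \<inter> cone_complex w B)"
    by (rule carrier_Int[OF K A0K(1) wB_K acA0 ac2(2)])
  also have "\<dots> \<subseteq> carrier_of B" by (rule carrier_mono) (auto simp: A0_def antistar_def cone_complex_def)
  finally have I1: "carrier_of A0 \<inter> carrier_of (cone_complex w B) \<subseteq> Domain (Id_on (carrier_of B))" by simp
  have "carrier_of A0 \<inter> carrier_of D' = carrier_of (A0 \<inter> D')"
    by (rule carrier_Int[OF K'(1) A0K(2) D'_K' acA0 acD(2)])
  also have "\<dots> \<subseteq> carrier_of B"
  proof (rule carrier_mono, rule subsetI)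
    fix \<tau> assume t: "\<tau> \<in> A0 \<inter> D'"
    then have "w \<notin> \<tau>" "m \<notin> \<tau>" using s(3) by (auto simp: A0_def antistar_def)
    then have "\<tau> - {w} = \<tau>" "\<tau> - {w} - {m} = \<tau>" by simp_all
    then show "\<tau> \<in> B" using t NB by (auto simp: D'_def cone_complex_def)
  qed
  finally have I2: "carrier_of A0 \<inter> carrier_of D' \<subseteq> Range (Id_on (carrier_of B))" by simp
  have "cone_complex w B \<subseteq> antistar K u" using A_eq by blast
  have "B \<subseteq> A0"
  proof
    fix \<tau> assume "\<tau> \<in> B"
    then show "\<tau> \<in> A0" using BK by (auto simp: A0_def antistar_def B_iff)
  qed
  then have BA0: "Id_on (carrier_of B) \<subseteq> Id_on (carrier_of A0)" by (rule Id_on_mono[OF carrier_mono])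
  have R: "pl_iso R (carrier_of (antistar K u)) (carrier_of (antistar K' u))"
    unfolding R_def A_eq A'_eq carrier_Un
    by (rule pl_iso_Un[OF pl_iso_Id_on[OF polyhedral_carrier[OF acA0]] R1 BA0 R1B I1 I2])
  define L0 where "L0 = antistar (link K u) w"
  have acL0: "abstract_complex L0" unfolding L0_def by (intro abstract_antistar abstract_link ac u(1))
  have "L0 \<subseteq> A0" using link_subset_antistar[OF ac, of u] by (auto simp: L0_def A0_def antistar_def)
  then have L0A0: "Id_on (carrier_of L0) \<subseteq> Id_on (carrier_of A0)" by (rule Id_on_mono[OF carrier_mono])
  have L_eq: "link K u = L0 \<union> cone_complex w N"
  proof (rule set_eqI)
    fix \<tau> show "\<tau> \<in> link K u \<longleftrightarrow> \<tau> \<in> L0 \<union> cone_complex w N"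
    proof (cases "w \<in> \<tau>")
      case True
      then have "insert w (insert u (\<tau> - {w})) = insert u \<tau>" by blast
      then show ?thesis using True s(1) by (auto simp: L0_def antistar_def cone_complex_def N_iff link_def)
    next
      case False
      then have "\<tau> - {w} = \<tau>" by simp
      then show ?thesis using False dn[of w "insert u \<tau>"] by (auto simp: L0_def antistar_def cone_complex_def N_iff link_def)
    qed
  qed
  have L'_eq: "link K' u = L0 \<union> cone_complex m N"
  proof (rule set_eqI)
    fix \<tau>
    have i: "\<tau> \<in> link K' u \<longleftrightarrow> w \<notin> \<tau> \<and> (if m \<in> \<tau> then insert w (\<tau> - {m}) else \<tau>) \<in> link K u"
      unfolding K'(2) by (rule link_near[OF ac s])
    show "\<tau> \<in> link K' u \<longleftrightarrow> \<tau> \<in> L0 \<union> cone_complex m N"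
    proof (cases "m \<in> \<tau>")
      case True
      have "\<tau> \<notin> L0" using True s(3) link_subset[OF ac, of u] by (auto simp: L0_def antistar_def)
      moreover have "insert u (insert w (\<tau> - {m})) = insert w (insert u (\<tau> - {m}))" by blast
      ultimately show ?thesis unfolding i using True mu s(1) by (auto simp: cone_complex_def N_iff link_def)
    next
      case False
      then have e: "\<tau> - {m} = \<tau>" by simp
      have "\<tau> \<in> L0" if "\<tau> \<in> N" using that dn[of w "insert u \<tau>"] by (auto simp: L0_def antistar_def N_iff link_def)
      then show ?thesis unfolding i using False e by (auto simp: cone_complex_def L0_def antistar_def)
    qed
  qed
  define G where "G = Id_on (carrier_of L0) \<union> G1"
  have GR: "G \<subseteq> R" unfolding G_def R_def using L0A0 G1 by blast
  have "polyhedral G" unfolding G_def G1_def cone_rel_def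
    by (intro polyhedral_Un polyhedral_Id_on polyhedral_cone_over polyhedral_carrier acL0 acN)
  from pl_iso_sub[OF R GR this] have "pl_iso G (Domain G) (Range G)" .
  moreover have "Domain G = carrier_of (link K u)" "Range G = carrier_of (link K' u)"
    unfolding L_eq L'_eq carrier_Un G_def G1_def carrier_cone_complex[OF acN nN(1)] carrier_cone_complex[OF acN nN(3)]
      Domain_Un_eq Range_Un_eq Domain_cone_rel Range_cone_rel by simp_all
  ultimately have "pl_iso G (carrier_of (link K u)) (carrier_of (link K' u))" by simp
  then show ?thesis using R GR unfolding pair_iso_def by blast
qed

text \<open>The hypothesis on links must hold in every intermediate triangulation. As edge
  subdivisions preserve the carrier, it is formulated for all complexes whose carrier satisfies
  \<open>P\<close>; later \<open>P\<close> says that the carrier is a sphere.\<close>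

lemma pair_iso_edge_step_rtrancl:
  fixes K :: "V set set"
  assumes "edge_step\<^sup>*\<^sup>* K K'" "realized K" "u \<in> \<Union>K" "P (carrier_of K)"
    and nw: "\<And>L w. realized L \<Longrightarrow> P (carrier_of L) \<Longrightarrow> {u, w} \<in> L \<Longrightarrow> u \<noteq> w \<Longrightarrow> antistar_cone (link L w) u"
  shows "pair_iso K u K' u"
  using assms(1-4)
proof induction
  case base
  show ?case by (rule pair_iso_eq[OF realized_abstract[OF base(1)] base(2)]) simp_all
next
  case (step L M)
  have L: "realized L" "u \<in> \<Union>L" "carrier_of L = carrier_of K"
    using edge_step_rtrancl_props[OF step.hyps(1) step.prems(1)] step.prems(2) by blast+
  have "pair_iso L u M u"
    using L(1) step.hyps(2)
  proof (cases rule: edge_step_cases[of _ _ u])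
    case (far a b t m)
    then show ?thesis using pair_iso_far[OF L(1,2)] by simp
  next
    case (near w t m)
    have "antistar_cone (link L w) u" using nw[OF L(1) _ near(2) near(1)] step.prems(3) L(3) by simp
    then show ?thesis
      using pair_iso_near[OF L(1) edge_step_props(1)[OF L(1) step.hyps(2)] near(6) L(2) edge_step_vertex[OF L(1) step.hyps(2) L(2)] near(1,2,7)]
      by simp
  qed
  moreover have "pair_iso K u L u" using step by blast
  ultimately show ?case using pair_iso_trans by blast
qed

section \<open>Making two triangulations agree near a vertex\<close>

lemma bary_sum_g_apex:
  fixes g :: "'v \<Rightarrow> real"
  assumes "abstract_complex K" "c \<in> bary_coords K" "g p = 0" "\<And>v. c v \<noteq> 0 \<Longrightarrow> v \<noteq> p \<Longrightarrow> g v = e"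
  shows "bary_sum g c = (1 - c p) * e"
proof -
  have f: "finite {v. c v \<noteq> 0}" using assms(1,2) by (rule bary_coords_finite)
  let ?W = "insert p {v. c v \<noteq> 0}"
  have W: "finite ?W" using f by simp
  have "bary_sum (\<lambda>_. 1::real) c = sum c ?W" using bary_sum_sum[OF W, of c "\<lambda>_. 1::real"] by auto
  then have "sum c ?W = 1" using bary_coords_mass[OF assms(2)] by simp
  then have s: "sum c (?W - {p}) = 1 - c p" using sum.remove[OF W, of p c] by simp
  have "bary_sum g c = (\<Sum>v\<in>?W. c v * g v)" using bary_sum_sum[OF W, of c g] by auto
  also have "\<dots> = (\<Sum>v\<in>?W - {p}. c v * g v)" using sum.remove[OF W, of p "\<lambda>v. c v * g v"] assms(3) by simp
  also have "\<dots> = (\<Sum>v\<in>?W - {p}. c v * e)"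
  proof (rule sum.cong)
    fix v assume "v \<in> ?W - {p}"
    then have "c v \<noteq> 0" "v \<noteq> p" by auto
    then show "c v * g v = c v * e" using assms(4) by simp
  qed simp
  also have "\<dots> = (1 - c p) * e" using s by (simp flip: sum_distrib_right)
  finally show ?thesis .
qed

lemma bary_sum_ge:
  fixes g :: "'v \<Rightarrow> real"
  assumes "abstract_complex K" "c \<in> bary_coords K" "\<And>v. c v \<noteq> 0 \<Longrightarrow> e \<le> g v"
  shows "e \<le> bary_sum g c"
proof -
  have "bary_sum g c \<in> {e..}" by (rule bary_sum_in_convex[OF assms(2,1)]) (use assms(3) in auto)
  then show ?thesis by simp
qed

text \<open>Here \<open>g\<close> is one minus the barycentric coordinate of \<open>p\<close> in \<open>L\<close>. After cutting at level \<open>e\<close> the star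
  of \<open>p\<close> is the set \<open>g \<le> e\<close>, which does not depend on the triangulation \<open>M\<close>.\<close>

lemma gauge_cut:
  fixes L M :: "'v::real_normed_vector set set"
  assumes L: "realized L" and M: "realized M" and r: "refines M L" and cM: "carrier_of M = carrier_of L"
    and p: "p \<in> \<Union>L" "p \<in> \<Union>M" and e: "0 < e" "e < (1::real)"
    and g: "simplexwise_affine L g" "g p = 0" "\<And>v. v \<in> \<Union>L \<Longrightarrow> v \<noteq> p \<Longrightarrow> g v = 1"
    and gM: "\<And>v. v \<in> \<Union>M \<Longrightarrow> v \<noteq> p \<Longrightarrow> e < g v"
  shows "\<exists>M'. edge_step\<^sup>*\<^sup>* M M' \<and> carrier_of (link M' p) = {x \<in> carrier_of L. g x = e} \<and>
    carrier_of (antistar M' p) = {x \<in> carrier_of L. e \<le> g x}"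
proof -
  have acL: "abstract_complex L" and acM: "abstract_complex M" using L M by (simp_all add: realized_abstract)
  have swM: "simplexwise_affine M g" by (rule simplexwise_affine_refines[OF acL acM r g(1)])
  have "simplexwise_affine M (\<lambda>x. g x - e)"
    unfolding simplexwise_affine_def
  proof
    fix c assume c: "c \<in> bary_coords M"
    have "bary_sum (\<lambda>x. g x - e) c = bary_sum g c - e * bary_sum (\<lambda>_. 1) c"
      by (simp add: bary_sum_def algebra_simps sum_subtractf sum_distrib_left)
    then show "g (bary_point c) - e = bary_sum (\<lambda>x. g x - e) c" using bary_coords_mass[OF c] bspec[OF swM[unfolded simplexwise_affine_def] c] by simp
  qed
  from cut[OF M this] obtain M' where M': "edge_step\<^sup>*\<^sup>* M M'"
    and sgn: "\<forall>\<sigma>\<in>M'. (\<forall>v\<in>\<sigma>. 0 \<le> g v - e) \<or> (\<forall>v\<in>\<sigma>. g v - e \<le> 0)"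
    and vM': "\<forall>v\<in>\<Union>M'. v \<in> \<Union>M \<or> g v - e = 0" by blast
  have pr: "realized M'" "carrier_of M' = carrier_of L" "refines M' M" "\<Union>M \<subseteq> \<Union>M'"
    using edge_step_rtrancl_props[OF M' M] cM by simp_all
  have ac: "abstract_complex M'" using pr(1) by (rule realized_abstract)
  have pM': "p \<in> \<Union>M'" using pr(4) p(2) by (rule subsetD)
  have sw: "simplexwise_affine M' g" by (rule simplexwise_affine_refines[OF acM ac pr(3) swM])
  have gb: "g (bary_point c) = bary_sum g c" if "c \<in> bary_coords M'" for c by (rule bspec[OF sw[unfolded simplexwise_affine_def] that])
  have ge: "e \<le> g v" if v: "v \<in> \<Union>M'" "v \<noteq> p" for v
  proof -
    consider "v \<in> \<Union>M" | "g v - e = 0" using bspec[OF vM' v(1)] by blast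
    then show ?thesis by cases (use gM[of v] v(2) in simp_all)
  qed
  \<comment> \<open>In a face containing \<open>p\<close> the sign condition and
    \<open>g p = 0 < e\<close> bound the other vertices by \<open>e\<close> from above, while
    \<open>ge\<close> bounds them from below.\<close>
  have geq: "g v = e" if v: "\<sigma> \<in> M'" "p \<in> \<sigma>" "v \<in> \<sigma>" "v \<noteq> p" for v \<sigma>
  proof -
    have "\<not> 0 \<le> g p - e" using g(2) e by simp
    then have "g v - e \<le> 0" using bspec[OF sgn v(1)] v(2,3) by blast
    moreover have "e \<le> g v" using v by (intro ge) auto
    ultimately show ?thesis by simp
  qed
  have supv: "v \<in> \<Union>M'" if "c \<in> bary_coords M'" "c v \<noteq> 0" for c v using that by (auto simp: bary_coords_def)
  have acA: "abstract_complex (antistar M' p)" by (rule abstract_antistar[OF ac])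
  have acK: "abstract_complex (link M' p)" by (rule abstract_link[OF ac pM'])
  have apex: "bary_sum g c = (1 - c p) * e" if c: "c \<in> bary_coords M'" "c p \<noteq> 0" for c
  proof (rule bary_sum_g_apex[where g = g and p = p, OF ac c(1) g(2)])
    fix v assume v: "c v \<noteq> 0" "v \<noteq> p"
    have "{v. c v \<noteq> 0} \<in> M'" using c(1) by (simp add: bary_coords_def)
    then show "g v = e" by (rule geq) (use v c in auto)
  qed
  have nz: "bary_sum g c \<ge> e" if c: "c \<in> bary_coords M'" "c p = 0" for c
  proof (rule bary_sum_ge[where g = g, OF ac c(1)])
    fix v assume "c v \<noteq> 0"
    then show "e \<le> g v" using supv[OF c(1)] c(2) by (intro ge) auto
  qed
  have "carrier_of (antistar M' p) = {x \<in> carrier_of L. e \<le> g x}"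
  proof (intro equalityI subsetI)
    fix x assume "x \<in> carrier_of (antistar M' p)"
    then obtain c where c: "x = bary_point c" "c \<in> bary_coords (antistar M' p)" unfolding carrier_coords[OF acA] by blast
    have c': "c \<in> bary_coords M'" by (rule subsetD[OF bary_coords_mono[OF antistar_subset] c(2)])
    have "c p = 0" using c(2) by (auto simp: bary_coords_def antistar_def)
    then have "e \<le> g x" using nz[OF c'] gb[OF c'] c(1) by simp
    moreover have "x \<in> carrier_of M'" unfolding carrier_coords[OF ac] c(1) using c' by (rule imageI)
    ultimately show "x \<in> {x \<in> carrier_of L. e \<le> g x}" using pr(2) by simp
  next
    fix x assume x: "x \<in> {x \<in> carrier_of L. e \<le> g x}"
    then have "x \<in> carrier_of M'" using pr(2) by simp
    then obtain c where c: "x = bary_point c" "c \<in> bary_coords M'" unfolding carrier_coords[OF ac] by blast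
    have "c p = 0"
    proof (rule ccontr)
      assume cp: "c p \<noteq> 0"
      then have "c p > 0" using c(2) by (simp add: bary_coords_def order_less_le)
      then have "(1 - c p) * e < e" using e by (simp add: algebra_simps)
      then show False using apex[OF c(2) cp] gb[OF c(2)] c(1) x by simp
    qed
    then have "c \<in> bary_coords (antistar M' p)" using c(2) by (simp add: bary_coords_def antistar_def)
    then show "x \<in> carrier_of (antistar M' p)" unfolding carrier_coords[OF acA] c(1) by blast
  qed
  moreover have "carrier_of (link M' p) = {x \<in> carrier_of L. g x = e}"
  proof (intro equalityI subsetI)
    fix x assume "x \<in> carrier_of (link M' p)"
    then obtain c where c: "x = bary_point c" "c \<in> bary_coords (link M' p)" unfolding carrier_coords[OF acK] by blast
    have c': "c \<in> bary_coords M'" by (rule subsetD[OF bary_coords_mono[OF link_subset[OF ac]] c(2)])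
    have s: "insert p {v. c v \<noteq> 0} \<in> M'" "c p = 0" using c(2) by (auto simp: bary_coords_def link_def)
    have "bary_sum g c = (1 - c p) * e"
    proof (rule bary_sum_g_apex[where g = g and p = p, OF ac c' g(2)])
      show "g v = e" if "c v \<noteq> 0" "v \<noteq> p" for v by (rule geq[OF s(1)]) (use that in auto)
    qed
    then have "g x = e" using gb[OF c'] c(1) s(2) by simp
    moreover have "x \<in> carrier_of M'" unfolding carrier_coords[OF ac] c(1) using c' by (rule imageI)
    ultimately show "x \<in> {x \<in> carrier_of L. g x = e}" using pr(2) by simp
  next
    fix x assume x: "x \<in> {x \<in> carrier_of L. g x = e}"
    then have "x \<in> carrier_of L" by simp
    then obtain d where d: "x = bary_point d" "d \<in> bary_coords L" unfolding carrier_coords[OF acL] by blast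
    have gL: "g (bary_point d) = bary_sum g d" if "d \<in> bary_coords L" for d by (rule bspec[OF g(1)[unfolded simplexwise_affine_def] that])
    have "bary_sum g d = (1 - d p) * 1"
    proof (rule bary_sum_g_apex[where g = g and p = p, OF acL d(2) g(2)])
      show "g v = 1" if "d v \<noteq> 0" "v \<noteq> p" for v using that d(2) by (intro g(3)) (auto simp: bary_coords_def)
    qed
    then have dp: "d p \<noteq> 0" using gL[OF d(2)] x d(1) e by auto
    let ?s = "{v. d v \<noteq> 0}"
    have sL: "?s \<in> L" using d(2) by (simp add: bary_coords_def)
    \<comment> \<open>Halfway towards \<open>p\<close> the value of \<open>g\<close> is
      \<open>e / 2\<close>, so this point has weight 1/2 at \<open>p\<close> in the subdivision.
      Doubling its other weights gives coordinates of \<open>x\<close> in the link.\<close>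
    let ?h = "\<lambda>v. (1 - 1/2) * vertex_coord p v + 1/2 * d v"
    have h: "?h \<in> bary_coords L"
      using bary_coords_convex[OF acL sL vertex_coord_bary_coords[OF acL p(1)] d(2), of "1/2"] dp by (simp add: vertex_coord_def)
    have "bary_point ?h = (1 - 1/2) *\<^sub>R p + (1/2) *\<^sub>R x" using bary_sum_cone_over[OF acL d(2), of "\<lambda>v. v" "1/2" p] d(1) by simp
    moreover have "bary_sum g ?h = (1 - 1/2) * g p + 1/2 * bary_sum g d"
      using bary_sum_cone_over[OF acL d(2), of g "1/2" p] by simp
    ultimately obtain y where y: "y = (1/2) *\<^sub>R p + (1/2) *\<^sub>R x" "y \<in> carrier_of L" "g y = e / 2"
      using gL[OF h] gL[OF d(2)] h d(1) x g(2) unfolding carrier_coords[OF acL] by fastforce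
    obtain c where c: "y = bary_point c" "c \<in> bary_coords M'" using y(2) unfolding pr(2)[symmetric] carrier_coords[OF ac] by blast
    have "e / 2 < e" using e by simp
    then have cp: "c p \<noteq> 0" using nz[OF c(2)] gb[OF c(2)] y(3) c(1) by auto
    have "(1 - c p) * e = e / 2" using apex[OF c(2) cp] gb[OF c(2)] y(3) c(1) by simp
    then have cp2: "c p = 1 / 2" using e by (simp add: field_simps)
    define c' where "c' v = (if v = p then 0 else 2 * c v)" for v
    have sc': "{v. c' v \<noteq> 0} = {v. c v \<noteq> 0} - {p}" by (auto simp: c'_def)
    have sM: "{v. c v \<noteq> 0} \<in> M'" using c(2) by (simp add: bary_coords_def)
    have "insert p ({v. c v \<noteq> 0} - {p}) = {v. c v \<noteq> 0}" using cp by auto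
    then have "{v. c' v \<noteq> 0} \<in> link M' p" unfolding sc' link_def using sM by simp
    moreover have "0 \<le> c' v" for v using c(2) by (simp add: c'_def bary_coords_def)
    moreover have f: "finite {v. c' v \<noteq> 0}" unfolding sc' using bary_coords_finite[OF ac c(2)] by simp
    have cc: "c = (\<lambda>v. 1/2 * vertex_coord p v + 1/2 * c' v)"
    proof
      show "c v = 1/2 * vertex_coord p v + 1/2 * c' v" for v using cp2 by (simp add: vertex_coord_def c'_def)
    qed
    have bl: "bary_sum f c = (1/2) *\<^sub>R f p + (1/2) *\<^sub>R bary_sum f c'" for f :: "'v \<Rightarrow> 'c::real_vector"
      using bary_sum_linear[OF vertex_coord_finite f, of f "1/2" p "1/2"] cc by (simp add: bary_sum_vertex_coord)
    have "bary_sum (\<lambda>_. 1::real) c' = 1" using bl[of "\<lambda>_. 1::real"] bary_coords_mass[OF c(2)] by simp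
    ultimately have c'm: "c' \<in> bary_coords (link M' p)" by (simp add: bary_coords_def bary_sum_one)
    have "bary_point c' = x" using bl[of "\<lambda>v. v"] c(1) y(1) by simp
    then show "x \<in> carrier_of (link M' p)" unfolding carrier_coords[OF acK] using c'm by blast
  qed
  ultimately show ?thesis using M' by blast
qed

text \<open>\<open>M\<close> and \<open>L\<close> are cut with the same function at the same level,
  so in both cases link and antistar have the carriers \<open>g = e\<close> and
  \<open>e \<le> g\<close>.\<close>

lemma gauge_pair:
  fixes L M :: "'v::real_normed_vector set set"
  assumes L: "realized L" and M: "realized M" and r: "refines M L" and cM: "carrier_of M = carrier_of L"
    and p: "p \<in> \<Union>L" "p \<in> \<Union>M"
  shows "\<exists>M' L'. edge_step\<^sup>*\<^sup>* M M' \<and> edge_step\<^sup>*\<^sup>* L L' \<and> carrier_of (link M' p) = carrier_of (link L' p) \<and>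
    carrier_of (antistar M' p) = carrier_of (antistar L' p)"
proof -
  have acL: "abstract_complex L" and acM: "abstract_complex M" using L M by (simp_all add: realized_abstract)
  \<comment> \<open>Uniqueness of coordinates makes the complementary weight at \<open>p\<close> a
    function of the point, which can then also be evaluated at the vertices of
    \<open>M\<close>.\<close>
  define g where "g x = 1 - (THE c. c \<in> bary_coords L \<and> bary_point c = x) p" for x
  have g: "g (bary_point c) = 1 - c p" if c: "c \<in> bary_coords L" for c
  proof -
    have "(THE d. d \<in> bary_coords L \<and> bary_point d = bary_point c) = c" using c realized_inj[OF L] by (intro the_equality) auto
    then show ?thesis by (simp add: g_def)
  qed
  have gv: "g v = 1 - vertex_coord v p" if "v \<in> \<Union>L" for v
    using g[OF vertex_coord_bary_coords[OF acL that]] by (simp add: bary_sum_vertex_coord)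
  have gp: "g p = 0" using gv[OF p(1)] by (simp add: vertex_coord_def)
  have g1: "g v = 1" if "v \<in> \<Union>L" "v \<noteq> p" for v using gv[OF that(1)] that(2) by (simp add: vertex_coord_def)
  have sw: "simplexwise_affine L g"
    unfolding simplexwise_affine_def
  proof
    fix c assume c: "c \<in> bary_coords L"
    have "bary_sum g c = (1 - c p) * 1"
    proof (rule bary_sum_g_apex[where g = g and p = p, OF acL c gp])
      show "g v = 1" if "c v \<noteq> 0" "v \<noteq> p" for v using that c by (intro g1) (auto simp: bary_coords_def)
    qed
    then show "g (bary_point c) = bary_sum g c" using g[OF c] by simp
  qed
  have gpos: "0 < g v" if v: "v \<in> \<Union>M" "v \<noteq> p" for v
  proof -
    have "v \<in> carrier_of L" using v(1) vertex_in_carrier cM by blast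
    then obtain c where c: "v = bary_point c" "c \<in> bary_coords L" unfolding carrier_coords[OF acL] by blast
    have f: "finite {v. c v \<noteq> 0}" using acL c(2) by (rule bary_coords_finite)
    have nn: "0 \<le> c w" for w using c(2) by (simp add: bary_coords_def)
    have s1: "(\<Sum>w | c w \<noteq> 0. c w) = 1" using c(2) by (simp add: bary_coords_def)
    have "c p < 1"
    proof (rule ccontr)
      assume a: "\<not> c p < 1"
      then have pin: "p \<in> {v. c v \<noteq> 0}" by simp
      have "(\<Sum>w\<in>{v. c v \<noteq> 0} - {p}. c w) = 1 - c p" using sum.remove[OF f pin, of c] s1 by simp
      moreover have "0 \<le> (\<Sum>w\<in>{v. c v \<noteq> 0} - {p}. c w)" using nn by (intro sum_nonneg)
      ultimately have "c p = 1" "(\<Sum>w\<in>{v. c v \<noteq> 0} - {p}. c w) = 0" using a by simp_all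
      then have "\<forall>w\<in>{v. c v \<noteq> 0} - {p}. c w = 0"
        using sum_nonneg_eq_0_iff[of "{v. c v \<noteq> 0} - {p}" c] f nn by simp
      then have "c w = vertex_coord p w" for w using \<open>c p = 1\<close> by (auto simp: vertex_coord_def)
      then have "c = vertex_coord p" by (rule ext)
      then show False using c(1) v(2) by (simp add: bary_sum_vertex_coord)
    qed
    then show ?thesis using g[OF c(2)] c(1) by simp
  qed
  have fM: "finite (\<Union>M)" using acM by (rule abstract_complex_finite_vertices)
  \<comment> \<open>Half of the least value at the vertices of \<open>M\<close> other than
    \<open>p\<close>, so that all of them lie above the level. The inserted 1 does the same for the
    vertices of \<open>L\<close>, where \<open>g\<close> is 1.\<close>
  define e where "e = Min (insert 1 (g ` (\<Union>M - {p}))) / 2"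
  let ?S = "insert 1 (g ` (\<Union>M - {p}))"
  have fS: "finite ?S" using fM by simp
  have "Min ?S \<in> ?S" using fS by (intro Min_in) simp_all
  moreover have "0 < s" if "s \<in> ?S" for s using that gpos by auto
  ultimately have mp: "0 < Min ?S" by blast
  have "Min ?S \<le> 1" using fS by (intro Min_le) simp_all
  then have e: "0 < e" "e < 1" using mp by (simp_all add: e_def)
  have eM: "e < g v" if "v \<in> \<Union>M" "v \<noteq> p" for v
  proof -
    have "g v \<in> ?S" using that by blast
    then have "Min ?S \<le> g v" using fS by (intro Min_le)
    then show ?thesis using mp by (simp add: e_def)
  qed
  have eL: "e < g v" if "v \<in> \<Union>L" "v \<noteq> p" for v using g1[OF that] e by simp
  obtain M' where M': "edge_step\<^sup>*\<^sup>* M M'" "carrier_of (link M' p) = {x \<in> carrier_of L. g x = e}"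
    "carrier_of (antistar M' p) = {x \<in> carrier_of L. e \<le> g x}"
    using gauge_cut[OF L M r cM p e sw gp g1 eM] by blast
  obtain L' where L': "edge_step\<^sup>*\<^sup>* L L'" "carrier_of (link L' p) = {x \<in> carrier_of L. g x = e}"
    "carrier_of (antistar L' p) = {x \<in> carrier_of L. e \<le> g x}"
    using gauge_cut[OF L L refines_refl refl p(1) p(1) e sw gp g1 eL] by blast
  show ?thesis using M' L' by (intro exI[of _ M'] exI[of _ L']) simp
qed

section \<open>Antistar and link under PL homeomorphisms\<close>

lemma link_image: assumes inj: "inj_on f (\<Union>K)" and u: "u \<in> \<Union>K"
  shows "link ((`) f ` K) (f u) = (`) f ` link K u"
proof (intro equalityI subsetI)
  fix \<tau> assume t: "\<tau> \<in> link ((`) f ` K) (f u)"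
  then have n: "f u \<notin> \<tau>" and "insert (f u) \<tau> \<in> (`) f ` K" by (simp_all add: link_def)
  then obtain \<rho> where r: "\<rho> \<in> K" "insert (f u) \<tau> = f ` \<rho>" by (auto)
  have "f u \<in> f ` \<rho>" using r(2) by blast
  then have ur: "u \<in> \<rho>" using inj_on_image_mem_iff[OF inj u] r(1) by blast
  have "f ` (\<rho> - {u}) = f ` \<rho> - {f u}"
    using inj_on_image_set_diff[OF inj, of \<rho> "{u}"] r(1) u by auto
  also have "\<dots> = \<tau>" using r(2) n by blast
  finally have "\<tau> = f ` (\<rho> - {u})" by simp
  moreover have "\<rho> - {u} \<in> link K u" using r(1) ur by (simp add: link_def insert_absorb)
  ultimately show "\<tau> \<in> (`) f ` link K u" by blast
next
  fix \<tau> assume "\<tau> \<in> (`) f ` link K u"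
  then obtain \<sigma> where s: "\<tau> = f ` \<sigma>" "u \<notin> \<sigma>" "insert u \<sigma> \<in> K" by (auto simp: link_def)
  have "\<sigma> \<subseteq> \<Union>K" using s(3) by blast
  then have "f u \<notin> \<tau>" using inj_on_image_mem_iff[OF inj u] s(1,2) by blast
  moreover have "insert (f u) \<tau> \<in> (`) f ` K" using s(1,3) by (intro image_eqI[of _ _ "insert u \<sigma>"]) simp_all
  ultimately show "\<tau> \<in> link ((`) f ` K) (f u)" by (simp add: link_def)
qed

lemma antistar_image: assumes inj: "inj_on f (\<Union>K)" and u: "u \<in> \<Union>K"
  shows "antistar ((`) f ` K) (f u) = (`) f ` antistar K u"
proof -
  have "f u \<in> f ` \<sigma> \<longleftrightarrow> u \<in> \<sigma>" if "\<sigma> \<in> K" for \<sigma>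
    using inj_on_image_mem_iff[OF inj u, of \<sigma>] that by blast
  then show ?thesis by (auto simp: antistar_def)
qed

lemma pair_iso_image:
  assumes K: "realized K" and M: "realized M" "M = (`) f ` K" and inj: "inj_on f (\<Union>K)" and u: "u \<in> \<Union>K"
  shows "pair_iso K u M (f u)"
proof -
  have ac: "abstract_complex K" using K by (rule realized_abstract)
  have fM: "f u \<in> \<Union>M" using u M(2) by blast
  have iA: "inj_on f (\<Union>(antistar K u))" by (rule inj_on_subset[OF inj Union_mono[OF antistar_subset]])
  have iL: "inj_on f (\<Union>(link K u))" by (rule inj_on_subset[OF inj Union_mono[OF link_subset[OF ac]]])
  have "pl_iso (simp_rel f (antistar K u)) (carrier_of (antistar K u)) (carrier_of (antistar M (f u)))"
    by (rule pl_iso_simp_rel[OF realized_antistar[OF K] realized_antistar[OF M(1)] iA]) (simp add: M(2) antistar_image[OF inj u])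
  moreover have "pl_iso (simp_rel f (link K u)) (carrier_of (link K u)) (carrier_of (link M (f u)))"
    by (rule pl_iso_simp_rel[OF realized_link[OF K u] realized_link[OF M(1) fM] iL]) (simp add: M(2) link_image[OF inj u])
  moreover have "simp_rel f (link K u) \<subseteq> simp_rel f (antistar K u)" by (rule simp_rel_mono[OF link_subset_antistar[OF ac]])
  ultimately show ?thesis unfolding pair_iso_def by blast
qed

text \<open>A simplexwise affine representative carries a subdivision of \<open>K\<close> to a
  triangulation \<open>M\<close> of the carrier of \<open>L\<close> that refines \<open>L\<close>.
  No chain of edge subdivisions from \<open>L\<close> to \<open>M\<close> is claimed; after cutting
  near \<open>p\<close>, their links and antistars have equal carriers.\<close>

lemma common_star_subdivisions:
  fixes K L :: "'v::real_normed_vector set set"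
  assumes K: "realized K" and L: "realized L" and R: "pl_iso R (carrier_of K) (carrier_of L)"
    and u: "u \<in> \<Union>K" and p: "p \<in> \<Union>L" and up: "(u, p) \<in> R"
  shows "\<exists>K' M M' L'. edge_step\<^sup>*\<^sup>* K K' \<and> realized M \<and> carrier_of M = carrier_of L \<and> p \<in> \<Union>M \<and> pair_iso K' u M p \<and>
    edge_step\<^sup>*\<^sup>* M M' \<and> edge_step\<^sup>*\<^sup>* L L' \<and> pair_iso M' p L' p"
proof -
  have acL: "abstract_complex L" using L by (rule realized_abstract)
  obtain K' f where K': "edge_step\<^sup>*\<^sup>* K K'" and fR: "\<forall>c\<in>bary_coords K'. (bary_point c, bary_sum f c) \<in> R"
    and fL: "\<forall>\<sigma>\<in>K'. \<exists>\<tau>\<in>L. f ` \<sigma> \<subseteq> convex hull \<tau>"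
    using pl_iso_simplexwise[OF K R acL] by blast
  have pr: "realized K'" "carrier_of K' = carrier_of K" "\<Union>K \<subseteq> \<Union>K'" using edge_step_rtrancl_props[OF K' K] by simp_all
  have ac: "abstract_complex K'" using pr(1) by (rule realized_abstract)
  have sv: "single_valued R" "single_valued (R\<inverse>)" and D: "Domain R = carrier_of K" "Range R = carrier_of L"
    using R by (simp_all add: pl_iso_def)
  have vR: "(v, f v) \<in> R" if "v \<in> \<Union>K'" for v
    using bspec[OF fR vertex_coord_bary_coords[OF ac that]] by (simp add: bary_sum_vertex_coord)
  have inj: "inj_on f (\<Union>K')"
  proof (rule inj_onI)
    fix v w assume vw: "v \<in> \<Union>K'" "w \<in> \<Union>K'" "f v = f w"
    have "(f v, v) \<in> R\<inverse>" by (rule converseI[OF vR[OF vw(1)]])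
    moreover have "(f v, w) \<in> R\<inverse>" unfolding vw(3) by (rule converseI[OF vR[OF vw(2)]])
    ultimately show "v = w" by (rule single_valuedD[OF sv(2)])
  qed
  define M where "M = (`) f ` K'"
  have acM: "abstract_complex M" unfolding M_def by (rule abstract_image[OF ac])
  have pull: "\<exists>c\<in>bary_coords K'. d = push_coord f (\<Union>K') c \<and> bary_point d = bary_sum f c" if d: "d \<in> bary_coords M" for d
  proof -
    obtain c where c: "c \<in> bary_coords K'" "d = push_coord f (\<Union>K') c" using pull_bary_coords[OF inj] d unfolding M_def by blast
    have "{v. c v \<noteq> 0} \<subseteq> \<Union>K'" using c(1) by (auto simp: bary_coords_def)
    from bary_sum_push_coord[OF inj this, of "\<lambda>v. v"] show ?thesis using c by auto
  qed
  have "inj_on bary_point (bary_coords M)"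
  proof (rule inj_onI)
    fix d e assume de: "d \<in> bary_coords M" "e \<in> bary_coords M" "bary_point d = bary_point e"
    obtain c where c: "c \<in> bary_coords K'" "d = push_coord f (\<Union>K') c" "bary_point d = bary_sum f c" using pull[OF de(1)] by blast
    obtain c' where c': "c' \<in> bary_coords K'" "e = push_coord f (\<Union>K') c'" "bary_point e = bary_sum f c'" using pull[OF de(2)] by blast
    have "(bary_sum f c, bary_point c) \<in> R\<inverse>" "(bary_sum f c, bary_point c') \<in> R\<inverse>"
      using bspec[OF fR c(1)] bspec[OF fR c'(1)] c(3) c'(3) de(3) by simp_all
    then have "bary_point c = bary_point c'" by (rule single_valuedD[OF sv(2)])
    then have "c = c'" using realized_inj[OF pr(1) c(1) c'(1)] by simp
    then show "d = e" using c c' by simp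
  qed
  then have gM: "realized M" using acM by (simp add: realized_def)
  have cM: "carrier_of M = carrier_of L"
  proof (intro equalityI subsetI)
    fix y assume "y \<in> carrier_of M"
    then obtain d where d: "y = bary_point d" "d \<in> bary_coords M" unfolding carrier_coords[OF acM] by blast
    then obtain c where "c \<in> bary_coords K'" "y = bary_sum f c" using pull by metis
    then show "y \<in> carrier_of L" using bspec[OF fR] D(2) by blast
  next
    fix y assume "y \<in> carrier_of L"
    then obtain x where x: "(x, y) \<in> R" using D(2) by blast
    then have "x \<in> carrier_of K'" using D(1) pr(2) by blast
    then obtain c where c: "x = bary_point c" "c \<in> bary_coords K'" unfolding carrier_coords[OF ac] by blast
    have "(x, bary_sum f c) \<in> R" using bspec[OF fR c(2)] c(1) by simp
    with x have y: "y = bary_sum f c" by (rule single_valuedD[OF sv(1)])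
    have "{v. c v \<noteq> 0} \<subseteq> \<Union>K'" using c(2) by (auto simp: bary_coords_def)
    from bary_sum_push_coord[OF inj this, of "\<lambda>v. v"] have "y = bary_point (push_coord f (\<Union>K') c)" using y by simp
    moreover have "push_coord f (\<Union>K') c \<in> bary_coords M" unfolding M_def by (rule push_coord_bary_coords[OF inj c(2)])
    ultimately show "y \<in> carrier_of M" unfolding carrier_coords[OF acM] by blast
  qed
  have rM: "refines M L" unfolding refines_def M_def using fL by blast
  have uK': "u \<in> \<Union>K'" using pr(3) u by (rule subsetD)
  have fu: "f u = p" by (rule single_valuedD[OF sv(1) vR[OF uK'] up])
  have pM: "p \<in> \<Union>M" unfolding M_def fu[symmetric] using uK' by blast
  have i1: "pair_iso K' u M p" using pair_iso_image[OF pr(1) gM M_def inj uK'] fu by simp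
  obtain M' L' where mc: "edge_step\<^sup>*\<^sup>* M M'" "edge_step\<^sup>*\<^sup>* L L'" "carrier_of (link M' p) = carrier_of (link L' p)"
    "carrier_of (antistar M' p) = carrier_of (antistar L' p)"
    using gauge_pair[OF L gM rM cM p pM] by blast
  have "realized M'" "p \<in> \<Union>M'" using edge_step_rtrancl_props[OF mc(1) gM] pM by blast+
  then have "pair_iso M' p L' p" using mc by (intro pair_iso_eq[OF realized_abstract]) simp_all
  then show ?thesis using K' gM cM pM i1 mc(1,2) by blast
qed

text \<open>For links an edge subdivision is always harmless. This part of the comparison does not
  rest on Newman's theorem and is therefore available inside its proof.\<close>

lemma link_inv:
  fixes K L :: "'v::real_normed_vector set set"
  assumes K: "realized K" and L: "realized L" and R: "pl_iso R (carrier_of K) (carrier_of L)"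
    and u: "u \<in> \<Union>K" and p: "p \<in> \<Union>L" and up: "(u, p) \<in> R"
  shows "link_iso K u L p"
proof -
  obtain K' M M' L' where *: "edge_step\<^sup>*\<^sup>* K K'" "realized M" "p \<in> \<Union>M" "pair_iso K' u M p"
    "edge_step\<^sup>*\<^sup>* M M'" "edge_step\<^sup>*\<^sup>* L L'" "pair_iso M' p L' p" using common_star_subdivisions[OF assms] by blast
  show ?thesis
    using link_iso_edge_step_rtrancl[OF *(1) K u] pair_iso_lk[OF *(4)] link_iso_edge_step_rtrancl[OF *(5) *(2,3)]
      pair_iso_lk[OF *(7)] link_iso_sym[OF link_iso_edge_step_rtrancl[OF *(6) L p]] link_iso_trans by metis
qed

text \<open>The comparison runs through subdivisions of \<open>K\<close>, of its image
  \<open>M\<close> and of \<open>L\<close>, and the hypothesis on links is invoked along each of the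
  three chains.\<close>

lemma pair_inv:
  fixes K L :: "V set set"
  assumes K: "realized K" and L: "realized L" and R: "pl_iso R (carrier_of K) (carrier_of L)"
    and u: "u \<in> \<Union>K" and p: "p \<in> \<Union>L" and up: "(u, p) \<in> R"
    and P: "P (carrier_of K)" "P (carrier_of L)"
    and nw: "\<And>L u w. realized L \<Longrightarrow> P (carrier_of L) \<Longrightarrow> {u, w} \<in> L \<Longrightarrow> u \<noteq> w \<Longrightarrow> antistar_cone (link L w) u"
  shows "pair_iso K u L p"
proof -
  obtain K' M M' L' where *: "edge_step\<^sup>*\<^sup>* K K'" "realized M" "p \<in> \<Union>M" "pair_iso K' u M p"
    "edge_step\<^sup>*\<^sup>* M M'" "edge_step\<^sup>*\<^sup>* L L'" "pair_iso M' p L' p" "carrier_of M = carrier_of L"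
    using common_star_subdivisions[OF K L R u p up] by blast
  have PM: "P (carrier_of M)" using P(2) *(8) by simp
  have "pair_iso K u K' u" by (rule pair_iso_edge_step_rtrancl[where P = P, OF *(1) K u P(1) nw])
  moreover have "pair_iso M p M' p" by (rule pair_iso_edge_step_rtrancl[where P = P, OF *(5) *(2,3) PM nw])
  moreover have "pair_iso L p L' p" by (rule pair_iso_edge_step_rtrancl[where P = P, OF *(6) L p P(2) nw])
  ultimately show ?thesis using *(4,7) pair_iso_trans pair_iso_sym by metis
qed

abbreviation basis_vec :: "'a \<Rightarrow> 'a \<Rightarrow>\<^sub>0 real" where
  "basis_vec v \<equiv> Poly_Mapping.single v 1"

section \<open>Spheres\<close>

lemma basis_vec_inj: "basis_vec v = basis_vec w \<longleftrightarrow> v = w"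
  by (metis lookup_single_eq lookup_single_not_eq zero_neq_one)

text \<open>The weight at a basis vector is the corresponding entry of the point, so coordinates are
  read off by \<open>lookup\<close>.\<close>

lemma basis_realized:
  fixes K :: "('a \<Rightarrow>\<^sub>0 real) set set"
  assumes ac: "abstract_complex K" and K: "\<Union>K \<subseteq> range basis_vec"
  shows "realized K"
proof -
  have key: "Poly_Mapping.lookup (bary_point c) v = c (basis_vec v)" if c: "c \<in> bary_coords K" for c v
  proof -
    have f: "finite {w. c w \<noteq> 0}" using ac c by (rule bary_coords_finite)
    have "Poly_Mapping.lookup (bary_point c) v = (\<Sum>w | c w \<noteq> 0. c w * Poly_Mapping.lookup w v)"
      unfolding bary_sum_def by (simp add: linear_sum[OF lookup_linear] lookup_scaleR)
    also have "\<dots> = (\<Sum>w | c w \<noteq> 0. if w = basis_vec v then c w else 0)"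
    proof (rule sum.cong[OF refl])
      fix w assume "w \<in> {w. c w \<noteq> 0}"
      then have "w \<in> \<Union>K" using c by (auto simp: bary_coords_def)
      then have "w \<in> range basis_vec" using K by (rule subsetD[rotated])
      then obtain v' where w: "w = basis_vec v'" by (rule rangeE)
      show "c w * Poly_Mapping.lookup w v = (if w = basis_vec v then c w else 0)"
        unfolding w basis_vec_inj by (simp add: lookup_single when_def)
    qed
    also have "\<dots> = c (basis_vec v)" using f by (simp add: sum.delta)
    finally show ?thesis .
  qed
  have "inj_on bary_point (bary_coords K)"
  proof (rule inj_onI)
    fix c d assume cd: "c \<in> bary_coords K" "d \<in> bary_coords K" "bary_point c = bary_point d"
    show "c = d"
    proof
      fix w show "c w = d w"
      proof (cases "w \<in> range basis_vec")
        case True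
        then obtain v where "w = basis_vec v" by (rule rangeE)
        then show ?thesis using key[OF cd(1), of v] key[OF cd(2), of v] cd(3) by simp
      next
        case False
        have z: "c w = 0" if c: "c \<in> bary_coords K" for c
        proof (rule ccontr)
          assume "c w \<noteq> 0"
          then have "w \<in> \<Union>K" using c by (auto simp: bary_coords_def)
          then show False using K False by blast
        qed
        show ?thesis unfolding z[OF cd(1)] z[OF cd(2)] ..
      qed
    qed
  qed
  then show ?thesis using ac by (simp add: realized_def)
qed

section \<open>Boundaries of simplices and their joins\<close>

definition bdry :: "'v set \<Rightarrow> 'v set set" where
  "bdry W = {\<sigma>. \<sigma> \<subset> W}"

lemma abstract_bdry: assumes "finite W" "W \<noteq> {}" shows "abstract_complex (bdry W)"
proof (rule abstract_complexI)
  show "finite (bdry W)" by (rule finite_subset[of _ "Pow W"]) (auto simp: bdry_def assms)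
  show "{} \<in> bdry W" using assms(2) by (auto simp: bdry_def)
  show "finite \<sigma>" if "\<sigma> \<in> bdry W" for \<sigma> using that assms(1) finite_subset by (auto simp: bdry_def)
  show "\<tau> \<in> bdry W" if "\<sigma> \<in> bdry W" "\<tau> \<subseteq> \<sigma>" for \<sigma> \<tau> using that by (auto simp: bdry_def)
qed

lemma image_bdry: assumes "inj_on b W" shows "(`) b ` bdry W = bdry (b ` W)"
proof (intro equalityI subsetI)
  fix \<tau> assume "\<tau> \<in> (`) b ` bdry W"
  then obtain \<sigma> where s: "\<tau> = b ` \<sigma>" "\<sigma> \<subset> W" by (auto simp: bdry_def)
  then have "b ` \<sigma> \<noteq> b ` W" using inj_on_image_eq_iff[OF assms, of \<sigma> W] by blast
  then show "\<tau> \<in> bdry (b ` W)" using s by (auto simp: bdry_def)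
next
  fix \<tau> assume t: "\<tau> \<in> bdry (b ` W)"
  then obtain \<sigma> where s: "\<sigma> \<subseteq> W" "\<tau> = b ` \<sigma>" unfolding bdry_def by (metis mem_Collect_eq psubsetE subset_imageE)
  then have "\<sigma> \<noteq> W" using t by (auto simp: bdry_def)
  then show "\<tau> \<in> (`) b ` bdry W" using s by (auto simp: bdry_def)
qed

lemma Union_bdry: "\<Union>(bdry W) \<subseteq> W" by (auto simp: bdry_def)

text \<open>The index is the number of vertices, that is the dimension plus two. For
  \<open>n = 1\<close> the complex is \<open>{{}}\<close>, the sphere of dimension -1, which occurs
  as the link of a vertex in a 0-sphere.\<close>

definition model_sphere :: "nat \<Rightarrow> V set set" where
  "model_sphere n = bdry (basis_vec ` {..<n})"

definition pl_sphere :: "nat \<Rightarrow> 'v::real_normed_vector set \<Rightarrow> bool" where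
  "pl_sphere n X \<longleftrightarrow> (\<exists>R. pl_iso R X (carrier_of (model_sphere n)))"

lemma pl_sphere_pl_iso: "pl_iso R X Y \<Longrightarrow> pl_sphere n Y \<Longrightarrow> pl_sphere n X"
  unfolding pl_sphere_def using pl_iso_relcomp by blast

lemma realized_bdry: "finite W \<Longrightarrow> W \<noteq> {} \<Longrightarrow> W \<subseteq> range basis_vec \<Longrightarrow> realized (bdry W)"
  by (rule basis_realized[OF abstract_bdry subset_trans[OF Union_bdry]])

lemma pl_sphere_bdry:
  assumes "realized (bdry W)" "finite W" "W \<noteq> {}" "card W = n"
  shows "pl_sphere n (carrier_of (bdry W))"
proof -
  have "card (basis_vec ` {..<n}) = n" by (subst card_image) (auto simp: inj_on_def basis_vec_inj)
  then obtain b where b: "bij_betw b W (basis_vec ` {..<n} :: V set)"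
    using finite_same_card_bij[OF assms(2), of "basis_vec ` {..<n}"] assms(4) by auto
  have n: "0 < n" using assms(2-4) by (auto simp: card_gt_0_iff)
  have g: "realized (model_sphere n)" unfolding model_sphere_def using n by (intro realized_bdry) auto
  have inj: "inj_on b W" and im: "b ` W = basis_vec ` {..<n}" using b by (simp_all add: bij_betw_def)
  have "pl_iso (simp_rel b (bdry W)) (carrier_of (bdry W)) (carrier_of (model_sphere n))"
    by (rule pl_iso_simp_rel[OF assms(1) g inj_on_subset[OF inj Union_bdry]]) (simp add: image_bdry[OF inj] im model_sphere_def)
  then show ?thesis unfolding pl_sphere_def by blast
qed

text \<open>For disjoint \<phi> and \<psi> this is \<partial>\<phi> * \<partial>\<psi>. If \<psi> is
  a single vertex, its boundary is the unit \<open>{{}}\<close> of the join and only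
  \<partial>\<phi> remains.\<close>

definition bdry_join :: "'v set \<Rightarrow> 'v set \<Rightarrow> 'v set set" where
  "bdry_join \<phi> \<psi> = {\<sigma>. \<sigma> \<subseteq> \<phi> \<union> \<psi> \<and> \<not> \<phi> \<subseteq> \<sigma> \<and> \<not> \<psi> \<subseteq> \<sigma>}"

lemma bdry_join_sym: "bdry_join \<phi> \<psi> = bdry_join \<psi> \<phi>" by (auto simp: bdry_join_def)

lemma bdry_join_singleton: "\<phi> \<inter> {z} = {} \<Longrightarrow> bdry_join \<phi> {z} = bdry \<phi>"
  by (auto simp: bdry_join_def bdry_def)

lemma abstract_bdry_join:
  assumes "finite \<phi>" "finite \<psi>" "\<phi> \<noteq> {}" "\<psi> \<noteq> {}" shows "abstract_complex (bdry_join \<phi> \<psi>)"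
proof (rule abstract_complexI)
  show "finite (bdry_join \<phi> \<psi>)" by (rule finite_subset[of _ "Pow (\<phi> \<union> \<psi>)"]) (auto simp: bdry_join_def assms)
  show "{} \<in> bdry_join \<phi> \<psi>" using assms by (auto simp: bdry_join_def)
  show "finite \<sigma>" if "\<sigma> \<in> bdry_join \<phi> \<psi>" for \<sigma>
    using that assms finite_subset[of \<sigma> "\<phi> \<union> \<psi>"] by (simp add: bdry_join_def)
  show "\<tau> \<in> bdry_join \<phi> \<psi>" if "\<sigma> \<in> bdry_join \<phi> \<psi>" "\<tau> \<subseteq> \<sigma>" for \<sigma> \<tau> using that by (auto simp: bdry_join_def)
qed

lemma uniform_coords:
  assumes "abstract_complex K" "\<phi> \<in> K" "\<phi> \<noteq> {}"
  shows "\<exists>l\<in>bary_coords K. {v. l v \<noteq> 0} = \<phi>"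
proof -
  have f: "finite \<phi>" using assms(1,2) by (rule abstract_complex_finite)
  have n: "card \<phi> \<noteq> 0" using f assms(3) by simp
  let ?l = "\<lambda>v. if v \<in> \<phi> then 1 / real (card \<phi>) else 0"
  have "?l \<in> bary_coords K" using n by (intro bary_coordsI[OF assms(1,2)]) auto
  moreover have "{v. ?l v \<noteq> 0} = \<phi>" using n by auto
  ultimately show ?thesis by (rule bexI[of "\<lambda>l. {v. l v \<noteq> 0} = \<phi>" ?l, rotated])
qed

lemma general_stellar:
  assumes "realized K" "l \<in> bary_coords K"
  shows "realized (stellar K {v. l v \<noteq> 0} (bary_point l))" "carrier_of (stellar K {v. l v \<noteq> 0} (bary_point l)) = carrier_of K"
    "bary_point l \<in> \<Union>K \<Longrightarrow> {v. l v \<noteq> 0} = {bary_point l}"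
proof -
  interpret stellar_point K l by unfold_locales (fact assms)+
  show "realized (stellar K {v. l v \<noteq> 0} (bary_point l))" "carrier_of (stellar K {v. l v \<noteq> 0} (bary_point l)) = carrier_of K"
    "bary_point l \<in> \<Union>K \<Longrightarrow> {v. l v \<noteq> 0} = {bary_point l}"
    using stellar_realized stellar_carrier p_vertex(2) unfolding \<phi>_def p_def by blast+
qed

text \<open>If \<open>z \<in> \<psi>\<close>, then \<open>\<partial>\<phi> * \<partial>\<psi>\<close> is the boundary of the simplex \<open>\<phi> \<union> \<psi> - {z}\<close> starred at an interior
  point of \<open>\<phi>\<close>, with \<open>z\<close> as the new vertex.\<close>

lemma pl_sphere_bdry_join:
  fixes \<phi> \<psi> :: "V set"
  assumes E: "\<phi> \<subseteq> range basis_vec" "\<psi> \<subseteq> range basis_vec" and f: "finite \<phi>" "finite \<psi>" and ne: "\<phi> \<noteq> {}" "\<psi> \<noteq> {}"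
    and dis: "\<phi> \<inter> \<psi> = {}" and n: "card \<phi> + card \<psi> = Suc n"
  shows "pl_sphere n (carrier_of (bdry_join \<phi> \<psi>))"
proof -
  have single: "pl_sphere n (carrier_of (bdry_join \<phi> {z}))"
    if "\<phi> \<subseteq> range basis_vec" "finite \<phi>" "\<phi> \<noteq> {}" "z \<notin> \<phi>" "card \<phi> = n" for \<phi> :: "V set" and z
    using pl_sphere_bdry[OF realized_bdry[OF that(2,3,1)] that(2,3,5)] bdry_join_singleton[of \<phi> z] that(4) by simp
  \<comment> \<open>If \<psi> is a single vertex, \<phi> would be the whole simplex and no face; if
    \<phi> is one, starring it creates no new vertex. In both cases the join is merely the boundary
    of the other simplex.\<close>
  consider (a) z where "\<psi> = {z}" | (b) z where "\<phi> = {z}" | (c) "\<And>z. \<psi> \<noteq> {z}" "\<And>z. \<phi> \<noteq> {z}" by blast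
  then show ?thesis
  proof cases
    case (a z)
    then show ?thesis using single[OF E(1) f(1) ne(1), of z] dis n by simp
  next
    case (b z)
    then show ?thesis using single[OF E(2) f(2) ne(2), of z] dis n by (simp add: bdry_join_sym)
  next
    case c
    obtain z where z: "z \<in> \<psi>" using ne(2) by blast
    define \<psi>' where "\<psi>' = \<psi> - {z}"
    have ps': "\<psi>' \<noteq> {}" "\<psi> = insert z \<psi>'" "z \<notin> \<psi>'" using c(1)[of z] z by (auto simp: \<psi>'_def)
    define W where "W = \<phi> \<union> \<psi>'"
    have fW: "finite W" "W \<noteq> {}" "W \<subseteq> range basis_vec" using f ne E by (auto simp: W_def \<psi>'_def)
    have zW: "z \<notin> W" using z dis ps'(3) by (auto simp: W_def)
    have "card W = card \<phi> + card \<psi>'" unfolding W_def using f dis by (intro card_Un_disjoint) (auto simp: \<psi>'_def)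
    moreover have "card \<psi> = Suc (card \<psi>')" using f(2) ps'(3) unfolding ps'(2) by (intro card_insert_disjoint) simp_all
    ultimately have cW: "card W = n" using n by simp
    define K where "K = bdry W"
    have K: "realized K" unfolding K_def by (rule realized_bdry[OF fW])
    have ac: "abstract_complex K" using K by (rule realized_abstract)
    have "\<phi> \<in> K" using ps'(1) dis by (auto simp: K_def bdry_def W_def \<psi>'_def)
    then obtain l where l: "l \<in> bary_coords K" "{v. l v \<noteq> 0} = \<phi>" using uniform_coords[OF ac _ ne(1)] by blast
    define p where "p = bary_point l"
    note st = general_stellar[OF K l(1), unfolded l(2), folded p_def]
    have pK: "p \<notin> \<Union>K" using st(3) c(2) by blast
    have WK: "W \<subseteq> \<Union>K"
    proof
      fix w assume w: "w \<in> W"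
      have "W \<noteq> {w}" using c(2)[of w] ne(1) ps'(1) dis by (auto simp: W_def \<psi>'_def)
      then have "{w} \<in> K" using w by (auto simp: K_def bdry_def)
      then show "w \<in> \<Union>K" by blast
    qed
    have pW: "p \<notin> W" using pK WK by blast
    have pz: "p \<noteq> z"
    proof
      assume "p = z"
      \<comment> \<open>In the full simplex on \<open>W\<close> and \<open>z\<close> the point
        \<open>p\<close> has coordinates with support \<phi>, which distinguishes it from the vertex
        \<open>z\<close>.\<close>
      let ?F = "Pow (insert z W)"
      have acF: "abstract_complex ?F"
        by (rule abstract_complexI) (use fW in \<open>auto intro: finite_subset\<close>)
      have gF: "realized ?F" by (rule basis_realized[OF acF]) (use fW(3) E z in auto)
      have "K \<subseteq> ?F" by (auto simp: K_def bdry_def)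
      then have "l \<in> bary_coords ?F" using l(1) bary_coords_mono by blast
      moreover have "vertex_coord z \<in> bary_coords ?F" by (rule vertex_coord_bary_coords[OF acF]) blast
      moreover have "bary_point l = bary_point (vertex_coord z)" using \<open>p = z\<close> by (simp add: p_def bary_sum_vertex_coord)
      ultimately have "l = vertex_coord z" by (rule realized_inj[OF gF])
      then have "\<phi> = {z}" unfolding l(2)[symmetric] by (auto simp: vertex_coord_def)
      then show False using c(2) by blast
    qed
    have fJ: "realized (bdry_join \<phi> \<psi>)"
      by (rule basis_realized[OF abstract_bdry_join[OF f ne]]) (use E in \<open>auto simp: bdry_join_def\<close>)
    have zS: "z \<notin> \<Union>(stellar K \<phi> p)" using zW pz by (auto simp: stellar_def K_def bdry_def)
    have "\<tau> \<in> bdry_join \<phi> \<psi> \<longleftrightarrow> p \<notin> \<tau> \<and> (if z \<in> \<tau> then insert p (\<tau> - {z}) else \<tau>) \<in> stellar K \<phi> p" for \<tau>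
    proof (cases "p \<in> \<tau>")
      case True
      have "p \<notin> \<phi> \<union> \<psi>" using pW pz ps'(2) by (auto simp: W_def)
      then show ?thesis using True by (auto simp: bdry_join_def)
    next
      case F: False
      show ?thesis
      proof (cases "z \<in> \<tau>")
        case True
        have e: "insert p (\<tau> - {z}) - {p} = \<tau> - {z}" using F by blast
        have "\<tau> \<in> bdry_join \<phi> \<psi> \<longleftrightarrow> \<tau> - {z} \<subseteq> W \<and> \<not> \<phi> \<subseteq> \<tau> - {z} \<and> \<not> \<psi>' \<subseteq> \<tau> - {z}"
          using True z dis by (auto simp: bdry_join_def W_def \<psi>'_def)
        also have "\<dots> \<longleftrightarrow> \<tau> - {z} \<subset> W \<and> \<not> \<phi> \<subseteq> \<tau> - {z} \<and> (\<tau> - {z}) \<union> \<phi> \<subset> W"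
          using dis by (auto simp: W_def \<psi>'_def)
        finally show ?thesis using True F e by (simp add: stellar_def K_def bdry_def)
      next
        case False
        have e: "\<tau> - {p} = \<tau>" using F by blast
        have "\<tau> \<in> bdry_join \<phi> \<psi> \<longleftrightarrow> \<tau> \<subset> W \<and> \<not> \<phi> \<subseteq> \<tau>"
          using False z dis by (auto simp: bdry_join_def W_def \<psi>'_def)
        then show ?thesis using False F e by (simp add: stellar_def K_def bdry_def)
      qed
    qed
    from pl_iso_rename[OF st(1) fJ pz zS this] st(2)
    have "pl_iso (simp_rel (id(p := z)) (stellar K \<phi> p)) (carrier_of K) (carrier_of (bdry_join \<phi> \<psi>))" by simp
    moreover have "pl_sphere n (carrier_of K)" unfolding K_def by (rule pl_sphere_bdry[OF realized_bdry[OF fW] fW(1,2) cW])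
    ultimately show ?thesis using pl_sphere_pl_iso pl_iso_converse by blast
  qed
qed

text \<open>The complex \<open>L\<close> is the boundary of a simplex starred at \<open>p\<close>. The antistar of \<open>p\<close> is \<open>\<partial>\<phi> * \<psi>\<close>, so
  starring \<open>\<psi>\<close> at an interior point exhibits it as a cone over \<open>\<partial>\<phi> * \<partial>\<psi>\<close>.\<close>

lemma sphere_model:
  fixes X :: "'v::real_normed_vector set"
  assumes R: "pl_iso R X (carrier_of (model_sphere n))" and u: "u \<in> X"
  obtains \<phi> \<psi> p L where "(u, p) \<in> R" "realized L" "carrier_of L = carrier_of (model_sphere n)" "p \<in> \<Union>L"
    "\<phi> \<subseteq> range basis_vec" "\<psi> \<subseteq> range basis_vec" "finite \<phi>" "finite \<psi>" "\<phi> \<noteq> {}" "\<psi> \<noteq> {}" "\<phi> \<inter> \<psi> = {}"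
    "card \<phi> + card \<psi> = n" "link L p = bdry_join \<phi> \<psi>" "antistar_cone L p"
proof -
  let ?W = "basis_vec ` {..<n} :: V set"
  have "u \<in> Domain R" using R u by (simp add: pl_iso_def)
  then obtain p where up: "(u, p) \<in> R" by blast
  have pm: "p \<in> carrier_of (model_sphere n)" using R up unfolding pl_iso_def by blast
  then obtain \<sigma> where "\<sigma> \<in> model_sphere n" by (auto simp: carrier_of_def)
  then have W: "finite ?W" "?W \<noteq> {}" "?W \<subseteq> range basis_vec" by (auto simp: model_sphere_def bdry_def)
  have g: "realized (model_sphere n)" unfolding model_sphere_def by (rule realized_bdry[OF W])
  have ac: "abstract_complex (model_sphere n)" using g by (rule realized_abstract)
  obtain l where l: "p = bary_point l" "l \<in> bary_coords (model_sphere n)" using pm unfolding carrier_coords[OF ac] by blast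
  \<comment> \<open>The point \<open>p\<close> that corresponds to \<open>u\<close> lies in the
    interior of \<phi>, and \<psi> is the complementary face.\<close>
  define \<phi> where "\<phi> = {v. l v \<noteq> 0}"
  define \<psi> where "\<psi> = ?W - \<phi>"
  have ph: "\<phi> \<in> model_sphere n" using l(2) by (simp add: \<phi>_def bary_coords_def)
  have "(\<Sum>v\<in>\<phi>. l v) = 1" using l(2) by (simp add: \<phi>_def bary_coords_def)
  then have ne: "\<phi> \<noteq> {}" by (metis sum.empty zero_neq_one)
  have ps: "\<psi> \<noteq> {}" "\<phi> \<union> \<psi> = ?W" "\<phi> \<inter> \<psi> = {}" using ph by (auto simp: \<psi>_def model_sphere_def bdry_def)
  have sub: "\<phi> \<subseteq> ?W" "\<psi> \<subseteq> ?W" using ps(2) by blast+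
  have f: "finite \<phi>" "finite \<psi>" using sub W(1) finite_subset by blast+
  have E: "\<phi> \<subseteq> range basis_vec" "\<psi> \<subseteq> range basis_vec" using sub W(3) by blast+
  have "card \<phi> + card \<psi> = card ?W" using card_Un_disjoint[OF f ps(3)] ps(2) by simp
  also have "\<dots> = n" by (subst card_image) (auto simp: inj_on_def basis_vec_inj)
  finally have card: "card \<phi> + card \<psi> = n" .
  define L where "L = stellar (model_sphere n) \<phi> p"
  note st = general_stellar[OF g l(2), folded \<phi>_def l(1), folded L_def]
  have acL: "abstract_complex L" using st(1) by (rule realized_abstract)
  have m_iff: "\<sigma> \<in> model_sphere n \<longleftrightarrow> \<sigma> \<subset> ?W" for \<sigma> by (simp add: model_sphere_def bdry_def)
  have WK: "?W \<subseteq> \<Union>(model_sphere n)"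
  proof
    fix w assume w: "w \<in> ?W"
    have "?W \<noteq> {w}"
    proof
      assume e: "?W = {w}"
      have "\<phi> \<subseteq> {w}" "\<psi> \<subseteq> {w}" using sub unfolding e by simp_all
      then show False using ne ps(1,3) by blast
    qed
    then have "{w} \<in> model_sphere n" unfolding m_iff using w by blast
    then show "w \<in> \<Union>(model_sphere n)" by blast
  qed
  have pphi: "\<phi> = {p}" if "p \<in> ?W" using st(3) WK that by blast
  have pL: "p \<in> \<Union>L"
  proof -
    have "{p} \<in> L" unfolding L_def stellar_def using abstract_complexD(2)[OF ac] ne ph by simp
    then show ?thesis by blast
  qed
  have lk: "link L p = bdry_join \<phi> \<psi>"
  proof (rule set_eqI)
    fix \<sigma> show "\<sigma> \<in> link L p \<longleftrightarrow> \<sigma> \<in> bdry_join \<phi> \<psi>"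
    proof (cases "p \<in> \<sigma>")
      case True
      have "\<sigma> \<notin> bdry_join \<phi> \<psi>"
      proof
        assume s: "\<sigma> \<in> bdry_join \<phi> \<psi>"
        then have "p \<in> ?W" using True ps(2) by (auto simp: bdry_join_def)
        then show False using pphi s True by (auto simp: bdry_join_def)
      qed
      then show ?thesis using True by (simp add: link_def)
    next
      case False
      then have "insert p \<sigma> - {p} = \<sigma>" by blast
      then have "\<sigma> \<in> link L p \<longleftrightarrow> \<sigma> \<subset> ?W \<and> \<not> \<phi> \<subseteq> \<sigma> \<and> \<sigma> \<union> \<phi> \<subset> ?W"
        using False by (simp add: link_def L_def stellar_def m_iff)
      also have "\<dots> \<longleftrightarrow> \<sigma> \<in> bdry_join \<phi> \<psi>" using ps(2,3) unfolding bdry_join_def by blast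
      finally show ?thesis .
    qed
  qed
  \<comment> \<open>A set of vertices that does not contain \<phi> is automatically proper, so the
    antistar consists of the faces of \<partial>\<phi> * \<psi>.\<close>
  have A_iff: "\<sigma> \<in> antistar L p \<longleftrightarrow> \<sigma> \<subseteq> ?W \<and> \<not> \<phi> \<subseteq> \<sigma>" for \<sigma>
  proof (cases "p \<in> \<sigma>")
    case True
    then show ?thesis using pphi by (auto simp: antistar_def)
  next
    case False
    then have "\<sigma> - {p} = \<sigma>" by blast
    then have "\<sigma> \<in> antistar L p \<longleftrightarrow> \<sigma> \<subset> ?W \<and> \<not> \<phi> \<subseteq> \<sigma>" using False by (simp add: antistar_def L_def stellar_def m_iff)
    then show ?thesis using sub(1) by blast
  qed
  define A where "A = antistar L p"
  define Q where "Q = bdry_join \<phi> \<psi>"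
  have gA: "realized A" unfolding A_def by (rule realized_antistar[OF st(1)])
  have acA: "abstract_complex A" using gA by (rule realized_abstract)
  have acQ: "abstract_complex Q" unfolding Q_def by (rule abstract_bdry_join[OF f ne ps(1)])
  have psA: "\<psi> \<in> A" unfolding A_def A_iff using sub(2) ne ps(3) by blast
  obtain l2 where l2: "l2 \<in> bary_coords A" "{v. l2 v \<noteq> 0} = \<psi>" using uniform_coords[OF acA psA ps(1)] by blast
  define q where "q = bary_point l2"
  note st2 = general_stellar[OF gA l2(1), unfolded l2(2), folded q_def]
  have cs: "stellar A \<psi> q = cone_complex q Q"
  proof (rule set_eqI)
    fix \<tau>
    have "\<tau> \<in> stellar A \<psi> q \<longleftrightarrow> (\<tau> - {q} \<subseteq> ?W \<and> \<not> \<phi> \<subseteq> \<tau> - {q}) \<and> \<not> \<psi> \<subseteq> \<tau> - {q} \<and>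
        (q \<in> \<tau> \<longrightarrow> (\<tau> - {q}) \<union> \<psi> \<subseteq> ?W \<and> \<not> \<phi> \<subseteq> (\<tau> - {q}) \<union> \<psi>)"
      unfolding stellar_def A_def mem_Collect_eq A_iff ..
    also have "\<dots> \<longleftrightarrow> \<tau> - {q} \<subseteq> ?W \<and> \<not> \<phi> \<subseteq> \<tau> - {q} \<and> \<not> \<psi> \<subseteq> \<tau> - {q}"
      using sub(2) ps(3) by blast
    also have "\<dots> \<longleftrightarrow> \<tau> \<in> cone_complex q Q" unfolding cone_complex_def Q_def bdry_join_def ps(2) by simp
    finally show "\<tau> \<in> stellar A \<psi> q \<longleftrightarrow> \<tau> \<in> cone_complex q Q" .
  qed
  have pQ: "p \<notin> \<Union>Q" unfolding Q_def lk[symmetric] by (rule apex_not_in_link)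
  have qQ: "q \<notin> \<Union>Q"
  proof
    assume "q \<in> \<Union>Q"
    then obtain \<sigma> where s: "\<sigma> \<in> Q" "q \<in> \<sigma>" by blast
    have "\<sigma> \<in> A" using s(1) unfolding A_def A_iff Q_def bdry_join_def ps(2) by simp
    then have "\<psi> = {q}" using st2(3) s(2) by blast
    then show False using s by (simp add: Q_def bdry_join_def)
  qed
  \<comment> \<open>Otherwise a single point of the model sphere would have both \<phi> and \<psi>
    as its support.\<close>
  have qp: "q \<noteq> p"
  proof
    assume "q = p"
    then have e: "bary_point l2 = bary_point l" using l(1) q_def by simp
    have "\<psi> \<in> model_sphere n" unfolding m_iff using sub ne ps(3) by blast
    then have "l2 \<in> bary_coords (model_sphere n)" using l2 by (simp add: bary_coords_def)
    then have "l2 = l" using l(2) e by (rule realized_inj[OF g])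
    then have "\<psi> = \<phi>" using l2(2) by (simp add: \<phi>_def)
    then show False using ne ps(3) by blast
  qed
  have "cone_complex p Q \<subseteq> L" unfolding Q_def lk[symmetric] by (rule cone_complex_link_subset[OF acL])
  from realized_subcomplex[OF st(1) this abstract_cone_complex[OF acQ]] have gp: "realized (cone_complex p Q)" .
  have gq: "realized (cone_complex q Q)" using st2(1) unfolding cs .
  note ren = pl_iso_rename_apex[OF acQ qQ pQ qp gq gp]
  have "carrier_of (cone_complex q Q) = carrier_of A" using st2(2) unfolding cs .
  then have "antistar_cone L p" unfolding antistar_cone_def using ren unfolding A_def Q_def lk by metis
  then show thesis
    by (rule that[OF up st(1,2) pL E f ne ps(1) ps(3) card lk])
qed

text \<open>Links are invariant, so it is enough to look at the model triangulation, where the link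
  is \<partial>\<phi> * \<partial>\<psi>. That \<phi> and \<psi> are nonempty gives the bound on
  \<open>n\<close>.\<close>

lemma link_sphere:
  fixes K :: "V set set"
  assumes K: "realized K" and S: "pl_sphere n (carrier_of K)" and u: "u \<in> \<Union>K"
  shows "2 \<le> n" "pl_sphere (n - 1) (carrier_of (link K u))"
proof -
  obtain R where R: "pl_iso R (carrier_of K) (carrier_of (model_sphere n))" using S unfolding pl_sphere_def by blast
  have "u \<in> carrier_of K" using u vertex_in_carrier by blast
  from sphere_model[OF R this] obtain \<phi> \<psi> p L where
    *: "(u, p) \<in> R" "realized L" "carrier_of L = carrier_of (model_sphere n)" "p \<in> \<Union>L"
    "\<phi> \<subseteq> range basis_vec" "\<psi> \<subseteq> range basis_vec" "finite \<phi>" "finite \<psi>" "\<phi> \<noteq> {}" "\<psi> \<noteq> {}" "\<phi> \<inter> \<psi> = {}"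
    "card \<phi> + card \<psi> = n" "link L p = bdry_join \<phi> \<psi>" by metis
  have "0 < card \<phi>" "0 < card \<psi>" using *(7-10) by (simp_all add: card_gt_0_iff)
  then show n: "2 \<le> n" using *(12) by simp
  then have "card \<phi> + card \<psi> = Suc (n - 1)" using *(12) by simp
  then have "pl_sphere (n - 1) (carrier_of (link L p))"
    unfolding *(13) by (rule pl_sphere_bdry_join[OF *(5-11)])
  moreover have "link_iso K u L p" using R *(3) by (intro link_inv[OF K *(2) _ u *(4) *(1)]) simp
  ultimately show "pl_sphere (n - 1) (carrier_of (link K u))" unfolding link_iso_def using pl_sphere_pl_iso by blast
qed

text \<open>The way through \<open>R\<close> and \<open>h\<close> moves a point of the link of
  \<open>u\<close> to its image under \<open>G\<close>. Coning the inverse of \<open>G\<close> leads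
  back to the cone with apex \<open>u\<close> and undoes this motion.\<close>

lemma antistar_cone_transfer:
  assumes K: "realized K" "u \<in> \<Union>K" and L: "realized L" "p \<in> \<Union>L" and pr: "pair_iso K u L p" and N: "antistar_cone L p"
  shows "antistar_cone K u"
proof -
  have ac: "abstract_complex K" "abstract_complex L" using K L by (simp_all add: realized_abstract)
  have al: "abstract_complex (link K u)" "abstract_complex (link L p)"
    by (rule abstract_link[OF ac(1) K(2)], rule abstract_link[OF ac(2) L(2)])
  obtain R G where R: "pl_iso R (carrier_of (antistar K u)) (carrier_of (antistar L p))"
    and G: "pl_iso G (carrier_of (link K u)) (carrier_of (link L p))" "G \<subseteq> R" using pr unfolding pair_iso_def by blast
  obtain h where h: "pl_iso h (carrier_of (antistar L p)) (carrier_of (cone_complex p (link L p)))"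
    "Id_on (carrier_of (link L p)) \<subseteq> h" using N unfolding antistar_cone_def by blast
  have g1: "realized (cone_complex u (link K u))"
    by (rule realized_subcomplex[OF K(1) cone_complex_link_subset[OF ac(1)] abstract_cone_complex[OF al(1)]])
  have g2: "realized (cone_complex p (link L p))"
    by (rule realized_subcomplex[OF L(1) cone_complex_link_subset[OF ac(2)] abstract_cone_complex[OF al(2)]])
  have C: "pl_iso (cone_rel p u (G\<inverse>)) (carrier_of (cone_complex p (link L p))) (carrier_of (cone_complex u (link K u)))"
    unfolding carrier_cone_complex[OF al(1) apex_not_in_link] carrier_cone_complex[OF al(2) apex_not_in_link]
    by (rule pl_iso_cone_rel[OF pl_iso_converse[OF G(1)] realized_cone_pos[OF g2 al(2) apex_not_in_link] realized_cone_pos[OF g1 al(1) apex_not_in_link]])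
  have "Id_on (carrier_of (link K u)) \<subseteq> R O h O cone_rel p u (G\<inverse>)"
  proof
    fix q assume "q \<in> Id_on (carrier_of (link K u))"
    then obtain x where x: "q = (x, x)" "x \<in> carrier_of (link K u)" by auto
    have D: "Domain G = carrier_of (link K u)" "Range G = carrier_of (link L p)" using G(1) by (simp_all add: pl_iso_def)
    obtain y where y: "(x, y) \<in> G" using x(2) D(1) by blast
    then have "(y, y) \<in> h" using D(2) h(2) by blast
    moreover have "(y, x) \<in> cone_rel p u (G\<inverse>)" using y cone_rel_superset by blast
    ultimately show "q \<in> R O h O cone_rel p u (G\<inverse>)" unfolding x(1) using y G(2) by blast
  qed
  then show ?thesis unfolding antistar_cone_def using pl_iso_relcomp[OF R pl_iso_relcomp[OF h(1) C]] by blast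
qed

text \<open>Strong induction on the index. The links of the neighbours of \<open>u\<close> are
  spheres of smaller index in every triangulation of the sphere, so the induction hypothesis
  provides what the comparison with the model triangulation asks for.\<close>

lemma newman:
  fixes K :: "V set set"
  assumes "realized K" "pl_sphere n (carrier_of K)" "u \<in> \<Union>K"
  shows "antistar_cone K u"
  using assms
proof (induction n arbitrary: K u rule: less_induct)
  case (less n)
  obtain R where R: "pl_iso R (carrier_of K) (carrier_of (model_sphere n))" using less.prems(2) unfolding pl_sphere_def by blast
  have "u \<in> carrier_of K" using less.prems(3) vertex_in_carrier by blast
  from sphere_model[OF R this] obtain p L where
    *: "(u, p) \<in> R" "realized L" "carrier_of L = carrier_of (model_sphere n)" "p \<in> \<Union>L" "antistar_cone L p" by metis
  have RL: "pl_iso R (carrier_of K) (carrier_of L)" using R *(3) by simp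
  have SL: "pl_sphere n (carrier_of L)" using pl_sphere_pl_iso[OF pl_iso_converse[OF RL] less.prems(2)] .
  have nw: "antistar_cone (link M w) v" if M: "realized M" "pl_sphere n (carrier_of M)" "{v, w} \<in> M" "v \<noteq> w" for M :: "V set set" and v w
  proof -
    have w: "w \<in> \<Union>M" using M(3) by blast
    have "v \<in> \<Union>(link M w)" using M(3,4) by (auto simp: link_def insert_commute)
    moreover have "n - 1 < n" using link_sphere(1)[OF M(1,2) w] by simp
    ultimately show ?thesis using less.IH realized_link[OF M(1) w] link_sphere(2)[OF M(1,2) w] by blast
  qed
  have "pair_iso K u L p"
    by (rule pair_inv[where P = "pl_sphere n", OF less.prems(1) *(2) RL less.prems(3) *(4,1) less.prems(2) SL nw])
  then show ?case by (rule antistar_cone_transfer[OF less.prems(1,3) *(2,4) _ *(5)])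
qed

lemma basis_vec_neq: "v \<noteq> w \<Longrightarrow> basis_vec v \<noteq> basis_vec w"
  by (simp only: basis_vec_inj not_False_eq_True)

lemma basis_apex:
  assumes "realized K" "\<Union>K \<subseteq> range basis_vec" "x \<in> range basis_vec"
  shows "realized (cone_complex x K)" "\<Union>(cone_complex x K) \<subseteq> range basis_vec"
proof -
  have ac: "abstract_complex K" using assms(1) by (rule realized_abstract)
  show V: "\<Union>(cone_complex x K) \<subseteq> range basis_vec" unfolding cone_complex_vertices[OF ac] using assms(2,3) by blast
  show "realized (cone_complex x K)" by (rule basis_realized[OF abstract_cone_complex[OF ac] V])
qed

section \<open>Spheres from the link condition\<close>

lemma fresh_basis:
  fixes F :: "V set"
  assumes "finite F" shows "\<exists>x\<in>range basis_vec. x \<notin> F"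
proof -
  have "infinite (range (basis_vec :: nat \<Rightarrow> V))" by (rule range_inj_infinite) (simp add: inj_on_def basis_vec_inj)
  then have "\<not> range basis_vec \<subseteq> F" using finite_subset[OF _ assms] by metis
  then show ?thesis by blast
qed

lemma antistar_Un_cone_complex_link:
  assumes "abstract_complex K" shows "antistar K u \<union> cone_complex u (link K u) = K"
proof (intro equalityI subsetI)
  show "\<tau> \<in> K" if "\<tau> \<in> antistar K u \<union> cone_complex u (link K u)" for \<tau>
    using that cone_complex_link_subset[OF assms, of u] by (auto simp: antistar_def)
  fix \<tau> assume t: "\<tau> \<in> K"
  show "\<tau> \<in> antistar K u \<union> cone_complex u (link K u)"
  proof (cases "u \<in> \<tau>")
    case True
    then have "insert u (\<tau> - {u}) = \<tau>" by blast
    then show ?thesis using t by (simp add: cone_complex_def link_def)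
  qed (use t in \<open>simp add: antistar_def\<close>)
qed

lemma cone_complex_antistar: "cone_complex u (antistar K u) = cone_complex u K"
  by (auto simp: cone_complex_def antistar_def)

text \<open>The cone exchange is applied with \<open>u\<close> as \<open>w\<close>, the antistar as
  \<open>B\<close> and the link as \<open>N\<close>. Its target pieces \<open>x * B\<close> and
  \<open>{x, u} * N\<close> make up \<open>x * K\<close>, because antistar and star of
  \<open>u\<close> make up \<open>K\<close>.\<close>

lemma cone_complex_pl_iso:
  fixes K :: "V set set"
  assumes K: "realized K" "\<Union>K \<subseteq> range basis_vec" and S: "pl_sphere n (carrier_of K)" and u: "u \<in> \<Union>K"
    and x: "x \<in> range basis_vec" "x \<notin> \<Union>K"
  shows "\<exists>R. pl_iso R (carrier_of (cone_complex u K)) (carrier_of (cone_complex x K)) \<and> Id_on (carrier_of K) \<subseteq> R"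
proof -
  have ac: "abstract_complex K" using K(1) by (rule realized_abstract)
  define A where "A = antistar K u"
  define L where "L = link K u"
  have acA: "abstract_complex A" unfolding A_def by (rule abstract_antistar[OF ac])
  have acL: "abstract_complex L" unfolding L_def by (rule abstract_link[OF ac u])
  have LA: "L \<subseteq> A" unfolding L_def A_def by (rule link_subset_antistar[OF ac])
  have AK: "A \<subseteq> K" unfolding A_def by (rule antistar_subset)
  have uA: "u \<notin> \<Union>A" by (auto simp: A_def antistar_def)
  have uL: "u \<notin> \<Union>L" unfolding L_def by (rule apex_not_in_link)
  have xA: "x \<notin> \<Union>A" by (rule not_vertex_mono[OF AK x(2)])
  have gA: "realized A" unfolding A_def by (rule realized_antistar[OF K(1)])
  have VA: "\<Union>A \<subseteq> range basis_vec" by (rule subset_trans[OF Union_mono[OF AK] K(2)])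
  have ur: "u \<in> range basis_vec" using K(2) u by (rule subsetD)
  obtain y where y: "y \<in> range basis_vec" "y \<notin> insert x (insert u (\<Union>K))"
    using fresh_basis[of "insert x (insert u (\<Union>K))"] abstract_complex_finite_vertices[OF ac] by auto
  have yA: "y \<notin> \<Union>A" using not_vertex_mono[OF AK] y(2) by blast
  note g1 = basis_apex[OF gA VA ur]
  note g2 = basis_apex[OF g1 x(1)]
  note g3 = basis_apex[OF g2 y(1)]
  have yL: "y \<notin> \<Union>L" by (rule not_vertex_mono[OF LA yA])
  have gL: "realized L" unfolding L_def by (rule realized_link[OF K(1) u])
  have VL: "\<Union>L \<subseteq> range basis_vec" by (rule subset_trans[OF Union_mono[OF LA] VA])
  obtain h0 where h0: "pl_iso h0 (carrier_of A) (carrier_of (cone_complex u L))" "Id_on (carrier_of L) \<subseteq> h0"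
    using newman[OF K(1) S u] unfolding antistar_cone_def A_def L_def by blast
  have uy: "u \<noteq> y" using y(2) by blast
  note ren = pl_iso_rename_apex[OF acL uL yL uy basis_apex(1)[OF gL VL ur] basis_apex(1)[OF gL VL y(1)]]
  have h: "pl_iso (h0 O simp_rel (id(u := y)) (cone_complex u L)) (carrier_of A) (carrier_of (cone_complex y L))"
    by (rule pl_iso_relcomp[OF h0(1) ren(1)])
  have hL: "Id_on (carrier_of L) \<subseteq> h0 O simp_rel (id(u := y)) (cone_complex u L)" using h0(2) ren(2) by blast
  have neq: "x \<noteq> u" "x \<noteq> y" "u \<noteq> y" using x(2) u y(2) by auto
  obtain R where R: "pl_iso R (carrier_of (cone_complex u A)) (carrier_of (cone_complex x A) \<union> carrier_of (cone_complex x (cone_complex u L)))"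
    "Id_on (carrier_of A) \<subseteq> R" "Id_on (carrier_of (cone_complex u L)) \<subseteq> R"
    using cone_exchange[OF g3(1) acA acL LA neq xA uA yA h hL] by blast
  have KAL: "A \<union> cone_complex u L = K" unfolding A_def L_def by (rule antistar_Un_cone_complex_link[OF ac])
  have "cone_complex x A \<union> cone_complex x (cone_complex u L) = cone_complex x K" unfolding KAL[symmetric] by (auto simp: cone_complex_def)
  then have "pl_iso R (carrier_of (cone_complex u K)) (carrier_of (cone_complex x K))"
    using R(1) unfolding carrier_Un[symmetric] A_def cone_complex_antistar by simp
  moreover have "Id_on (carrier_of K) \<subseteq> R"
    using R(2,3) unfolding KAL[symmetric] carrier_Un by auto
  ultimately show ?thesis by blast
qed

text \<open>A homeomorphism onto the model sphere is coned from both apexes. The result is the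
  suspension of the boundary of a simplex, that is its join with the boundary of the edge
  \<open>ab\<close>.\<close>

lemma suspension_sphere:
  fixes K :: "V set set"
  assumes K: "realized K" "\<Union>K \<subseteq> range basis_vec" and S: "pl_sphere n (carrier_of K)" and n: "1 \<le> n"
    and x: "x \<in> range basis_vec" "x \<notin> \<Union>K" and y: "y \<in> range basis_vec" "y \<notin> \<Union>K" and xy: "x \<noteq> y"
  shows "pl_sphere (Suc n) (carrier_of (cone_complex x K \<union> cone_complex y K))"
proof -
  have ac: "abstract_complex K" using K(1) by (rule realized_abstract)
  have int: "carrier_of (cone_complex x K) \<inter> carrier_of (cone_complex y K) = carrier_of K"
    if K: "realized K" "\<Union>K \<subseteq> range basis_vec" and x: "x \<in> range basis_vec" "x \<notin> \<Union>K" and y: "y \<in> range basis_vec" "y \<notin> \<Union>K" and xy: "x \<noteq> y"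
    for K and x y :: V
  proof -
    have ac: "abstract_complex K" using K(1) by (rule realized_abstract)
    have acU: "abstract_complex (cone_complex x K \<union> cone_complex y K)" by (intro abstract_complex_Un abstract_cone_complex ac)
    have "\<Union>(cone_complex x K \<union> cone_complex y K) \<subseteq> range basis_vec"
      using basis_apex(2)[OF K x(1)] basis_apex(2)[OF K y(1)] by auto
    from basis_realized[OF acU this] have g: "realized (cone_complex x K \<union> cone_complex y K)" .
    have "cone_complex x K \<inter> cone_complex y K = K"
    proof (intro equalityI subsetI)
      fix \<tau> assume "\<tau> \<in> cone_complex x K \<inter> cone_complex y K"
      then have t: "\<tau> - {x} \<in> K" "\<tau> - {y} \<in> K" by (simp_all add: cone_complex_def)
      then have "x \<notin> \<tau> - {y}" using x(2) by blast
      then have "\<tau> - {x} = \<tau>" using xy by blast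
      then show "\<tau> \<in> K" using t by simp
    next
      show "\<tau> \<in> cone_complex x K \<inter> cone_complex y K" if "\<tau> \<in> K" for \<tau>
        using that cone_complex_superset[OF ac, of x] cone_complex_superset[OF ac, of y] by auto
    qed
    then show ?thesis using carrier_Int[OF g Un_upper1 Un_upper2 abstract_cone_complex[OF ac] abstract_cone_complex[OF ac]] by simp
  qed
  let ?W = "basis_vec ` {..<n} :: V set"
  have "basis_vec 0 \<in> ?W" using n by (intro imageI) simp
  then have W: "finite ?W" "?W \<noteq> {}" "?W \<subseteq> range basis_vec" by blast+
  define M where "M = model_sphere n"
  have M_def': "M = bdry ?W" by (simp add: M_def model_sphere_def)
  have gM: "realized M" unfolding M_def' by (rule realized_bdry[OF W])
  have acM: "abstract_complex M" using gM by (rule realized_abstract)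
  have VM: "\<Union>M \<subseteq> ?W" unfolding M_def' by (rule Union_bdry)
  have VM': "\<Union>M \<subseteq> range basis_vec" using VM W(3) by (rule subset_trans)
  define a :: V where "a = basis_vec n"
  define b :: V where "b = basis_vec (Suc n)"
  have abW: "a \<notin> ?W" "b \<notin> ?W" by (auto simp: a_def b_def basis_vec_inj)
  have ab: "a \<in> range basis_vec" "b \<in> range basis_vec" "a \<noteq> b" by (simp_all add: a_def b_def basis_vec_inj)
  have abM: "a \<notin> \<Union>M" "b \<notin> \<Union>M" using abW VM by blast+
  obtain R where R: "pl_iso R (carrier_of K) (carrier_of M)" using S unfolding pl_sphere_def M_def by blast
  have c: "pl_iso (cone_rel z c R) (carrier_of (cone_complex z K)) (carrier_of (cone_complex c M))"
    if "z \<in> range basis_vec" "z \<notin> \<Union>K" "c \<in> range basis_vec" "c \<notin> \<Union>M" for z c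
    unfolding carrier_cone_complex[OF ac that(2)] carrier_cone_complex[OF acM that(4)]
    by (rule pl_iso_cone_rel[OF R realized_cone_pos[OF basis_apex(1)[OF K that(1)] ac that(2)] realized_cone_pos[OF basis_apex(1)[OF gM VM' that(3)] acM that(4)]])
  have "carrier_of (cone_complex x K) \<inter> carrier_of (cone_complex y K) \<subseteq> Domain R"
    unfolding int[OF K x y xy] using R by (simp add: pl_iso_def)
  moreover have "carrier_of (cone_complex a M) \<inter> carrier_of (cone_complex b M) \<subseteq> Range R"
    unfolding int[OF gM VM' ab(1) abM(1) ab(2) abM(2) ab(3)] using R by (simp add: pl_iso_def)
  ultimately have P: "pl_iso (cone_rel x a R \<union> cone_rel y b R) (carrier_of (cone_complex x K \<union> cone_complex y K)) (carrier_of (cone_complex a M \<union> cone_complex b M))"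
    unfolding carrier_Un using pl_iso_Un[OF c[OF x ab(1) abM(1)] c[OF y ab(2) abM(2)] cone_rel_superset cone_rel_superset] by blast
  have eq: "cone_complex a M \<union> cone_complex b M = bdry_join {a, b} ?W"
  proof (intro equalityI subsetI)
    fix \<tau> assume "\<tau> \<in> cone_complex a M \<union> cone_complex b M"
    then consider "\<tau> - {a} \<subset> ?W" | "\<tau> - {b} \<subset> ?W" unfolding cone_complex_def M_def' bdry_def by blast
    then show "\<tau> \<in> bdry_join {a, b} ?W"
    proof cases
      case 1
      then have "b \<notin> \<tau>" using abW(2) ab(3) by blast
      moreover have "\<not> ?W \<subseteq> \<tau>" using 1 abW(1) by blast
      ultimately show ?thesis using 1 by (auto simp: bdry_join_def)
    next
      case 2
      then have "a \<notin> \<tau>" using abW(1) ab(3) by blast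
      moreover have "\<not> ?W \<subseteq> \<tau>" using 2 abW(2) by blast
      ultimately show ?thesis using 2 by (auto simp: bdry_join_def)
    qed
  next
    fix \<tau> assume "\<tau> \<in> bdry_join {a, b} ?W"
    then have t: "\<tau> \<subseteq> {a, b} \<union> ?W" "a \<notin> \<tau> \<or> b \<notin> \<tau>" "\<not> ?W \<subseteq> \<tau>" by (auto simp: bdry_join_def)
    then have "\<tau> - {a} \<subset> ?W \<or> \<tau> - {b} \<subset> ?W" by blast
    then show "\<tau> \<in> cone_complex a M \<union> cone_complex b M" unfolding cone_complex_def M_def' bdry_def by blast
  qed
  have cW: "card ?W = n" by (subst card_image) (auto simp: inj_on_def basis_vec_inj)
  have "pl_sphere (Suc n) (carrier_of (bdry_join {a, b} ?W))"
    by (rule pl_sphere_bdry_join) (use ab abW W cW in auto)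
  then show ?thesis using pl_sphere_pl_iso[OF P] unfolding eq by blast
qed

text \<open>By the hypothesis \<open>lc\<close> the cones meet only in \<open>K\<close>. Two
  homeomorphisms that are both the identity on \<open>K\<close> can then be glued, and the target is
  a suspension.\<close>

lemma sphere_from_link_condition:
  fixes K :: "V set set"
  assumes K: "realized K" "\<Union>K \<subseteq> range basis_vec" and S: "pl_sphere n (carrier_of K)" and u: "u \<in> \<Union>K" and v: "v \<in> \<Union>K"
    and lc: "cone_complex u K \<inter> cone_complex v K \<subseteq> K"
  shows "pl_sphere (Suc n) (carrier_of (cone_complex u K \<union> cone_complex v K))"
proof -
  have ac: "abstract_complex K" using K(1) by (rule realized_abstract)
  have n: "1 \<le> n" using link_sphere(1)[OF K(1) S u] by simp
  have fV: "finite (\<Union>K)" using ac by (rule abstract_complex_finite_vertices)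
  obtain x where x: "x \<in> range basis_vec" "x \<notin> \<Union>K" using fresh_basis[OF fV] by blast
  obtain y where y': "y \<in> range basis_vec" "y \<notin> insert x (\<Union>K)" using fresh_basis[of "insert x (\<Union>K)"] fV by blast
  then have y: "y \<notin> \<Union>K" "x \<noteq> y" by blast+
  obtain R1 where R1: "pl_iso R1 (carrier_of (cone_complex u K)) (carrier_of (cone_complex x K))" "Id_on (carrier_of K) \<subseteq> R1"
    using cone_complex_pl_iso[OF K S u x] by blast
  obtain R2 where R2: "pl_iso R2 (carrier_of (cone_complex v K)) (carrier_of (cone_complex y K))" "Id_on (carrier_of K) \<subseteq> R2"
    using cone_complex_pl_iso[OF K S v y'(1) y(1)] by blast
  have ur: "u \<in> range basis_vec" "v \<in> range basis_vec" using K(2) u v by blast+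
  have acU: "abstract_complex (cone_complex a K \<union> cone_complex b K)" for a b by (intro abstract_complex_Un abstract_cone_complex ac)
  have gU: "realized (cone_complex a K \<union> cone_complex b K)" if "a \<in> range basis_vec" "b \<in> range basis_vec" for a b
    using basis_apex(2)[OF K that(1)] basis_apex(2)[OF K that(2)] by (intro basis_realized[OF acU]) simp
  have "carrier_of (cone_complex u K) \<inter> carrier_of (cone_complex v K) = carrier_of (cone_complex u K \<inter> cone_complex v K)"
    by (rule carrier_Int[OF gU[OF ur] Un_upper1 Un_upper2 abstract_cone_complex[OF ac] abstract_cone_complex[OF ac]])
  also have "\<dots> \<subseteq> carrier_of K" by (rule carrier_mono[OF lc])
  finally have I1: "carrier_of (cone_complex u K) \<inter> carrier_of (cone_complex v K) \<subseteq> Domain (Id_on (carrier_of K))" by simp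
  have "carrier_of (cone_complex x K) \<inter> carrier_of (cone_complex y K) = carrier_of (cone_complex x K \<inter> cone_complex y K)"
    by (rule carrier_Int[OF gU[OF x(1) y'(1)] Un_upper1 Un_upper2 abstract_cone_complex[OF ac] abstract_cone_complex[OF ac]])
  also have "\<dots> \<subseteq> carrier_of K"
  proof (rule carrier_mono, rule subsetI)
    fix \<tau> assume "\<tau> \<in> cone_complex x K \<inter> cone_complex y K"
    then have t: "\<tau> - {x} \<in> K" "\<tau> - {y} \<in> K" by (simp_all add: cone_complex_def)
    then have "x \<notin> \<tau> - {y}" using x(2) by blast
    then have "\<tau> - {x} = \<tau>" using y(2) by blast
    then show "\<tau> \<in> K" using t by simp
  qed
  finally have I2: "carrier_of (cone_complex x K) \<inter> carrier_of (cone_complex y K) \<subseteq> Range (Id_on (carrier_of K))" by simp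
  have "pl_iso (R1 \<union> R2) (carrier_of (cone_complex u K \<union> cone_complex v K)) (carrier_of (cone_complex x K \<union> cone_complex y K))"
    unfolding carrier_Un by (rule pl_iso_Un[OF R1(1) R2(1) R1(2) R2(2) I1 I2])
  then show ?thesis by (rule pl_sphere_pl_iso[OF _ suspension_sphere[OF K S n x y'(1) y]])
qed

section \<open>Spheres with few vertices\<close>

lemma pl_sphere_nonempty: assumes "pl_sphere n X" "2 \<le> n" shows "X \<noteq> {}"
proof -
  have 1: "basis_vec (1::nat) \<in> basis_vec ` {..<n}" "basis_vec (0::nat) \<in> basis_vec ` {..<n}"
    by (rule imageI, use assms(2) in simp)+
  have "basis_vec (1::nat) \<noteq> basis_vec 0" by (rule basis_vec_neq) simp
  then have "{basis_vec 0} \<subset> basis_vec ` {..<n}" using 1 by blast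
  then have "{basis_vec 0} \<in> model_sphere n" unfolding model_sphere_def bdry_def by (rule CollectI)
  then have "basis_vec 0 \<in> carrier_of (model_sphere n)" by (rule vertex_in_carrier) simp
  moreover obtain R where R: "pl_iso R X (carrier_of (model_sphere n))" using assms(1) unfolding pl_sphere_def by blast
  have "Domain R = X" "Range R = carrier_of (model_sphere n)" using R by (simp_all add: pl_iso_def)
  ultimately show ?thesis by blast
qed

lemma carrier_nonempty_vertex: "carrier_of K \<noteq> {} \<Longrightarrow> \<exists>v. v \<in> \<Union>K"
  unfolding carrier_of_def by (metis UN_E Union_iff all_not_in_conv convex_hull_empty)

lemma pl_sphere_1: assumes "pl_sphere 1 (carrier_of K)" shows "\<Union>K = {}"
proof -
  have "model_sphere 1 = {{}}" by (auto simp: model_sphere_def bdry_def lessThan_Suc)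
  then have "carrier_of (model_sphere 1) = {}" by (simp add: carrier_of_def)
  moreover obtain R where "pl_iso R (carrier_of K) (carrier_of (model_sphere 1))" using assms unfolding pl_sphere_def by blast
  ultimately have "carrier_of K = {}" unfolding pl_iso_def by blast
  then show ?thesis using vertex_in_carrier by blast
qed

lemma bdry_pair: assumes "a \<noteq> b" shows "bdry {a, b} = {{}, {a}, {b}}"
proof (intro equalityI subsetI)
  fix \<sigma> assume "\<sigma> \<in> bdry {a, b}"
  then have "\<sigma> \<subseteq> {a} \<or> \<sigma> \<subseteq> {b}" unfolding bdry_def by blast
  then show "\<sigma> \<in> {{}, {a}, {b}}" by (metis insertCI subset_singletonD)
next
  fix \<sigma> assume "\<sigma> \<in> {{}, {a}, {b}}"
  then consider "\<sigma> = {}" | "\<sigma> = {a}" | "\<sigma> = {b}" by blast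
  then show "\<sigma> \<in> bdry {a, b}" by cases (use assms in \<open>auto simp: bdry_def\<close>)
qed

text \<open>The carrier has exactly two points, whereas an edge would contribute its midpoint as a
  third one.\<close>

lemma pl_sphere_2:
  assumes K: "realized K" and S: "pl_sphere 2 (carrier_of K)" shows "card (\<Union>K) = 2" "K = bdry (\<Union>K)"
proof -
  have ac: "abstract_complex K" using K by (rule realized_abstract)
  have W: "basis_vec ` {..<2::nat} = {basis_vec 0, basis_vec 1}" by (auto simp: lessThan_Suc numeral_2_eq_2)
  have "model_sphere 2 = {{}, {basis_vec 0}, {basis_vec 1}}"
    unfolding model_sphere_def W by (rule bdry_pair) (rule basis_vec_neq, simp)
  then have m: "carrier_of (model_sphere 2) = {basis_vec 0, basis_vec 1}" by (auto simp: carrier_of_def)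
  obtain R where R: "pl_iso R (carrier_of K) (carrier_of (model_sphere 2))" using S unfolding pl_sphere_def by blast
  obtain f g where "homeomorphism (carrier_of K) (carrier_of (model_sphere 2)) f g" using pl_iso_homeomorphism[OF R] by blast
  then have "bij_betw f (carrier_of K) {basis_vec 0, basis_vec 1}"
    unfolding m homeomorphism_def by (intro bij_betw_byWitness[where f' = g]) auto
  then have "card (carrier_of K) = card {basis_vec (0::nat), basis_vec 1 :: V}" by (rule bij_betw_same_card)
  also have "\<dots> = 2"
  proof -
    have c: "card {a, b} = 2" if "a \<noteq> b" for a b :: V using that by simp
    have "basis_vec (0::nat) \<noteq> basis_vec 1" by (rule basis_vec_neq) simp
    then show ?thesis by (rule c)
  qed
  finally have c2: "card (carrier_of K) = 2" .
  have fin: "finite (carrier_of K)" by (rule card_ge_0_finite) (simp add: c2)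
  have no_edge: "a = b" if ab: "{a, b} \<in> K" for a b
  proof (rule ccontr)
    assume neq: "a \<noteq> b"
    let ?m = "(1/2) *\<^sub>R a + (1/2) *\<^sub>R b"
    have h: "a \<in> convex hull {a, b}" "b \<in> convex hull {a, b}" by (auto intro: hull_inc)
    have "?m \<in> convex hull {a, b}" using h by (intro convexD[OF convex_convex_hull]) simp_all
    then have sub: "{a, b, ?m} \<subseteq> carrier_of K" using h ab unfolding carrier_of_def by blast
    have half: "z = (1/2) *\<^sub>R z + (1/2) *\<^sub>R z" for z :: 'a by (simp flip: scaleR_add_left)
    have "?m \<noteq> a"
    proof
      assume "?m = a"
      then have "(1/2) *\<^sub>R a + (1/2) *\<^sub>R b = (1/2) *\<^sub>R a + (1/2) *\<^sub>R a" using half[of a] by (rule trans)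
      then show False using neq by simp
    qed
    moreover have "?m \<noteq> b"
    proof
      assume "?m = b"
      then have "(1/2) *\<^sub>R a + (1/2) *\<^sub>R b = (1/2) *\<^sub>R b + (1/2) *\<^sub>R b" using half[of b] by (rule trans)
      then show False using neq by simp
    qed
    ultimately have "?m \<noteq> a" "?m \<noteq> b" by simp_all
    then have "card {a, b, ?m} = 3" using neq by auto
    then show False using card_mono[OF fin sub] c2 by simp
  qed
  have single: "\<sigma> = {} \<or> (\<exists>v. \<sigma> = {v})" if s: "\<sigma> \<in> K" for \<sigma>
  proof (cases "\<sigma> = {}")
    case False
    then obtain v where v: "v \<in> \<sigma>" by blast
    have "w = v" if "w \<in> \<sigma>" for w
      using no_edge abstract_complexD(4)[OF ac s, of "{w, v}"] that v by blast
    then show ?thesis using v by blast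
  qed simp
  have "carrier_of K = \<Union>K"
  proof (intro equalityI subsetI)
    fix x assume "x \<in> carrier_of K"
    then obtain \<sigma> where "\<sigma> \<in> K" "x \<in> convex hull \<sigma>" by (auto simp: carrier_of_def)
    then show "x \<in> \<Union>K" using single[of \<sigma>] by auto
  next
    show "x \<in> carrier_of K" if "x \<in> \<Union>K" for x using that vertex_in_carrier by blast
  qed
  then show card: "card (\<Union>K) = 2" using c2 by simp
  then obtain a b where ab: "\<Union>K = {a, b}" "a \<noteq> b" by (auto simp: card_2_iff)
  show "K = bdry (\<Union>K)"
  proof (intro equalityI subsetI)
    fix \<sigma> assume s: "\<sigma> \<in> K"
    have "\<sigma> \<subseteq> \<Union>K" using s by blast
    moreover have "\<sigma> \<noteq> \<Union>K" using single[OF s] ab by auto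
    ultimately show "\<sigma> \<in> bdry (\<Union>K)" by (simp add: bdry_def psubset_eq)
  next
    fix \<sigma> assume "\<sigma> \<in> bdry (\<Union>K)"
    then have "\<sigma> \<subset> {a, b}" unfolding ab(1) by (simp add: bdry_def)
    then have "\<sigma> = {} \<or> \<sigma> = {a} \<or> \<sigma> = {b}" by blast
    moreover have "a \<in> \<Union>K" "b \<in> \<Union>K" using ab by auto
    then have "{a} \<in> K" "{b} \<in> K" using iffD1[OF abstract_complex_vertex[OF ac]] by blast+
    ultimately show "\<sigma> \<in> K" using abstract_complexD(2)[OF ac] by blast
  qed
qed

text \<open>The link of a vertex has at most \<open>n - 1\<close> vertices, so by induction it is
  the boundary of a simplex on all the other vertices. These links determine the nonempty faces of
  \<open>K\<close>.\<close>

lemma minimal_sphere: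
  fixes K :: "V set set"
  assumes "realized K" "pl_sphere n (carrier_of K)" "2 \<le> n" "card (\<Union>K) \<le> n"
  shows "card (\<Union>K) = n \<and> K = bdry (\<Union>K)"
  using assms
proof (induction n arbitrary: K rule: less_induct)
  case (less n)
  note K = less.prems
  have ac: "abstract_complex K" using K(1) by (rule realized_abstract)
  have fV: "finite (\<Union>K)" using ac by (rule abstract_complex_finite_vertices)
  show ?case
  proof (cases "n = 2")
    case True
    then show ?thesis using pl_sphere_2 K(1,2) by blast
  next
    case False
    have lk: "link K w = bdry (\<Union>K - {w}) \<and> card (\<Union>K) = n" if w: "w \<in> \<Union>K" for w
    proof -
      have sub: "\<Union>(link K w) \<subseteq> \<Union>K - {w}" using link_subset[OF ac, of w] by (auto simp: link_def)
      have c: "card (\<Union>K - {w}) = card (\<Union>K) - 1" using w fV by simp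
      have "card (\<Union>(link K w)) \<le> card (\<Union>K - {w})" using sub fV by (intro card_mono) simp_all
      then have le: "card (\<Union>(link K w)) \<le> n - 1" using c K(4) by linarith
      have IH: "card (\<Union>(link K w)) = n - 1 \<and> link K w = bdry (\<Union>(link K w))"
        by (rule less.IH[OF _ realized_link[OF K(1) w] link_sphere(2)[OF K(1,2) w] _ le]) (use K(3) False in simp_all)
      have p: "0 < card (\<Union>K)" using w fV by (auto simp: card_gt_0_iff)
      have "card (\<Union>K - {w}) \<le> card (\<Union>(link K w))" using IH c K(4) by linarith
      then have e: "\<Union>(link K w) = \<Union>K - {w}" using sub fV by (intro card_seteq) simp_all
      have "card (\<Union>K) - 1 = n - 1" using IH c unfolding e by (metis (no_types))
      then have "card (\<Union>K) = n" using p K(3) by linarith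
      then show ?thesis using IH unfolding e by blast
    qed
    obtain w0 where w0: "w0 \<in> \<Union>K" using carrier_nonempty_vertex[OF pl_sphere_nonempty[OF K(2,3)]] by blast
    have "K = bdry (\<Union>K)"
    proof (intro equalityI subsetI)
      fix \<sigma> assume s: "\<sigma> \<in> K"
      have "\<sigma> \<noteq> \<Union>K"
      proof
        assume e: "\<sigma> = \<Union>K"
        then have "insert w0 (\<Union>K - {w0}) \<in> K" using s w0 by (simp add: insert_absorb)
        then have "\<Union>K - {w0} \<in> link K w0" by (simp add: link_def)
        then show False using lk[OF w0] by (simp add: bdry_def)
      qed
      moreover have "\<sigma> \<subseteq> \<Union>K" using s by blast
      ultimately show "\<sigma> \<in> bdry (\<Union>K)" by (simp add: bdry_def psubset_eq)
    next
      fix \<sigma> assume s: "\<sigma> \<in> bdry (\<Union>K)"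
      show "\<sigma> \<in> K"
      proof (cases "\<sigma> = {}")
        case True
        then show ?thesis using abstract_complexD(2)[OF ac] by simp
      next
        case False
        then obtain w where w: "w \<in> \<sigma>" by blast
        then have wK: "w \<in> \<Union>K" using s by (auto simp: bdry_def)
        have "\<sigma> - {w} \<subset> \<Union>K - {w}" using s w by (auto simp: bdry_def)
        then have "\<sigma> - {w} \<in> link K w" using lk[OF wK] by (simp add: bdry_def)
        then show ?thesis using w by (simp add: link_def insert_absorb)
      qed
    qed
    then show ?thesis using lk[OF w0] by simp
  qed
qed

text \<open>With at least three vertices the facets of a simplex meet pairwise: omitting two
  vertices leaves a common one.\<close>

lemma connected_bdry:
  fixes W :: "'v::real_normed_vector set"
  assumes "finite W" "3 \<le> card W" shows "connected (carrier_of (bdry W))"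
proof -
  have "W \<noteq> {}" using assms(2) by auto
  then obtain w0 where w0: "w0 \<in> W" by blast
  let ?B = "(\<lambda>w. convex hull (W - {w})) ` W"
  have eq: "carrier_of (bdry W) = convex hull (W - {w0}) \<union> \<Union>?B"
  proof (intro equalityI subsetI)
    fix x assume "x \<in> carrier_of (bdry W)"
    then obtain \<sigma> where s: "\<sigma> \<subset> W" "x \<in> convex hull \<sigma>" by (auto simp: carrier_of_def bdry_def)
    then obtain w where w: "w \<in> W" "\<sigma> \<subseteq> W - {w}" by blast
    then have "x \<in> convex hull (W - {w})" using s(2) hull_mono by blast
    then show "x \<in> convex hull (W - {w0}) \<union> \<Union>?B" using w(1) by blast
  next
    fix x assume "x \<in> convex hull (W - {w0}) \<union> \<Union>?B"
    then obtain w where w: "w \<in> W" "x \<in> convex hull (W - {w})" using w0 by blast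
    then have "W - {w} \<in> bdry W" by (auto simp: bdry_def)
    then show "x \<in> carrier_of (bdry W)" using w(2) unfolding carrier_of_def by blast
  qed
  have conn: "connected (convex hull (W - {w}))" for w by (simp add: convex_connected)
  have "connected (convex hull (W - {w0}) \<union> \<Union>?B)"
  proof (rule connected_Un_UN[OF conn])
    show "connected X" if "X \<in> ?B" for X using that conn by blast
    fix X assume "X \<in> ?B"
    then obtain w where w: "X = convex hull (W - {w})" by blast
    have "W - {w0, w} \<noteq> {}"
    proof
      assume "W - {w0, w} = {}"
      then have "card W \<le> card {w0, w}" by (intro card_mono) auto
      also have "\<dots> \<le> 2" by (simp add: card_insert_if)
      finally show False using assms(2) by simp
    qed
    then obtain v where "v \<in> W - {w0}" "v \<in> W - {w}" by blast
    then have "v \<in> convex hull (W - {w0})" "v \<in> X" unfolding w by (simp_all add: hull_inc)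
    then show "convex hull (W - {w0}) \<inter> X \<noteq> {}" by blast
  qed
  then show ?thesis unfolding eq .
qed

lemma pl_sphere_connected: assumes "pl_sphere n X" "3 \<le> n" shows "connected X"
proof -
  obtain R where R: "pl_iso R X (carrier_of (model_sphere n))" using assms(1) unfolding pl_sphere_def by blast
  obtain f g where h: "homeomorphism (carrier_of (model_sphere n)) X f g" using pl_iso_homeomorphism[OF pl_iso_converse[OF R]] by blast
  have "card (basis_vec ` {..<n} :: V set) = n" by (subst card_image) (auto simp: inj_on_def basis_vec_inj)
  then have "connected (carrier_of (model_sphere n))" unfolding model_sphere_def using assms(2) by (intro connected_bdry) simp_all
  then have "connected (f ` carrier_of (model_sphere n))"
    using homeomorphism_cont1[OF h] by (rule connected_continuous_image[rotated])
  then show ?thesis using homeomorphism_image1[OF h] by simp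
qed

text \<open>By induction the link in \<open>K\<close> of each vertex of \<open>W\<close> is
  exhausted by the boundary of \<open>W\<close>, so no further face of \<open>K\<close> meets
  \<open>W\<close>. Faces disjoint from \<open>W\<close> would form a second closed piece of a
  connected space. For \<open>n = 2\<close> connectedness fails and vertices are counted
  instead.\<close>

lemma sphere_containing_boundary:
  fixes K :: "V set set"
  assumes "realized K" "pl_sphere n (carrier_of K)" "2 \<le> n" "finite W" "card W = n" "bdry W \<subseteq> K"
  shows "K = bdry W"
  using assms
proof (induction n arbitrary: K W rule: less_induct)
  case (less n)
  note K = less.prems
  have ac: "abstract_complex K" using K(1) by (rule realized_abstract)
  have WK: "W \<subseteq> \<Union>K"
  proof
    fix w assume w: "w \<in> W"
    have "W \<noteq> {w}" using K(3,5) by auto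
    then have "{w} \<in> bdry W" using w by (auto simp: bdry_def)
    then show "w \<in> \<Union>K" using K(6) by blast
  qed
  show ?case
  proof (cases "n = 2")
    case True
    have S2: "card (\<Union>K) = 2" "K = bdry (\<Union>K)" using pl_sphere_2[OF K(1)] K(2) True by simp_all
    have "W = \<Union>K" by (rule card_seteq[OF abstract_complex_finite_vertices[OF ac] WK]) (use S2(1) K(5) True in simp)
    then show ?thesis using S2(2) by simp
  next
    case False
    have lk: "link K w = bdry (W - {w})" if w: "w \<in> W" for w
    proof -
      have wK: "w \<in> \<Union>K" using WK w by (rule subsetD)
      have sub: "bdry (W - {w}) \<subseteq> link K w"
      proof
        fix \<sigma> assume s: "\<sigma> \<in> bdry (W - {w})"
        then have "insert w \<sigma> \<in> bdry W" using w unfolding bdry_def by blast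
        then have "insert w \<sigma> \<in> K" using K(6) by (rule subsetD[rotated])
        then show "\<sigma> \<in> link K w" using s by (auto simp: link_def bdry_def)
      qed
      have "card (W - {w}) = n - 1" using w K(4,5) by simp
      moreover have "n - 1 < n" "2 \<le> n - 1" using K(3) False by simp_all
      moreover have "finite (W - {w})" using K(4) by simp
      ultimately show ?thesis
        using less.IH[of "n - 1" "link K w" "W - {w}"] realized_link[OF K(1) wK] link_sphere(2)[OF K(1,2) wK] sub by blast
    qed
    have meet: "\<sigma> \<in> bdry W" if s: "\<sigma> \<in> K" "w \<in> \<sigma>" "w \<in> W" for \<sigma> w
    proof -
      have "insert w (\<sigma> - {w}) = \<sigma>" using s(2) by blast
      then have "\<sigma> - {w} \<in> link K w" using s(1) by (simp add: link_def)
      then have "\<sigma> - {w} \<subset> W - {w}" unfolding lk[OF s(3)] by (simp add: bdry_def)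
      then have "\<sigma> \<subset> W" using s(2,3) by blast
      then show ?thesis by (simp add: bdry_def)
    qed
    define K2 where "K2 = {\<sigma> \<in> K. \<sigma> \<inter> W = {}}"
    have ac2: "abstract_complex K2"
    proof (rule abstract_complexI)
      show "finite K2" using abstract_complexD(1)[OF ac] by (simp add: K2_def)
      show "{} \<in> K2" using abstract_complexD(2)[OF ac] by (simp add: K2_def)
      show "finite \<sigma>" if "\<sigma> \<in> K2" for \<sigma> using that abstract_complexD(3)[OF ac] by (simp add: K2_def)
      show "\<tau> \<in> K2" if "\<sigma> \<in> K2" "\<tau> \<subseteq> \<sigma>" for \<sigma> \<tau>
        using that abstract_complexD(4)[OF ac, of \<sigma> \<tau>] by (auto simp: K2_def)
    qed
    have Wne: "W \<noteq> {}" using K(3,5) by auto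
    have acW: "abstract_complex (bdry W)" by (rule abstract_bdry[OF K(4) Wne])
    have K2K: "K2 \<subseteq> K" by (simp add: K2_def)
    have KU: "K = bdry W \<union> K2"
    proof (intro equalityI subsetI)
      fix \<sigma> assume s: "\<sigma> \<in> K"
      show "\<sigma> \<in> bdry W \<union> K2"
      proof (cases "\<sigma> \<inter> W = {}")
        case True then show ?thesis using s by (simp add: K2_def)
      next
        case F: False
        then obtain w where "w \<in> \<sigma>" "w \<in> W" by blast
        then show ?thesis using meet[OF s] by blast
      qed
    qed (use K(6) K2K in blast)
    have "K2 \<subseteq> {{}}"
    proof (rule ccontr)
      assume "\<not> K2 \<subseteq> {{}}"
      then obtain \<sigma> v where "\<sigma> \<in> K2" "v \<in> \<sigma>" by blast
      then have ne2: "carrier_of K2 \<noteq> {}" using vertex_in_carrier by blast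
      obtain w where w: "w \<in> W" using Wne by blast
      have "{w} \<in> bdry W" using w K(3,5) by (auto simp: bdry_def)
      then have ne1: "carrier_of (bdry W) \<noteq> {}" using vertex_in_carrier[of "{w}" "bdry W" w] by blast
      have "carrier_of (bdry W) \<inter> carrier_of K2 = carrier_of (bdry W \<inter> K2)"
        by (rule carrier_Int[OF K(1,6) K2K acW ac2])
      also have "bdry W \<inter> K2 \<subseteq> {{}}" by (auto simp: bdry_def K2_def)
      then have "carrier_of (bdry W \<inter> K2) \<subseteq> {}" using carrier_mono[of _ "{{}}"] by (auto simp: carrier_of_def)
      finally have dis: "carrier_of (bdry W) \<inter> carrier_of K2 = {}" by blast
      have cl: "closed (carrier_of (bdry W))" "closed (carrier_of K2)"
        using acW ac2 polyhedral_carrier polyhedral_compact compact_imp_closed by blast+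
      have "carrier_of K \<subseteq> carrier_of (bdry W) \<union> carrier_of K2" unfolding KU carrier_Un ..
      moreover have "carrier_of (bdry W) \<inter> carrier_of K \<noteq> {}" "carrier_of K2 \<inter> carrier_of K \<noteq> {}"
        using ne1 ne2 carrier_mono[OF K(6)] carrier_mono[OF K2K] by blast+
      moreover have "connected (carrier_of K)" using pl_sphere_connected[OF K(2)] K(3) False by simp
      ultimately show False using cl dis unfolding connected_closed by blast
    qed
    then show ?thesis using KU abstract_complexD(2)[OF acW] by blast
  qed
qed

section \<open>From abstract complexes to realizations on numbered basis vectors\<close>

lemma cone_complex_image:
  assumes inj: "inj_on b (\<Union>S)" and u: "u \<in> \<Union>S"
  shows "(`) b ` cone_complex u S = cone_complex (b u) ((`) b ` S)"
proof (intro equalityI subsetI)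
  fix \<tau> assume "\<tau> \<in> (`) b ` cone_complex u S"
  then obtain \<sigma> where s: "\<tau> = b ` \<sigma>" "\<sigma> - {u} \<in> S" by (auto simp: cone_complex_def)
  then have "\<sigma> \<subseteq> \<Union>S" using u by blast
  then have "b ` (\<sigma> - {u}) = \<tau> - {b u}" using inj_on_image_set_diff[OF inj, of \<sigma> "{u}"] u s(1) by auto
  then have "\<tau> - {b u} \<in> (`) b ` S" using s(2) by (intro image_eqI[of _ _ "\<sigma> - {u}"]) simp_all
  then show "\<tau> \<in> cone_complex (b u) ((`) b ` S)" by (simp add: cone_complex_def)
next
  fix \<tau> assume "\<tau> \<in> cone_complex (b u) ((`) b ` S)"
  then obtain \<sigma> where s: "\<sigma> \<in> S" "\<tau> - {b u} = b ` \<sigma>" by (auto simp: cone_complex_def)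
  have sS: "\<sigma> \<subseteq> \<Union>S" using s(1) by blast
  have "u \<notin> \<sigma>" using s(2) by blast
  then have su: "\<sigma> - {u} = \<sigma>" by simp
  show "\<tau> \<in> (`) b ` cone_complex u S"
  proof (cases "b u \<in> \<tau>")
    case True
    then have "\<tau> = b ` insert u \<sigma>" using s(2) by auto
    moreover have "insert u \<sigma> \<in> cone_complex u S" using s(1) su by (simp add: cone_complex_def)
    ultimately show ?thesis by blast
  next
    case False
    then have "\<tau> = b ` \<sigma>" using s(2) by auto
    moreover have "\<sigma> \<in> cone_complex u S" using s(1) su by (simp add: cone_complex_def)
    ultimately show ?thesis by blast
  qed
qed

text \<open>The sphere arguments take place in \<open>V\<close>, while the definition of a
  combinatorial sphere realizes a complex over its own vertex type. Numbering the vertices gives a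
  simplicial isomorphism between the two realizations.\<close>

lemma abstract_realization_pl_iso:
  fixes S :: "'a set set" and b :: "'a \<Rightarrow> V"
  assumes ac: "abstract_complex S" and inj: "inj_on b (\<Union>S)" and b: "b ` \<Union>S \<subseteq> range basis_vec"
  shows "realized ((`) b ` S)" "realized (realization S)"
    "\<exists>R. pl_iso R (carrier_of (realization S)) (carrier_of ((`) b ` S))"
proof -
  have U: "\<Union>((`) c ` S) = c ` \<Union>S" for c :: "'a \<Rightarrow> 'c" by blast
  show g1: "realized ((`) b ` S)" by (rule basis_realized[OF abstract_image[OF ac]]) (use b U[of b] in simp)
  have r: "realization S = (`) basis_vec ` S" by (simp add: realization_def)
  have "\<Union>((`) (basis_vec :: 'a \<Rightarrow> _) ` S) \<subseteq> range basis_vec" by blast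
  from basis_realized[OF abstract_image[OF ac] this] show g2: "realized (realization S)" unfolding r .
  define c where "c = (\<lambda>w. b (inv basis_vec w :: 'a))"
  have injE: "inj (basis_vec :: 'a \<Rightarrow> _)" by (rule injI) (simp only: basis_vec_inj)
  have ce: "c (basis_vec v) = b v" for v by (simp add: c_def inv_f_f[OF injE])
  have im: "(`) b ` S = (`) c ` realization S"
    unfolding r image_image using ce by simp
  have "inj_on c (\<Union>(realization S))"
  proof (rule inj_onI)
    fix x y assume xy: "x \<in> \<Union>(realization S)" "y \<in> \<Union>(realization S)" "c x = c y"
    obtain v where v: "v \<in> \<Union>S" "x = basis_vec v" using xy(1) unfolding r by blast
    obtain w where w: "w \<in> \<Union>S" "y = basis_vec w" using xy(2) unfolding r by blast
    have "b v = b w" using xy(3) ce v w by simp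
    then have "v = w" using inj v w by (simp only: inj_on_eq_iff)
    then show "x = y" using v w by simp
  qed
  from pl_iso_simp_rel[OF g2 g1 this im] show "\<exists>R. pl_iso R (carrier_of (realization S)) (carrier_of ((`) b ` S))" by blast
qed

lemma standard_sphere_bdry: "standard_sphere k = bdry {..<k + 2}"
proof -
  have "{0..k + 1} = {..<k + 2}" by auto
  then show ?thesis by (simp add: standard_sphere_def bdry_def)
qed

lemma realization_standard_sphere: "realization (standard_sphere k) = model_sphere (k + 2)"
  unfolding realization_def standard_sphere_bdry model_sphere_def
  by (rule image_bdry) (simp only: inj_on_def basis_vec_inj, blast)

lemma combinatorial_sphere_pl_sphere:
  assumes "combinatorial_sphere k S"
  shows "abstract_complex S" "pl_sphere (k + 2) (carrier_of (realization S))"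
proof -
  show "abstract_complex S" using assms by (simp add: combinatorial_sphere_def)
  have "pl_homeomorphic (realization S) (realization (standard_sphere k))" using assms by (simp add: combinatorial_sphere_def)
  from pl_homeomorphic_imp_pl_iso[OF this] show "pl_sphere (k + 2) (carrier_of (realization S))"
    unfolding pl_sphere_def realization_standard_sphere .
qed

lemma combinatorial_sphere_vertex:
  assumes "combinatorial_sphere k S" shows "\<exists>v. v \<in> \<Union>S"
proof -
  have "carrier_of (realization S) \<noteq> {}" by (rule pl_sphere_nonempty[OF combinatorial_sphere_pl_sphere(2)[OF assms]]) simp
  then obtain v where "v \<in> \<Union>(realization S)" using carrier_nonempty_vertex by blast
  then show ?thesis unfolding realization_def by blast
qed

section \<open>The link condition for joins, flag spheres and vertices of small degree\<close>

lemma iterated_join_vertices: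
  assumes "\<And>X. X \<in> set Xs \<Longrightarrow> {} \<in> X"
  shows "{} \<in> iterated_join Xs \<and> \<Union>(iterated_join Xs) = (\<Union>X\<in>set Xs. \<Union>X)"
  using assms
proof (induction Xs)
  case (Cons X Xs)
  then have IH: "{} \<in> iterated_join Xs" "\<Union>(iterated_join Xs) = (\<Union>X\<in>set Xs. \<Union>X)" and X: "{} \<in> X" by simp_all
  have "\<Union>(complex_join X J) = \<Union>X \<union> \<Union>J" for J unfolding complex_join_def by blast
  moreover have "{} \<in> complex_join X J" for J using X by (simp add: complex_join_def)
  ultimately show ?case using IH(2) by simp
qed simp

lemma complex_join_alt: "{} \<in> X \<Longrightarrow> {} \<in> J \<Longrightarrow> complex_join X J = {\<alpha> \<union> \<beta> |\<alpha> \<beta>. \<alpha> \<in> X \<and> \<beta> \<in> J}"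
  unfolding complex_join_def by blast

text \<open>Split \<sigma> into its vertices in \<open>X\<close> and those in \<open>J\<close>. The
  first part survives the removal of \<open>v\<close> and the second the removal of
  \<open>u\<close>, so each is a face of its factor.\<close>

lemma join_link_condition:
  assumes "{} \<in> X" "{} \<in> J" and u: "u \<in> \<Union>X" and v: "v \<in> \<Union>J" and dis: "\<Union>X \<inter> \<Union>J = {}"
    and S: "S = complex_join X J"
  shows "cone_complex u S \<inter> cone_complex v S \<subseteq> S"
proof
  fix \<sigma> assume s: "\<sigma> \<in> cone_complex u S \<inter> cone_complex v S"
  note S' = S[unfolded complex_join_alt[OF assms(1,2)]]
  obtain \<alpha> \<beta> where 1: "\<sigma> - {u} = \<alpha> \<union> \<beta>" "\<alpha> \<in> X" "\<beta> \<in> J" using s unfolding S' cone_complex_def by blast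
  obtain \<alpha>' \<beta>' where 2: "\<sigma> - {v} = \<alpha>' \<union> \<beta>'" "\<alpha>' \<in> X" "\<beta>' \<in> J" using s unfolding S' cone_complex_def by blast
  have i: "\<alpha> \<subseteq> \<Union>X" "\<beta> \<subseteq> \<Union>J" "\<alpha>' \<subseteq> \<Union>X" "\<beta>' \<subseteq> \<Union>J" using 1 2 by blast+
  have "u \<notin> \<Union>J" "v \<notin> \<Union>X" using u v dis by blast+
  then have "\<sigma> = \<alpha>' \<union> \<beta>"
  proof (intro equalityI subsetI)
    fix x assume x: "x \<in> \<sigma>"
    show "x \<in> \<alpha>' \<union> \<beta>"
    proof (cases "x = u")
      case True
      then have "x \<in> \<sigma> - {v}" using x u \<open>v \<notin> \<Union>X\<close> by blast
      then show ?thesis using 2(1) i(4) True \<open>u \<notin> \<Union>J\<close> by blast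
    next
      case False
      then have "x \<in> \<alpha> \<union> \<beta>" using x 1(1) by blast
      then show ?thesis
      proof
        assume "x \<in> \<alpha>"
        then have xX: "x \<in> \<Union>X" using i(1) by blast
        then have "x \<in> \<sigma> - {v}" using x \<open>v \<notin> \<Union>X\<close> by blast
        then have "x \<in> \<alpha>' \<union> \<beta>'" unfolding 2(1) .
        then show ?thesis using xX i(4) dis by blast
      qed blast
    qed
  next
    fix x assume "x \<in> \<alpha>' \<union> \<beta>"
    then show "x \<in> \<sigma>" using 1(1) 2(1) by blast
  qed
  then show "\<sigma> \<in> S" unfolding S' using 2(2) 1(3) by blast
qed

text \<open>A pair of vertices of \<sigma> either is \<open>{u, v}\<close> or avoids one of
  \<open>u\<close> and \<open>v\<close>. In each case it is an edge, so \<sigma> is a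
  clique.\<close>

lemma flag_link_condition:
  assumes uv: "{u, v} \<in> S" "u \<noteq> v" and ac: "abstract_complex S" and flag: "\<And>U. clique S U \<Longrightarrow> U \<in> S"
  shows "cone_complex u S \<inter> cone_complex v S \<subseteq> S"
proof
  fix \<sigma> assume "\<sigma> \<in> cone_complex u S \<inter> cone_complex v S"
  then have s: "\<sigma> - {u} \<in> S" "\<sigma> - {v} \<in> S" by (simp_all add: cone_complex_def)
  have "clique S \<sigma>"
    unfolding clique_def vertex_set_def
  proof (intro conjI ballI impI)
    show "\<sigma> \<subseteq> \<Union>S"
    proof
      fix x assume "x \<in> \<sigma>"
      then have "x = u \<or> x \<in> \<sigma> - {u}" by blast
      then show "x \<in> \<Union>S" using uv(1) s(1) by blast
    qed
    fix x y assume xy: "x \<in> \<sigma>" "y \<in> \<sigma>" "x \<noteq> y"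
    consider "{x, y} = {u, v}" | "{x, y} \<subseteq> \<sigma> - {u}" | "{x, y} \<subseteq> \<sigma> - {v}" using xy uv(2) by blast
    then show "{x, y} \<in> S"
    proof cases
      case 1 then show ?thesis using uv(1) by simp
    next
      case 2 then show ?thesis by (rule abstract_complexD(4)[OF ac s(1)])
    next
      case 3 then show ?thesis by (rule abstract_complexD(4)[OF ac s(2)])
    qed
  qed
  then show "\<sigma> \<in> S" by (rule flag)
qed

text \<open>A link with only \<open>d\<close> vertices is the boundary of a simplex on a set
  \<open>A\<close>. If \<open>A\<close> were a face, \<open>K\<close> would contain, and hence be,
  the boundary of the simplex on \<open>A\<close> and \<open>u\<close>, which has just
  \<open>d + 1\<close> vertices. With \<open>A\<close> missing, every \<open>v\<close> in
  \<open>A\<close> works: the link of \<open>u\<close> consists of the proper subsets of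
  \<open>A\<close>.\<close>

lemma degree_link_condition:
  fixes K :: "V set set"
  assumes K: "realized K" and S: "pl_sphere (Suc d) (carrier_of K)" and u: "u \<in> \<Union>K" and d: "1 \<le> d"
    and deg: "card (\<Union>(link K u)) = d" and n: "d + 2 \<le> card (\<Union>K)"
  shows "\<exists>v\<in>\<Union>K. cone_complex u K \<inter> cone_complex v K \<subseteq> K"
proof -
  have ac: "abstract_complex K" using K by (rule realized_abstract)
  have lS: "pl_sphere d (carrier_of (link K u))" using link_sphere(2)[OF K S u] by simp
  define A where "A = \<Union>(link K u)"
  \<comment> \<open>In a 0-sphere the link of a vertex has no vertices, so the degree would be 0 and
    not \<open>d = 1\<close>.\<close>
  have d2: "2 \<le> d"
  proof (rule ccontr)
    assume "\<not> 2 \<le> d"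
    then have d1: "d = 1" using d by simp
    then have "A = {}" unfolding A_def using lS pl_sphere_1 by blast
    then have "card (\<Union>(link K u)) = 0" unfolding A_def by (simp only: card.empty)
    then show False using deg d1 by linarith
  qed
  have lk: "link K u = bdry A" unfolding A_def using minimal_sphere[OF realized_link[OF K u] lS d2] deg by simp
  have cA: "card A = d" using deg by (simp add: A_def)
  then have fA: "finite A" "A \<noteq> {}" using d by (auto intro: card_ge_0_finite)
  have uA: "u \<notin> A" unfolding A_def by (rule apex_not_in_link)
  have AK: "A \<notin> K"
  proof
    assume a: "A \<in> K"
    have "bdry (insert u A) \<subseteq> K"
    proof
      fix \<sigma> assume s: "\<sigma> \<in> bdry (insert u A)"
      show "\<sigma> \<in> K"
      proof (cases "u \<in> \<sigma>")
        case True
        then have "\<sigma> - {u} \<in> bdry A" using s uA by (auto simp: bdry_def)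
        then have "\<sigma> - {u} \<in> link K u" unfolding lk .
        then show ?thesis using True by (simp add: link_def insert_absorb)
      next
        case False
        then have "\<sigma> \<subseteq> A" using s by (auto simp: bdry_def)
        then show ?thesis by (rule abstract_complexD(4)[OF ac a])
      qed
    qed
    moreover have "card (insert u A) = Suc d" using fA uA cA by simp
    ultimately have "K = bdry (insert u A)" using d fA by (intro sphere_containing_boundary[OF K S]) simp_all
    then have "\<Union>K \<subseteq> insert u A" using Union_bdry by metis
    then have "card (\<Union>K) \<le> card (insert u A)" using fA by (intro card_mono) simp_all
    then show False using n \<open>card (insert u A) = Suc d\<close> by simp
  qed
  obtain v where v: "v \<in> A" using fA by blast
  have "v \<in> \<Union>K" using v link_subset[OF ac, of u] unfolding A_def by blast
  moreover have "cone_complex u K \<inter> cone_complex v K \<subseteq> K"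
  proof
    fix \<sigma> assume "\<sigma> \<in> cone_complex u K \<inter> cone_complex v K"
    then have s: "\<sigma> - {u} \<in> K" "\<sigma> - {v} \<in> K" by (simp_all add: cone_complex_def)
    show "\<sigma> \<in> K"
    proof (cases "u \<in> \<sigma> \<and> v \<in> \<sigma>")
      case False
      then have "\<sigma> - {u} = \<sigma> \<or> \<sigma> - {v} = \<sigma>" by blast
      then show ?thesis using s by metis
    next
      case True
      have uv: "u \<noteq> v" using uA v by blast
      have "insert u (\<sigma> - {v} - {u}) = \<sigma> - {v}" using True uv by blast
      then have "\<sigma> - {v} - {u} \<in> link K u" using s(2) by (simp add: link_def)
      then have "\<sigma> - {v} - {u} \<subseteq> A" unfolding lk bdry_def by blast
      then have sub: "\<sigma> - {u} \<subseteq> A" using v by blast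
      have "\<sigma> - {u} \<noteq> A" using s(1) AK by metis
      then have "\<sigma> - {u} \<in> link K u" unfolding lk bdry_def using sub by blast
      then show ?thesis using True by (simp add: link_def insert_absorb)
    qed
  qed
  ultimately show ?thesis by blast
qed

theorem theorem4:
  fixes S :: "'a set set" and d n :: nat
  assumes "d \<ge> 1"
    and "combinatorial_sphere (d - 1) S"
    and "card (vertex_set S) = n"
    and "(\<exists>Ss. length Ss \<ge> 2 \<and>
            (\<forall>X\<in>set Ss. \<exists>k. combinatorial_sphere k X) \<and>
            (\<forall>i<length Ss. \<forall>j<length Ss. i \<noteq> j \<longrightarrow> vertex_set (Ss ! i) \<inter> vertex_set (Ss ! j) = {}) \<and>
            S = iterated_join Ss)
       \<or> ((\<exists>v\<in>vertex_set S. vertex_degree S v = d) \<and> n \<ge> d + 2)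
       \<or> flag_sphere (d - 1) S"
  shows "\<exists>T :: 'a set set. combinatorial_sphere d T \<and> S \<subseteq> T \<and>
           vertex_set T = vertex_set S \<and> card (vertex_set T) = n"
proof -
  have ac: "abstract_complex S" using assms(2) by (rule combinatorial_sphere_pl_sphere)
  have "pl_sphere (d - 1 + 2) (carrier_of (realization S))" using assms(2) by (rule combinatorial_sphere_pl_sphere)
  \<comment> \<open>The sphere has dimension \<open>d - 1\<close> and therefore index
    \<open>d + 1\<close>; the truncated subtraction is exact because \<open>d\<close> is
    positive.\<close>
  then have SS: "pl_sphere (Suc d) (carrier_of (realization S))" using assms(1) by simp
  have fV: "finite (\<Union>S)" using ac by (rule abstract_complex_finite_vertices)
  obtain f :: "'a \<Rightarrow> nat" where f: "inj_on f (\<Union>S)" using finite_imp_inj_to_nat_seg[OF fV] by blast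
  define b :: "'a \<Rightarrow> V" where "b v = basis_vec (f v)" for v
  have inj: "inj_on b (\<Union>S)" using f unfolding inj_on_def b_def basis_vec_inj .
  have bE: "b ` X \<subseteq> range basis_vec" for X by (auto simp: b_def)
  define K where "K = (`) b ` S"
  note ar = abstract_realization_pl_iso[OF ac inj bE]
  have K: "realized K" unfolding K_def by (rule ar(1))
  have acK: "abstract_complex K" using K by (rule realized_abstract)
  have UK: "\<Union>K = b ` \<Union>S" unfolding K_def by blast
  have KE: "\<Union>K \<subseteq> range basis_vec" unfolding UK by (rule bE)
  have cK: "card (\<Union>K) = n" unfolding UK using card_image[OF inj] assms(3) by (simp add: vertex_set_def)
  obtain R where "pl_iso R (carrier_of (realization S)) (carrier_of K)" using ar(3) unfolding K_def by blast
  from pl_sphere_pl_iso[OF pl_iso_converse[OF this] SS] have KS: "pl_sphere (Suc d) (carrier_of K)" .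
  have lift: "cone_complex (b u) K \<inter> cone_complex (b v) K \<subseteq> K \<Longrightarrow> ?thesis" if u: "u \<in> \<Union>S" and v: "v \<in> \<Union>S" for u v
  proof -
    assume lc: "cone_complex (b u) K \<inter> cone_complex (b v) K \<subseteq> K"
    \<comment> \<open>Both apexes are vertices of \<open>S\<close>, so coning from them leaves the
      vertex set unchanged.\<close>
    define T where "T = cone_complex u S \<union> cone_complex v S"
    have acT: "abstract_complex T" unfolding T_def by (intro abstract_complex_Un abstract_cone_complex ac)
    have UT: "\<Union>T = \<Union>S" unfolding T_def Union_Un_distrib cone_complex_vertices[OF ac] using u v by blast
    have bT: "(`) b ` T = cone_complex (b u) K \<union> cone_complex (b v) K"
      unfolding T_def image_Un cone_complex_image[OF inj u] cone_complex_image[OF inj v] K_def ..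
    have "pl_sphere (Suc (Suc d)) (carrier_of ((`) b ` T))" unfolding bT
      using u v by (intro sphere_from_link_condition[OF K KE KS _ _ lc]) (simp_all only: UK imageI)
    moreover note aT = abstract_realization_pl_iso[OF acT inj[folded UT] bE]
    obtain R' where "pl_iso R' (carrier_of (realization T)) (carrier_of ((`) b ` T))" using aT(3) by blast
    ultimately have "pl_sphere (d + 2) (carrier_of (realization T))" using pl_sphere_pl_iso by simp
    then obtain R'' where R'': "pl_iso R'' (carrier_of (realization T)) (carrier_of (realization (standard_sphere d)))"
      unfolding pl_sphere_def realization_standard_sphere by blast
    have gs: "realized (realization (standard_sphere d))"
      unfolding realization_standard_sphere model_sphere_def by (rule realized_bdry) auto
    have "combinatorial_sphere d T"
      unfolding combinatorial_sphere_def using acT pl_iso_imp_pl_homeomorphic[OF aT(2) gs R''] by blast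
    moreover have "S \<subseteq> T" unfolding T_def using cone_complex_superset[OF ac] by blast
    ultimately show ?thesis using UT assms(3) unfolding vertex_set_def by (intro exI[of _ T]) simp
  qed
  have lift': ?thesis if u: "u \<in> \<Union>S" and v: "v \<in> \<Union>S" and lc: "cone_complex u S \<inter> cone_complex v S \<subseteq> S" for u v
  proof (rule lift[OF u v])
    have "cone_complex (b u) K \<inter> cone_complex (b v) K = (`) b ` cone_complex u S \<inter> (`) b ` cone_complex v S"
      unfolding K_def cone_complex_image[OF inj u] cone_complex_image[OF inj v] ..
    also have "\<dots> \<subseteq> (`) b ` (cone_complex u S \<inter> cone_complex v S)"
    proof
      fix \<tau> assume "\<tau> \<in> (`) b ` cone_complex u S \<inter> (`) b ` cone_complex v S"
      then obtain \<sigma> \<rho> where s: "\<tau> = b ` \<sigma>" "\<sigma> \<in> cone_complex u S" "\<tau> = b ` \<rho>" "\<rho> \<in> cone_complex v S" by blast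
      have "\<sigma> \<subseteq> \<Union>(cone_complex u S)" "\<rho> \<subseteq> \<Union>(cone_complex v S)" using s(2,4) by blast+
      then have "\<sigma> \<subseteq> \<Union>S" "\<rho> \<subseteq> \<Union>S" unfolding cone_complex_vertices[OF ac] using u v by blast+
      then have "\<sigma> = \<rho>" using inj_on_image_eq_iff[OF inj] s(1,3) by metis
      then show "\<tau> \<in> (`) b ` (cone_complex u S \<inter> cone_complex v S)" using s by blast
    qed
    also have "\<dots> \<subseteq> K" unfolding K_def by (rule image_mono[OF lc])
    finally show "cone_complex (b u) K \<inter> cone_complex (b v) K \<subseteq> K" .
  qed
  consider (a) Ss where "length Ss \<ge> 2" "\<And>X. X \<in> set Ss \<Longrightarrow> \<exists>k. combinatorial_sphere k X"
      "\<And>i j. i < length Ss \<Longrightarrow> j < length Ss \<Longrightarrow> i \<noteq> j \<Longrightarrow> vertex_set (Ss ! i) \<inter> vertex_set (Ss ! j) = {}"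
      "S = iterated_join Ss"
    | (b) v where "v \<in> vertex_set S" "vertex_degree S v = d" "n \<ge> d + 2"
    | (c) "flag_sphere (d - 1) S"
    using assms(4) by (elim disjE exE conjE bexE) simp_all
  then show ?thesis
  proof cases
    case (a Ss)
    obtain X Y Zs where Ss: "Ss = X # Y # Zs" using a(1) by (cases Ss rule: list.exhaust; cases "tl Ss") auto
    have e: "{} \<in> Z" if "Z \<in> set Ss" for Z
      using a(2)[OF that] combinatorial_sphere_pl_sphere(1) abstract_complexD(2) by blast
    let ?J = "iterated_join (Y # Zs)"
    have J: "{} \<in> ?J" "\<Union>?J = (\<Union>Z\<in>set (Y # Zs). \<Union>Z)"
    proof -
      have "{} \<in> Z" if "Z \<in> set (Y # Zs)" for Z by (rule e) (use that in \<open>simp add: Ss\<close>)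
      note i = iterated_join_vertices[of "Y # Zs", OF this]
      show "{} \<in> ?J" by (rule conjunct1[OF i])
      show "\<Union>?J = (\<Union>Z\<in>set (Y # Zs). \<Union>Z)" by (rule conjunct2[OF i])
    qed
    have S: "S = complex_join X ?J" using a(4) unfolding Ss by simp
    have XY: "X \<in> set Ss" "Y \<in> set Ss" by (simp_all add: Ss)
    obtain k where k: "combinatorial_sphere k X" using a(2)[OF XY(1)] by (rule exE)
    \<comment> \<open>The pair consists of a vertex of the first factor and one of the second; the
      latter is a vertex of the join of all remaining factors.\<close>
    obtain u where u: "u \<in> \<Union>X" using combinatorial_sphere_vertex[OF k] by (rule exE)
    obtain l where l: "combinatorial_sphere l Y" using a(2)[OF XY(2)] by (rule exE)
    obtain v where v: "v \<in> \<Union>Y" using combinatorial_sphere_vertex[OF l] by (rule exE)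
    have vJ: "v \<in> \<Union>?J" unfolding J(2) using v by simp
    have dis: "\<Union>X \<inter> \<Union>?J = {}"
    proof -
      have "\<Union>X \<inter> \<Union>Z = {}" if Z: "Z \<in> set (Y # Zs)" for Z
      proof -
        obtain i where i: "i < length (Y # Zs)" "Z = (Y # Zs) ! i" using Z by (metis in_set_conv_nth)
        then have "vertex_set (Ss ! 0) \<inter> vertex_set (Ss ! Suc i) = {}" unfolding Ss by (intro a(3)[unfolded Ss]) simp_all
        then show ?thesis using i unfolding Ss vertex_set_def by simp
      qed
      then show ?thesis unfolding J(2) by blast
    qed
    have XS: "{} \<in> X" using e unfolding Ss by simp
    have "u \<in> \<Union>S" "v \<in> \<Union>S" using u vJ unfolding S complex_join_def by blast+
    then show ?thesis by (rule lift'[OF _ _ join_link_condition[OF XS J(1) u vJ dis S]])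
  next
    case (b v)
    have v: "v \<in> \<Union>S" using b(1) by (simp add: vertex_set_def)
    \<comment> \<open>The vertices of the link are the other ends of the edges at \<open>v\<close>,
      which turns the degree into a vertex count.\<close>
    have "bij_betw (\<lambda>w. {v, w}) (\<Union>(link S v)) {e \<in> S. card e = 2 \<and> v \<in> e}"
    proof (rule bij_betwI')
      fix x y assume "x \<in> \<Union>(link S v)" "y \<in> \<Union>(link S v)"
      then show "({v, x} = {v, y}) = (x = y)" by (auto simp: doubleton_eq_iff)
    next
      fix x assume "x \<in> \<Union>(link S v)"
      then obtain \<sigma> where s: "x \<in> \<sigma>" "v \<notin> \<sigma>" "insert v \<sigma> \<in> S" by (auto simp: link_def)
      have "{v, x} \<in> S" by (rule abstract_complexD(4)[OF ac s(3)]) (use s in blast)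
      moreover have "v \<noteq> x" using s by blast
      ultimately show "{v, x} \<in> {e \<in> S. card e = 2 \<and> v \<in> e}" by simp
    next
      fix e assume e: "e \<in> {e \<in> S. card e = 2 \<and> v \<in> e}"
      then obtain x where x: "e = {v, x}" "v \<noteq> x" by (auto simp: card_2_iff)
      then have "{x} \<in> link S v" using e by (auto simp: link_def)
      then show "\<exists>x\<in>\<Union>(link S v). e = {v, x}" using x by blast
    qed
    then have "card (\<Union>(link S v)) = vertex_degree S v" unfolding vertex_degree_def by (rule bij_betw_same_card)
    moreover have "\<Union>(link K (b v)) = b ` \<Union>(link S v)" for b' unfolding K_def link_image[OF inj v] by blast
    moreover have "inj_on b (\<Union>(link S v))" by (rule inj_on_subset[OF inj Union_mono[OF link_subset[OF ac]]])
    ultimately have "card (\<Union>(link K (b v))) = d" using b(2) by (simp add: card_image)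
    moreover have "b v \<in> \<Union>K" unfolding UK using v by (rule imageI)
    ultimately obtain w where w: "w \<in> \<Union>K" "cone_complex (b v) K \<inter> cone_complex w K \<subseteq> K"
      using degree_link_condition[OF K KS _ assms(1)] b(3) cK by blast
    obtain w' where "w = b w'" "w' \<in> \<Union>S" using w(1) unfolding UK by blast
    then show ?thesis using lift[OF v] w(2) by blast
  next
    case c
    have flag: "U \<in> S" if "clique S U" for U using c that by (simp add: flag_sphere_def)
    \<comment> \<open>For \<open>d = 1\<close> the sphere consists of two points: every clique is a
      face, but there is no edge to work with. This is the standard 0-sphere, which the definition
      of a flag sphere rules out.\<close>
    have d2: "2 \<le> d"
    proof (rule ccontr)
      assume "\<not> 2 \<le> d"
      then have d1: "d = 1" using assms(1) by simp
      then have "pl_sphere 2 (carrier_of K)" using KS by (simp add: numeral_2_eq_2)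
      note S2 = pl_sphere_2[OF K this]
      have "(`) b ` S = (`) b ` bdry (\<Union>S)"
        unfolding image_bdry[OF inj] UK[symmetric] S2(2)[symmetric] by (rule K_def[symmetric])
      moreover have "inj_on ((`) b) (Pow (\<Union>S))" by (rule inj_on_image_Pow[OF inj])
      moreover have "S \<subseteq> Pow (\<Union>S)" "bdry (\<Union>S) \<subseteq> Pow (\<Union>S)" by (auto simp: bdry_def)
      ultimately have Sbd: "S = bdry (\<Union>S)" by (metis inj_on_image_eq_iff)
      have "card (\<Union>S) = 2" using S2(1) cK assms(3) by (simp add: vertex_set_def)
      then obtain g where g: "bij_betw g (\<Union>S) {..<2::nat}" using finite_same_card_bij[OF fV, of "{..<2::nat}"] by auto
      have gi: "inj_on g (\<Union>S)" "g ` \<Union>S = {..<2}" using g by (simp_all add: bij_betw_def)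
      have "standard_sphere 0 = (`) g ` bdry (\<Union>S)" unfolding image_bdry[OF gi(1)] gi(2) standard_sphere_bdry by (simp only: add_0)
      then have "standard_sphere (d - 1) = (`) g ` S" unfolding Sbd[symmetric] d1 by simp
      then have "complex_iso S (standard_sphere (d - 1))"
        unfolding complex_iso_def vertex_set_def using gi(1) by blast
      then show False using c by (simp add: flag_sphere_def)
    qed
    obtain u where u: "u \<in> \<Union>S" using combinatorial_sphere_vertex[OF assms(2)] by (rule exE)
    have bu: "b u \<in> \<Union>K" unfolding UK using u by (rule imageI)
    \<comment> \<open>Every edge will do, and one exists because the link of \<open>u\<close> is a
      nonempty sphere once \<open>2 \<le> d\<close>.\<close>
    have "pl_sphere d (carrier_of (link K (b u)))" using link_sphere(2)[OF K KS bu] by simp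
    then have "carrier_of (link K (b u)) \<noteq> {}" using d2 by (rule pl_sphere_nonempty)
    from carrier_nonempty_vertex[OF this] obtain x where "x \<in> \<Union>(link K (b u))" by (rule exE)
    then obtain \<sigma> v where s: "\<sigma> \<in> link S u" "v \<in> \<sigma>" unfolding K_def link_image[OF inj u] by blast
    have uv: "{u, v} \<in> S" by (rule abstract_complexD(4)[OF ac, of "insert u \<sigma>"]) (use s in \<open>auto simp: link_def\<close>)
    have neq: "u \<noteq> v" using s by (auto simp: link_def)
    from uv have "v \<in> \<Union>S" by blast
    then show ?thesis by (rule lift'[OF u _ flag_link_condition[OF uv neq ac flag]])
  qed
qed

end
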